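(* For every $d\in\mathbb{N}$, $0<\delta<1$ and $0<\epsilon<1-\delta$ there exists a constant $c>0$, depending only on $d$, $\delta$ and $\epsilon$, such that the following holds. Let $\{\Omega_N\}_{N\in\mathbb{N}}$ be any uniformly $\delta$-dense sequence with bandwidths $\{K_N\}_{N\in\mathbb{N}}$, let $k\ge0$, let $0=w_0<w_1<\dots<w_k<w_{k+1}=1$, put $\eta=\min_{j=0,\dots,k}\{w_{j+1}-w_j\}$, and let $\tilde{\mathrm{T}}_{w,d}$ be the space of splines of degree $d$ on the knot sequence $w=\{w_1,\dots,w_k\}$. If $N\in\mathbb{N}$ satisfies $$\frac{1}{\eta}\le c\,K_N,$$ then the weighted least-squares reconstruction from $\tilde{\mathrm{T}}_{w,d}$ using the samples at $\Omega_N$ is stable and quasi-optimal with constant $\frac{1+\delta}{1-\epsilon-\delta}$.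
   Context: $\mathbb{N}=\{1,2,\dots\}$; $\mathrm{H}=L^2(0,1)$ (complex-valued functions) with usual norm $\|\cdot\|$; $\hat f(\omega)=\int_0^1 f(x)e^{-2\pi i\omega x}\,dx$ for $f\in\mathrm{H}$, $\omega\in\mathbb{R}$. The space of splines of degree $d$ on the knot sequence $w$ consists of the functions in $C^{d-1}[0,1]$ whose restriction to each $[w_j,w_{j+1})$, $j=0,\dots,k$, is an algebraic polynomial of degree at most $d$. Sampling points: $\{\Omega_N\}_{N\in\mathbb{N}}$ with $\Omega_N=\{\omega_{n,N}\}_{n=1}^N\subseteq\mathbb{R}$, $\omega_{1,N}<\dots<\omega_{N,N}$. The sequence is uniformly $\delta$-dense ($0<\delta<1$) with bandwidths $\{K_N\}_{N\in\mathbb{N}}\subseteq[0,\infty)$ if: (i) $K_N\to\infty$ as $N\to\infty$ and $\Omega_N\subseteq[-K_N,K_N]$ for each $N$; (ii) for each $N$, $\max_{n=0,\dots,N}\{\omega_{n+1,N}-\omega_{n,N}\}\le\delta$, where $\omega_{0,N}=\omega_{N,N}-2K_N$ and $\omega_{N+1,N}=\omega_{1,N}+2K_N$. Weights: $\mu_{n,N}=\frac12(\omega_{n+1,N}-\omega_{n-1,N})$, $n=1,\dots,N$. Weighted least-squares reconstruction from a finite-dimensional subspace $\mathrm{T}\subseteq\mathrm{H}$ using the samples at $\Omega_N$: for $f\in\mathrm{H}$, $$f_{N,\mathrm{T}}=\underset{g\in\mathrm{T}}{\operatorname{argmin}}\sum_{n=1}^N\mu_{n,N}\left|\hat f(\omega_{n,N})-\hat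 g(\omega_{n,N})\right|^2.$$ It is called stable and quasi-optimal with constant $C$ if for every $f\in\mathrm{H}$ the minimizer $f_{N,\mathrm{T}}$ exists and is unique, and $$\|f-f_{N,\mathrm{T}}\|\le C\inf_{g\in\mathrm{T}}\|f-g\|,\qquad\|f_{N,\mathrm{T}}\|\le C\|f\|\qquad\forall f\in\mathrm{H}.$$ *)

theory Defs
  imports "HOL-Analysis.Analysis" "HOL-Computational_Algebra.Polynomial"
begin

text \<open>
  Elements of \<open>L\<^sup>2(0,1)\<close> are represented by square-integrable functions on the
  real line whose values outside \<open>(0,1)\<close> are irrelevant. Equality in the space is
  equality almost everywhere on \<open>(0,1)\<close>.
\<close>

abbreviation unit_leb :: "real measure" where
  "unit_leb \<equiv> lebesgue_on {0<..<1}"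

definition L2_unit :: "(real \<Rightarrow> complex) set" where
  "L2_unit = {f. f \<in> borel_measurable unit_leb \<and> integrable unit_leb (\<lambda>x. (cmod (f x))\<^sup>2)}"

definition L2_norm_unit :: "(real \<Rightarrow> complex) \<Rightarrow> real" where
  "L2_norm_unit f = sqrt (\<integral>x. (cmod (f x))\<^sup>2 \<partial>unit_leb)"

definition fourier_unit :: "(real \<Rightarrow> complex) \<Rightarrow> real \<Rightarrow> complex" where
  "fourier_unit f \<omega> =
     (\<integral>x. f x * exp (- (2 * complex_of_real pi * \<i> * complex_of_real \<omega> * complex_of_real x)) \<partial>unit_leb)"

text \<open>
  \<open>\<Omega> N n\<close> is the \<open>n\<close>-th sampling point of the \<open>N\<close>-th sampling set, and it matters only
  for \<open>1 \<le> n \<le> N\<close>. The points with index \<open>0\<close> and \<open>N + 1\<close> come from \<open>2 K N\<close>-periodic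
  continuation of the sampling set.
\<close>

definition sample_ext :: "(nat \<Rightarrow> nat \<Rightarrow> real) \<Rightarrow> (nat \<Rightarrow> real) \<Rightarrow> nat \<Rightarrow> nat \<Rightarrow> real" where
  "sample_ext \<Omega> K N n =
     (if n = 0 then \<Omega> N N - 2 * K N
      else if n = N + 1 then \<Omega> N 1 + 2 * K N
      else \<Omega> N n)"

definition uniformly_dense :: "real \<Rightarrow> (nat \<Rightarrow> nat \<Rightarrow> real) \<Rightarrow> (nat \<Rightarrow> real) \<Rightarrow> bool" where
  "uniformly_dense \<delta> \<Omega> K \<longleftrightarrow>
     (\<forall>N\<ge>1. strict_mono_on {1..N} (\<Omega> N)) \<and>
     (\<forall>N\<ge>1. K N \<ge> 0) \<and>
     filterlim K at_top sequentially \<and>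
     (\<forall>N\<ge>1. \<Omega> N ` {1..N} \<subseteq> {- K N..K N}) \<and>
     (\<forall>N\<ge>1. (MAX n\<in>{0..N}. sample_ext \<Omega> K N (n + 1) - sample_ext \<Omega> K N n) \<le> \<delta>)"

definition sample_weight :: "(nat \<Rightarrow> nat \<Rightarrow> real) \<Rightarrow> (nat \<Rightarrow> real) \<Rightarrow> nat \<Rightarrow> nat \<Rightarrow> real" where
  "sample_weight \<Omega> K N n = (sample_ext \<Omega> K N (n + 1) - sample_ext \<Omega> K N (n - 1)) / 2"

definition wls_error ::
  "(nat \<Rightarrow> nat \<Rightarrow> real) \<Rightarrow> (nat \<Rightarrow> real) \<Rightarrow> nat \<Rightarrow> (real \<Rightarrow> complex) \<Rightarrow> (real \<Rightarrow> complex) \<Rightarrow> real" where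
  "wls_error \<Omega> K N f g =
     (\<Sum>n=1..N. sample_weight \<Omega> K N n * (cmod (fourier_unit f (\<Omega> N n) - fourier_unit g (\<Omega> N n)))\<^sup>2)"

definition wls_reconstruction ::
  "(nat \<Rightarrow> nat \<Rightarrow> real) \<Rightarrow> (nat \<Rightarrow> real) \<Rightarrow> nat \<Rightarrow> (real \<Rightarrow> complex) set \<Rightarrow>
   (real \<Rightarrow> complex) \<Rightarrow> (real \<Rightarrow> complex) \<Rightarrow> bool" where
  "wls_reconstruction \<Omega> K N T f g \<longleftrightarrow> is_arg_min (wls_error \<Omega> K N f) (\<lambda>h. h \<in> T) g"

definition stable_quasi_optimal ::
  "(nat \<Rightarrow> nat \<Rightarrow> real) \<Rightarrow> (nat \<Rightarrow> real) \<Rightarrow> nat \<Rightarrow> (real \<Rightarrow> complex) set \<Rightarrow> real \<Rightarrow> bool" where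
  "stable_quasi_optimal \<Omega> K N T C \<longleftrightarrow>
     (\<forall>f\<in>L2_unit.
        (\<exists>g. wls_reconstruction \<Omega> K N T f g) \<and>
        (\<forall>g g'. wls_reconstruction \<Omega> K N T f g \<longrightarrow> wls_reconstruction \<Omega> K N T f g' \<longrightarrow>
           (AE x in unit_leb. g x = g' x)) \<and>
        (\<forall>g. wls_reconstruction \<Omega> K N T f g \<longrightarrow>
           L2_norm_unit (\<lambda>x. f x - g x) \<le> C * (INF h\<in>T. L2_norm_unit (\<lambda>x. f x - h x)) \<and>
           L2_norm_unit g \<le> C * L2_norm_unit f))"

text \<open>
  Continuous differentiability of order \<open>m\<close> on \<open>S\<close>; \<open>D i\<close> is the \<open>i\<close>-th derivative,
  taken within \<open>S\<close>, so that it is one-sided at the end points of an interval.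
\<close>

definition Ck_on :: "nat \<Rightarrow> real set \<Rightarrow> (real \<Rightarrow> complex) \<Rightarrow> bool" where
  "Ck_on m S f \<longleftrightarrow>
     (\<exists>D. (\<forall>x\<in>S. D 0 x = f x) \<and>
          (\<forall>i<m. \<forall>x\<in>S. (D i has_vector_derivative D (Suc i) x) (at x within S)) \<and>
          continuous_on S (D m))"

text \<open>
  Splines of degree \<open>d \<ge> 1\<close> with knots \<open>0 = w 0 < w 1 < \<dots> < w k < w (k + 1) = 1\<close>.
\<close>

definition spline_space :: "nat \<Rightarrow> nat \<Rightarrow> (nat \<Rightarrow> real) \<Rightarrow> (real \<Rightarrow> complex) set" where
  "spline_space d k w =
     {f. Ck_on (d - 1) {0..1} f \<and>
         (\<forall>j\<le>k. \<exists>p. degree p \<le> d \<and>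
            (\<forall>x\<in>{w j..<w (j + 1)}. f x = poly p (complex_of_real x)))}"

end

theory Submission
  imports Defs "HOL-Probability.Characteristic_Functions"
begin

text \<open>
  The factor \<open>(1 + \<delta>) / (1 - \<epsilon> - \<delta>)\<close> is the ratio of two frame bounds for the sampled norm
  \<open>sqrt (\<Sum>n. \<mu>\<^sub>n |Ff(\<omega>\<^sub>n)|\<^sup>2)\<close>, where \<open>Ff\<close> is the Fourier transform: it is at most
  \<open>1 + \<delta>\<close> times \<open>\<parallel>f\<parallel>\<close> on all of \<open>L\<^sup>2(0,1)\<close>, and at least
  \<open>1 - \<epsilon> - \<delta>\<close> times \<open>\<parallel>f\<parallel>\<close> on splines. The weight \<open>\<mu>\<^sub>n\<close> is the length of the cell around
  \<open>\<omega>\<^sub>n\<close> cut out by the midpoints of neighbouring nodes, so the sampled norm is the \<open>L\<^sup>2\<close> norm of a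
  step function. Wirtinger's inequality on the half cells, of length at most \<open>\<delta>/2\<close>, bounds its
  distance to the transform by \<open>(\<delta>/\<pi>) \<cdot> \<pi>\<parallel>f\<parallel> = \<delta>\<parallel>f\<parallel>\<close>, once \<open>(0,1)\<close> has been
  recentred at the origin.

  The lower bound also needs that splines have little Fourier mass outside the band. Equivalence of
  norms on polynomials of degree at most \<open>d\<close> gives
  \<open>\<parallel>f(\<cdot> + t) - f\<parallel>\<^sup>2 \<le> C |t|/\<eta> \<parallel>f\<parallel>\<^sup>2\<close>, and testing the
  autocorrelation of \<open>f\<close> against a Gaussian turns this into concentration of the transform on
  frequencies of order \<open>1/\<eta>\<close>. Finally, the least-squares solution is an oblique projection \<open>P\<close>,
  and \<open>\<parallel>I - P\<parallel> = \<parallel>P\<parallel>\<close>.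
\<close>

section \<open>Wirtinger's inequality on a half interval\<close>

text \<open>Plancherel's theorem is replaced by two one-sided facts: a bounded frequency interval
  carries at most the full mass of a function on the unit interval, and a spline has almost all of
  its mass in the band. Both come from one identity, which turns a Gaussian average of the squared
  transform into a normal average of the autocorrelation. The translation estimate cannot be better
  than linear in |t|, since a spline extended by zero may jump at 0 and 1; a first absolute moment
  of the normal law is enough to exploit it. The tolerance \<epsilon> is spent in two halves. One
  pays for the mass lost to a Gaussian of width 1/\<sigma>, which fixes \<sigma> of order
  \<epsilon>\<eta>. The other pays for the tail beyond the radius R, which needs \<sigma>R of order
  1/\<epsilon>. Together they force K_N to be of order 1/(\<epsilon>^2 \<eta>), whence c. The cells
  around the nodes fill an interval of length 2 K_N whose centre may be off the origin, but by at
  most \<delta>/2; this is why R is slightly smaller than K_N.\<close>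

lemma weighted_wirtinger:
  fixes g g' :: "real \<Rightarrow> complex"
  assumes ab: "a \<le> b" and s: "0 < s" "s * (b - a) < pi / 2"
    and g: "\<And>x. x \<in> {a..b} \<Longrightarrow> (g has_vector_derivative g' x) (at x within {a..b})"
    and g': "continuous_on {a..b} g'"
    and e: "(e = b \<and> g a = 0) \<or> (e = a \<and> g b = 0)"
  shows "s\<^sup>2 * integral {a..b} (\<lambda>x. (cmod (g x))\<^sup>2) \<le> integral {a..b} (\<lambda>x. (cmod (g' x))\<^sup>2)"
proof -
  \<comment> \<open>\<open>s * T\<close> is the logarithmic derivative of the extremal function
    \<open>cos (s * (e - x))\<close>, which stays positive because
    \<open>s * (b - a) < pi / 2\<close>. Completing the square with it gives, pointwise, |g'|^2 = H'
    + |r|^2 + s^2 |g|^2.\<close>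
  define T where "T = (\<lambda>x. tan (s * (e - x)))"
  define H where "H = (\<lambda>x. s * T x * (g x \<bullet> g x))"
  define r where "r = (\<lambda>x. g' x - (s * T x) *\<^sub>R g x)"
  have cosne: "cos (s * (e - x)) \<noteq> 0" if x: "x \<in> {a..b}" for x
  proof -
    have "\<bar>s * (e - x)\<bar> \<le> s * (b - a)"
      using e x s(1) by (auto simp: abs_mult intro!: mult_left_mono)
    then have "\<bar>s * (e - x)\<bar> < pi / 2" using s(2) by linarith
    then have "cos (s * (e - x)) > 0" by (intro cos_gt_zero_pi) linarith+
    then show ?thesis by simp
  qed
  have contg: "continuous_on {a..b} g"
    by (rule continuous_on_vector_derivative) (use g in auto)
  have contT: "continuous_on {a..b} T"
    unfolding T_def using cosne by (intro continuous_intros) auto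
  have T': "(T has_real_derivative - s * (1 + (T x)\<^sup>2)) (at x within {a..b})" if "x \<in> {a..b}" for x
  proof -
    have "(T has_real_derivative inverse ((cos (s * (e - x)))\<^sup>2) * (- s)) (at x within {a..b})"
      unfolding T_def by (rule derivative_eq_intros refl cosne that | simp)+
    moreover have "inverse ((cos (s * (e - x)))\<^sup>2) = 1 + (T x)\<^sup>2"
      unfolding T_def using tan_sec[OF cosne[OF that]] by (simp add: power_inverse)
    ultimately show ?thesis by (simp add: mult.commute)
  qed
  have H': "(H has_vector_derivative
      (- s\<^sup>2 * (1 + (T x)\<^sup>2) * (g x \<bullet> g x) + 2 * s * T x * (g x \<bullet> g' x))) (at x within {a..b})"
    if x: "x \<in> {a..b}" for x
  proof -
    have 1: "((\<lambda>x. g x \<bullet> g x) has_real_derivative 2 * (g x \<bullet> g' x)) (at x within {a..b})"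
      using has_derivative_inner[OF g[OF x, unfolded has_vector_derivative_def] g[OF x, unfolded has_vector_derivative_def]]
      by (simp add: has_field_derivative_def inner_commute algebra_simps mult_commute_abs)
    show ?thesis
      unfolding H_def has_real_derivative_iff_has_vector_derivative[symmetric]
      by (rule derivative_eq_intros T'[OF x] 1 refl)+ (simp add: algebra_simps power2_eq_square)
  qed
  have "((\<lambda>x. - s\<^sup>2 * (1 + (T x)\<^sup>2) * (g x \<bullet> g x) + 2 * s * T x * (g x \<bullet> g' x))
      has_integral (H b - H a)) {a..b}"
    by (rule fundamental_theorem_of_calculus[OF ab H'])
  \<comment> \<open>At \<open>e\<close> the tangent vanishes, at the other end point
    \<open>g\<close> does.\<close>
  moreover have "H b - H a = 0" using e by (auto simp: H_def T_def)
  ultimately have I1: "((\<lambda>x. - s\<^sup>2 * (1 + (T x)\<^sup>2) * (g x \<bullet> g x) + 2 * s * T x * (g x \<bullet> g' x))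
      has_integral 0) {a..b}" by simp
  have contr: "continuous_on {a..b} r"
    unfolding r_def by (intro continuous_intros contT contg g')
  have I2: "((\<lambda>x. (cmod (r x))\<^sup>2) has_integral integral {a..b} (\<lambda>x. (cmod (r x))\<^sup>2)) {a..b}"
    by (intro integrable_integral integrable_continuous_interval continuous_intros contr)
  have I3: "((\<lambda>x. s\<^sup>2 * (cmod (g x))\<^sup>2) has_integral s\<^sup>2 * integral {a..b} (\<lambda>x. (cmod (g x))\<^sup>2)) {a..b}"
    by (intro has_integral_mult_right integrable_integral integrable_continuous_interval continuous_intros contg)
  have "(cmod (g' x))\<^sup>2 = (- s\<^sup>2 * (1 + (T x)\<^sup>2) * (g x \<bullet> g x) + 2 * s * T x * (g x \<bullet> g' x))
      + (cmod (r x))\<^sup>2 + s\<^sup>2 * (cmod (g x))\<^sup>2" for x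
    unfolding r_def power2_norm_eq_inner
    by (simp add: inner_diff_left inner_diff_right inner_commute algebra_simps power2_eq_square)
  then have "((\<lambda>x. (cmod (g' x))\<^sup>2) has_integral
      0 + integral {a..b} (\<lambda>x. (cmod (r x))\<^sup>2) + s\<^sup>2 * integral {a..b} (\<lambda>x. (cmod (g x))\<^sup>2)) {a..b}"
    using has_integral_add[OF has_integral_add[OF I1 I2] I3] by (simp cong: has_integral_cong)
  then have "integral {a..b} (\<lambda>x. (cmod (g' x))\<^sup>2)
      = integral {a..b} (\<lambda>x. (cmod (r x))\<^sup>2) + s\<^sup>2 * integral {a..b} (\<lambda>x. (cmod (g x))\<^sup>2)"
    by (simp add: integral_unique)
  moreover have "0 \<le> integral {a..b} (\<lambda>x. (cmod (r x))\<^sup>2)"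
    by (intro integral_nonneg integrable_continuous_interval continuous_intros contr) auto
  ultimately show ?thesis by linarith
qed

text \<open>The preceding lemma needs \<open>s * (b - a)\<close> strictly below
  \<open>pi / 2\<close>, where the tangent blows up. The sharp constant is reached by letting
  \<open>s\<close> tend to \<open>pi / (2 * L)\<close> from below.\<close>

lemma wirtinger_half_interval:
  fixes g g' :: "real \<Rightarrow> complex"
  assumes ab: "a \<le> b" "b - a \<le> L" and L: "0 < L"
    and g: "\<And>x. x \<in> {a..b} \<Longrightarrow> (g has_vector_derivative g' x) (at x within {a..b})"
    and g': "continuous_on {a..b} g'"
    and e: "g a = 0 \<or> g b = 0"
  shows "integral {a..b} (\<lambda>x. (cmod (g x))\<^sup>2) \<le> (2 * L / pi)\<^sup>2 * integral {a..b} (\<lambda>x. (cmod (g' x))\<^sup>2)"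
proof -
  define I where "I = integral {a..b} (\<lambda>x. (cmod (g x))\<^sup>2)"
  define J where "J = integral {a..b} (\<lambda>x. (cmod (g' x))\<^sup>2)"
  define S where "S = pi / (2 * L)"
  have S: "S > 0" using L by (simp add: S_def)
  have ev: "s\<^sup>2 * I \<le> J" if s: "0 < s" "s < S" for s
  proof -
    have "s * (b - a) \<le> s * L" using ab s by (intro mult_left_mono) auto
    also have "\<dots> < pi / 2" using s L by (simp add: S_def field_simps)
    finally have *: "s * (b - a) < pi / 2" .
    show ?thesis unfolding I_def J_def
      using e weighted_wirtinger[OF ab(1) s(1) * g g', of a] weighted_wirtinger[OF ab(1) s(1) * g g', of b]
      by auto
  qed
  have "((\<lambda>s. s\<^sup>2 * I) \<longlongrightarrow> S\<^sup>2 * I) (at_left S)" by (intro tendsto_intros)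
  moreover have "eventually (\<lambda>s. s\<^sup>2 * I \<le> J) (at_left S)"
    using eventually_at_left_real[OF S] by eventually_elim (auto intro: ev)
  ultimately have "S\<^sup>2 * I \<le> J"
    by (intro tendsto_upperbound[where F="at_left S"]) auto
  then have "I \<le> J / S\<^sup>2" using S by (simp add: field_simps)
  also have "J / S\<^sup>2 = (2 * L / pi)\<^sup>2 * J" using L by (simp add: S_def field_simps power2_eq_square)
  finally show ?thesis by (simp add: I_def J_def)
qed

section \<open>Weighted orthogonal projection\<close>

text \<open>In the induction the last coordinate is split off: the subspace is spanned by its elements
  with vanishing last coordinate and at most one further vector, which is made orthogonal to those.\<close>

lemma weighted_projection_exists:
  fixes S :: "(nat \<Rightarrow> complex) set" and \<mu> :: "nat \<Rightarrow> real"
  assumes "(\<lambda>_. 0) \<in> S" "\<And>u v a. u \<in> S \<Longrightarrow> v \<in> S \<Longrightarrow> (\<lambda>i. u i + a * v i) \<in> S"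
    and "\<And>i. i < n \<Longrightarrow> \<mu> i > 0"
  shows "\<exists>p\<in>S. \<forall>s\<in>S. (\<Sum>i<n. \<mu> i * ((y i - p i) * cnj (s i))) = 0"
  using assms
proof (induction n arbitrary: S y)
  case 0
  then show ?case by auto
next
  case (Suc n)
  define ip where "ip = (\<lambda>u v. \<Sum>i<Suc n. \<mu> i * (u i * cnj (v i)))"
  have ip_add: "ip (\<lambda>i. u i + a * v i) w = ip u w + a * ip v w" for u v w a
    by (simp add: ip_def algebra_simps sum.distrib sum_distrib_left)
  have ip_diff: "ip (\<lambda>i. u i - v i) w = ip u w - ip v w" for u v w
    by (simp add: ip_def algebra_simps sum_subtractf)
  have ip_add_right: "ip w (\<lambda>i. u i + a * v i) = ip w u + cnj a * ip w v" for u v w a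
    by (simp add: ip_def algebra_simps sum.distrib sum_distrib_left)
  have ip_cnj: "ip u v = cnj (ip v u)" for u v
    by (simp add: ip_def mult.commute)
  define S0 where "S0 = {s\<in>S. s n = 0}"
  have S0: "(\<lambda>_. 0) \<in> S0" "\<And>u v a. u \<in> S0 \<Longrightarrow> v \<in> S0 \<Longrightarrow> (\<lambda>i. u i + a * v i) \<in> S0"
    using Suc.prems(1,2) by (auto simp: S0_def)
  \<comment> \<open>Test vectors in \<open>S0\<close> annihilate the term of index \<open>n\<close>,
    so orthogonality in \<open>n\<close> coordinates is orthogonality in all
    \<open>Suc n\<close>.\<close>
  have IH: "\<exists>p\<in>S0. \<forall>s\<in>S0. ip (\<lambda>i. z i - p i) s = 0" for z
  proof -
    have "\<exists>p\<in>S0. \<forall>s\<in>S0. (\<Sum>i<n. \<mu> i * ((z i - p i) * cnj (s i))) = 0"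
      by (rule Suc.IH) (use S0 Suc.prems(3) in auto)
    then show ?thesis by (fastforce simp: ip_def S0_def)
  qed
  obtain p0 where p0: "p0 \<in> S0" "\<And>s. s \<in> S0 \<Longrightarrow> ip (\<lambda>i. y i - p0 i) s = 0" using IH by blast
  show ?case
  proof (cases "S = S0")
    case True
    then show ?thesis using p0 by (auto simp: ip_def)
  next
    case False
    then obtain e0 where e0: "e0 \<in> S" "e0 n \<noteq> 0" by (auto simp: S0_def)
    obtain q where q: "q \<in> S0" "\<And>s. s \<in> S0 \<Longrightarrow> ip (\<lambda>i. e0 i - q i) s = 0" using IH by blast
    define e where "e = (\<lambda>i. e0 i - q i)"
    have eS: "e \<in> S" using Suc.prems(2)[OF e0(1), of q "-1"] q(1) by (simp add: e_def S0_def)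
    have en: "e n \<noteq> 0" using e0 q by (simp add: e_def S0_def)
    have e_orth: "ip e s = 0" if "s \<in> S0" for s using q(2)[OF that] by (simp add: e_def)
    have e_orth': "ip s e = 0" if "s \<in> S0" for s using e_orth[OF that] ip_cnj[of s e] by simp
    have ipee: "ip e e = complex_of_real (\<Sum>i<Suc n. \<mu> i * (cmod (e i))\<^sup>2)"
      by (simp add: ip_def complex_norm_square del: sum.lessThan_Suc of_real_power)
    have "(\<Sum>i<Suc n. \<mu> i * (cmod (e i))\<^sup>2) > 0"
      by (rule sum_pos2[of _ n]) (use Suc.prems(3) en in \<open>auto simp: less_imp_le\<close>)
    then have ee: "ip e e \<noteq> 0" unfolding ipee of_real_eq_0_iff by linarith
    define c where "c = ip y e / ip e e"
    define p where "p = (\<lambda>i. p0 i + c * e i)"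
    have pS: "p \<in> S" unfolding p_def by (rule Suc.prems(2)) (use p0 eS in \<open>auto simp: S0_def\<close>)
    have 0: "ip (\<lambda>i. y i - p i) s = 0" if s: "s \<in> S" for s
    proof -
      define a where "a = s n / e n"
      define s0 where "s0 = (\<lambda>i. s i + (- a) * e i)"
      have s0: "s0 \<in> S0" using Suc.prems(2)[OF s eS, of "-a"] en by (simp add: s0_def S0_def a_def)
      have "s = (\<lambda>i. s0 i + a * e i)" by (simp add: s0_def)
      then have "ip (\<lambda>i. y i - p i) s = ip (\<lambda>i. y i - p i) s0 + cnj a * ip (\<lambda>i. y i - p i) e"
        by (metis ip_add_right)
      moreover have "ip (\<lambda>i. y i - p i) s0 = 0"
        using p0(2)[OF s0] e_orth[OF s0] by (simp add: ip_diff p_def ip_add)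
      moreover have "ip (\<lambda>i. y i - p i) e = 0"
        using e_orth'[OF p0(1)] ee ip_add[of p0 c e e] by (simp add: ip_diff p_def) (simp add: c_def)
      ultimately show ?thesis by simp
    qed
    show ?thesis using pS 0 by (auto simp: ip_def)
  qed
qed

section \<open>Polynomials on an interval\<close>

lemma cmod_add_power2_le: "(cmod (a + b))\<^sup>2 \<le> 2 * (cmod a)\<^sup>2 + 2 * (cmod b)\<^sup>2"
proof -
  have "(cmod (a + b))\<^sup>2 \<le> (cmod a + cmod b)\<^sup>2"
    by (intro power_mono norm_triangle_ineq) auto
  moreover have "0 \<le> (cmod a - cmod b)\<^sup>2" by simp
  ultimately show ?thesis by (simp add: power2_eq_square algebra_simps)
qed

lemma cmod_diff_power2_le: "(cmod (a - b))\<^sup>2 \<le> 2 * (cmod a)\<^sup>2 + 2 * (cmod b)\<^sup>2"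
  using cmod_add_power2_le[of a "- b"] by simp

lemma cmod_sum_power2_le:
  assumes "\<And>i. i \<le> d \<Longrightarrow> (cmod (z i))\<^sup>2 \<le> M"
  shows "(cmod (\<Sum>i\<le>d. z i))\<^sup>2 \<le> (real d + 1)\<^sup>2 * M"
proof -
  have M: "0 \<le> M" using assms[of 0] order_trans[OF zero_le_power2] by blast
  have "cmod (\<Sum>i\<le>d. z i) \<le> (\<Sum>i\<le>d. cmod (z i))" by (rule norm_sum)
  also have "\<dots> \<le> (\<Sum>i\<le>d. sqrt M)" by (intro sum_mono real_le_rsqrt assms) auto
  also have "\<dots> = (real d + 1) * sqrt M" by simp
  finally have "(cmod (\<Sum>i\<le>d. z i))\<^sup>2 \<le> ((real d + 1) * sqrt M)\<^sup>2" by (intro power_mono) auto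
  then show ?thesis using M by (simp add: power_mult_distrib)
qed

lemma integral_unit_affine:
  fixes f :: "real \<Rightarrow> real"
  assumes h: "h > 0" and f: "continuous_on {a..a + h} f"
  shows "integral {0..1} (\<lambda>u. f (a + h * u)) = integral {a..a + h} f / h"
proof -
  have "(f has_integral integral {a..a + h} f) (cbox a (a + h))"
    using f by (simp add: integrable_continuous_interval integrable_integral)
  from has_integral_affinity'[OF this h, of a] h
  have "((\<lambda>u. f (a + h * u)) has_integral integral {a..a + h} f / h) {0..1}"
    by (simp add: add.commute divide_inverse_commute)
  then show ?thesis by (rule integral_unique)
qed

text \<open>In the induction step \<open>q(u) - 2^(d+1) q(u/2)\<close> has no term of degree \<open>d + 1\<close>, and its
  other coefficients are at least as large as those of \<open>q\<close>.\<close>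

lemma monomial_coeff_bound:
  "\<exists>B>0. \<forall>c :: nat \<Rightarrow> complex. \<forall>i\<le>d.
     (cmod (c i))\<^sup>2 \<le> B * integral {0..1} (\<lambda>u. (cmod (\<Sum>i\<le>d. c i * of_real u ^ i))\<^sup>2)"
proof (induction d)
  case 0
  show ?case by (intro exI[of _ 1]) auto
next
  case (Suc d)
  then obtain B where B: "B > 0" and IH: "\<And>(c :: nat \<Rightarrow> complex) i. i \<le> d \<Longrightarrow>
     (cmod (c i))\<^sup>2 \<le> B * integral {0..1} (\<lambda>u. (cmod (\<Sum>i\<le>d. c i * of_real u ^ i))\<^sup>2)" by blast
  define D where "D = Suc d"
  \<comment> \<open>\<open>B'\<close> serves the coefficients of degree at most \<open>d\<close>:
    the square of q(u) - 2^D q(u/2) costs 2 |q(u)|^2 + 2 * 4^D |q(u/2)|^2, and halving the argument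
    at most doubles the integral. \<open>B''\<close> serves the leading coefficient, isolated by
    subtracting the lower terms, already bounded, from q; the factor 2D + 1 is the inverse of the
    integral of u^(2D).\<close>
  define B' where "B' = B * (2 + 4 * 4 ^ D)"
  define B'' where "B'' = (2 * real D + 1) * (2 + 2 * (real d + 1)\<^sup>2 * B')"
  have B': "B' > 0" using B by (simp add: B'_def add_pos_pos)
  have B'': "B'' > 0" using B' by (auto simp: B''_def D_def intro!: mult_pos_pos add_pos_nonneg)
  have main: "(cmod (c i))\<^sup>2 \<le> max B' B'' * integral {0..1} (\<lambda>u. (cmod (\<Sum>i\<le>Suc d. c i * of_real u ^ i))\<^sup>2)"
    if i: "i \<le> Suc d" for c :: "nat \<Rightarrow> complex" and i
  proof -
    define q where "q = (\<lambda>u::real. \<Sum>i\<le>Suc d. c i * of_real u ^ i)"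
    define r where "r = (\<lambda>u::real. \<Sum>i\<le>d. (c i * (1 - 2 ^ D / 2 ^ i)) * of_real u ^ i)"
    define J where "J = integral {0..1} (\<lambda>u. (cmod (q u))\<^sup>2)"
    have contq: "continuous_on S (\<lambda>u. (cmod (q u))\<^sup>2)" for S
      unfolding q_def by (intro continuous_intros)
    have contq2: "continuous_on S (\<lambda>u. (cmod (q (u / 2)))\<^sup>2)" for S
      unfolding q_def by (intro continuous_intros) auto
    have contr: "continuous_on S (\<lambda>u. (cmod (r u))\<^sup>2)" for S
      unfolding r_def by (intro continuous_intros)
    have J0: "J \<ge> 0" unfolding J_def
      by (intro integral_nonneg integrable_continuous_interval contq) auto
    have "r u = q u - 2 ^ D * q (u / 2)" for u
    proof -
      have "q u - 2 ^ D * q (u / 2) = (\<Sum>i\<le>Suc d. (c i * (1 - 2 ^ D / 2 ^ i)) * of_real u ^ i)"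
        by (simp add: q_def sum_distrib_left sum_subtractf[symmetric] power_divide algebra_simps
            del: sum.atMost_Suc)
      then show ?thesis by (simp add: r_def D_def)
    qed
    moreover have four: "((2::real) ^ D)\<^sup>2 = 4 ^ D"
      by (simp add: power2_eq_square flip: power_mult_distrib)
    ultimately have rb: "(cmod (r u))\<^sup>2 \<le> 2 * (cmod (q u))\<^sup>2 + 2 * 4 ^ D * (cmod (q (u / 2)))\<^sup>2" for u
      using cmod_diff_power2_le[of "q u" "2 ^ D * q (u / 2)"]
      by (simp add: norm_mult norm_power power_mult_distrib four)
    have "integral {0..1} (\<lambda>u. (cmod (q (u / 2)))\<^sup>2) = integral {0..1/2} (\<lambda>u. (cmod (q u))\<^sup>2) / (1/2)"
      using integral_unit_affine[of "1/2" 0 "\<lambda>u. (cmod (q u))\<^sup>2"] contq by simp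
    also have "\<dots> \<le> 2 * J" unfolding J_def
      using integral_subset_le[of "{0..1/2}" "{0..1}" "\<lambda>u. (cmod (q u))\<^sup>2"]
      by (simp add: integrable_continuous_interval contq)
    finally have q2: "integral {0..1} (\<lambda>u. (cmod (q (u / 2)))\<^sup>2) \<le> 2 * J" .
    have "integral {0..1} (\<lambda>u. (cmod (r u))\<^sup>2)
        \<le> integral {0..1} (\<lambda>u. 2 * (cmod (q u))\<^sup>2 + 2 * 4 ^ D * (cmod (q (u / 2)))\<^sup>2)"
      by (intro integral_le integrable_continuous_interval continuous_intros contq contq2 contr rb)
    also have "\<dots> = 2 * J + 2 * 4 ^ D * integral {0..1} (\<lambda>u. (cmod (q (u / 2)))\<^sup>2)"
      unfolding J_def
      by (subst Henstock_Kurzweil_Integration.integral_add)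
        (auto intro!: integrable_continuous_interval continuous_intros contq contq2)
    also have "\<dots> \<le> 2 * J + 2 * 4 ^ D * (2 * J)" using q2 by (intro add_mono mult_left_mono) auto
    finally have rJ: "integral {0..1} (\<lambda>u. (cmod (r u))\<^sup>2) \<le> (2 + 4 * 4 ^ D) * J" by (simp add: algebra_simps)
    have low: "(cmod (c i))\<^sup>2 \<le> B' * J" if i: "i \<le> d" for i
    proof -
      have "(2::real) ^ Suc i \<le> 2 ^ D" using i by (intro power_increasing) (auto simp: D_def)
      then have "(1::real) \<le> 2 ^ D / 2 ^ i - 1" by (simp add: field_simps)
      also have "\<dots> = - Re (1 - 2 ^ D / 2 ^ i)" by simp
      also have "\<dots> \<le> cmod (1 - 2 ^ D / 2 ^ i)" using abs_Re_le_cmod[of "1 - 2 ^ D / 2 ^ i"] by linarith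
      finally have "cmod (c i) * 1 \<le> cmod (c i) * cmod (1 - 2 ^ D / 2 ^ i)" by (intro mult_left_mono) auto
      then have "(cmod (c i))\<^sup>2 \<le> (cmod (c i * (1 - 2 ^ D / 2 ^ i)))\<^sup>2"
        by (intro power_mono) (auto simp: norm_mult)
      also have "\<dots> \<le> B * integral {0..1} (\<lambda>u. (cmod (r u))\<^sup>2)"
        unfolding r_def using IH[OF i, of "\<lambda>i. c i * (1 - 2 ^ D / 2 ^ i)"] .
      also have "\<dots> \<le> B * ((2 + 4 * 4 ^ D) * J)" using rJ B by (intro mult_left_mono) auto
      finally show ?thesis by (simp add: B'_def)
    qed
    have top: "(cmod (c D))\<^sup>2 \<le> B'' * J"
    proof -
      have pt: "(cmod (c D))\<^sup>2 * u ^ (2 * D) \<le> 2 * (cmod (q u))\<^sup>2 + 2 * ((real d + 1)\<^sup>2 * (B' * J))"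
        if u: "u \<in> {0..1}" for u
      proof -
        have "c D * of_real u ^ D = q u - (\<Sum>i\<le>d. c i * of_real u ^ i)" by (simp add: q_def D_def)
        moreover have "(cmod (c D))\<^sup>2 * u ^ (2 * D) = (cmod (c D * of_real u ^ D))\<^sup>2"
          by (simp add: norm_mult norm_power power_mult_distrib power_even_abs mult.commute
              flip: power_mult)
        ultimately have "(cmod (c D))\<^sup>2 * u ^ (2 * D) = (cmod (q u - (\<Sum>i\<le>d. c i * of_real u ^ i)))\<^sup>2"
          by simp
        also have "\<dots> \<le> 2 * (cmod (q u))\<^sup>2 + 2 * (cmod (\<Sum>i\<le>d. c i * of_real u ^ i))\<^sup>2"
          by (rule cmod_diff_power2_le)
        also have "(cmod (\<Sum>i\<le>d. c i * of_real u ^ i))\<^sup>2 \<le> (real d + 1)\<^sup>2 * (B' * J)"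
        proof (rule cmod_sum_power2_le)
          fix i assume "i \<le> d"
          have "(cmod (c i * of_real u ^ i))\<^sup>2 = (cmod (c i))\<^sup>2 * (\<bar>u\<bar> ^ i)\<^sup>2"
            by (simp add: norm_mult norm_power power_mult_distrib)
          also have "\<dots> \<le> (cmod (c i))\<^sup>2 * 1"
            using u by (intro mult_left_mono power_le_one) auto
          finally show "(cmod (c i * of_real u ^ i))\<^sup>2 \<le> B' * J" using low[OF \<open>i \<le> d\<close>] by linarith
        qed
        finally show ?thesis by simp
      qed
      have "((\<lambda>u::real. u ^ (2 * D)) has_integral (1 ^ (2 * D + 1) / (2 * real D + 1) - 0 ^ (2 * D + 1) / (2 * real D + 1))) {0..1}"
      proof (rule fundamental_theorem_of_calculus)
        fix x :: real
        have "((\<lambda>u. u ^ (2 * D + 1) / (2 * real D + 1)) has_real_derivative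
            real (2 * D + 1) * x ^ (2 * D + 1 - Suc 0) / (2 * real D + 1)) (at x within {0..1})"
          by (rule DERIV_cdivide DERIV_pow)+
        then show "((\<lambda>u. u ^ (2 * D + 1) / (2 * real D + 1)) has_vector_derivative x ^ (2 * D)) (at x within {0..1})"
          by (simp add: has_real_derivative_iff_has_vector_derivative[symmetric] del: power_Suc)
            (metis (no_types, lifting) add.commute nonzero_mult_div_cancel_left of_nat_0_le_iff
              add_pos_nonneg less_irrefl mult_nonneg_nonneg zero_le_numeral zero_less_one)
      qed simp
      then have I: "((\<lambda>u. (cmod (c D))\<^sup>2 * u ^ (2 * D)) has_integral (cmod (c D))\<^sup>2 * (1 / (2 * real D + 1))) {0..1}"
        by (intro has_integral_mult_right) auto
      have "(cmod (c D))\<^sup>2 * (1 / (2 * real D + 1)) = integral {0..1} (\<lambda>u. (cmod (c D))\<^sup>2 * u ^ (2 * D))"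
        by (rule integral_unique[OF I, symmetric])
      also have "\<dots> \<le> integral {0..1} (\<lambda>u. 2 * (cmod (q u))\<^sup>2 + 2 * ((real d + 1)\<^sup>2 * (B' * J)))"
        by (intro integral_le pt integrable_continuous_interval continuous_intros contq)
      also have "\<dots> = 2 * J + 2 * ((real d + 1)\<^sup>2 * (B' * J))"
        unfolding J_def
        by (subst Henstock_Kurzweil_Integration.integral_add)
          (auto intro!: integrable_continuous_interval continuous_intros contq)
      finally show ?thesis by (simp add: B''_def field_simps)
    qed
    have "(cmod (c i))\<^sup>2 \<le> max B' B'' * J"
    proof (cases "i \<le> d")
      case True
      then show ?thesis using low[OF True] mult_right_mono[OF max.cobounded1[of B' B''] J0] by linarith
    next
      case False
      then have "i = D" using i by (simp add: D_def)
      then show ?thesis using top mult_right_mono[OF max.cobounded2[of B'' B'] J0] by auto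
    qed
    then show ?thesis by (simp add: J_def q_def)
  qed
  show ?case using B' main by (intro exI[of _ "max B' B''"]) auto
qed

lemma power_diff_le:
  fixes u v :: real
  assumes "0 \<le> u" "u \<le> 1" "0 \<le> v" "v \<le> 1"
  shows "\<bar>u ^ i - v ^ i\<bar> \<le> real i * \<bar>u - v\<bar>"
proof -
  have "norm (u ^ i - v ^ i) \<le> real i * norm (u - v)"
    by (rule norm_power_diff) (use assms in auto)
  then show ?thesis by simp
qed

text \<open>Rescaling [a, a + h] to [0, 1] makes the constant depend on \<open>d\<close> only. There
  both values and differences are controlled by the coefficients, the latter because |u^i - v^i| is
  at most i |u - v|.\<close>

lemma poly_pointwise_bounds:
  obtains C where "C \<ge> 1"
    "\<And>p a h x. degree p \<le> d \<Longrightarrow> h > 0 \<Longrightarrow> x \<in> {a..a + h} \<Longrightarrow>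
      (cmod (poly p (of_real x)))\<^sup>2 \<le> C / h * integral {a..a + h} (\<lambda>x. (cmod (poly p (of_real x)))\<^sup>2)"
    "\<And>p a h x y. degree p \<le> d \<Longrightarrow> h > 0 \<Longrightarrow> x \<in> {a..a + h} \<Longrightarrow> y \<in> {a..a + h} \<Longrightarrow>
      (cmod (poly p (of_real x) - poly p (of_real y)))\<^sup>2
        \<le> (\<bar>x - y\<bar> / h)\<^sup>2 * (C / h * integral {a..a + h} (\<lambda>x. (cmod (poly p (of_real x)))\<^sup>2))"
proof -
  obtain B where B: "B > 0" and co: "\<And>(c :: nat \<Rightarrow> complex) i. i \<le> d \<Longrightarrow>
     (cmod (c i))\<^sup>2 \<le> B * integral {0..1} (\<lambda>u. (cmod (\<Sum>i\<le>d. c i * of_real u ^ i))\<^sup>2)"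
    using monomial_coeff_bound[of d] by blast
  \<comment> \<open>One factor (d + 1)^2 comes from summing d + 1 terms, the other absorbs the
    factor i^2 of the difference estimate, so that a single constant serves both bounds.\<close>
  define C where "C = max 1 ((real d + 1)\<^sup>2 * ((real d + 1)\<^sup>2 * B))"
  have bounds: "(cmod (poly p (of_real x)))\<^sup>2 \<le> C / h * J \<and>
      (cmod (poly p (of_real x) - poly p (of_real y)))\<^sup>2 \<le> (\<bar>x - y\<bar> / h)\<^sup>2 * (C / h * J)"
    if p: "degree p \<le> d" and h: "h > 0" and x: "x \<in> {a..a + h}" and y: "y \<in> {a..a + h}"
      and J: "J = integral {a..a + h} (\<lambda>x. (cmod (poly p (of_real x)))\<^sup>2)"
    for p a h x y J
  proof -
    define q where "q = pcompose p [:of_real a, of_real h:]"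
    define I where "I = integral {0..1} (\<lambda>u. (cmod (\<Sum>i\<le>d. coeff q i * of_real u ^ i))\<^sup>2)"
    have "degree q \<le> d"
      using degree_pcompose_le[of p "[:complex_of_real a, of_real h:]"] p h by (auto simp: q_def)
    then have qsum: "(\<Sum>i\<le>d. coeff q i * z ^ i) = poly q z" for z
      by (subst poly_as_sum_of_monoms'[symmetric, of q d]) (auto simp: poly_sum poly_monom)
    have pq: "poly p (of_real (a + h * u)) = poly q (of_real u)" for u :: real
      by (simp add: q_def poly_pcompose mult.commute)
    have IJ: "I = J / h"
      using integral_unit_affine[OF h, of a "\<lambda>x. (cmod (poly p (of_real x)))\<^sup>2"]
      by (simp add: I_def qsum pq[symmetric] J continuous_intros)
    have I0: "0 \<le> I" unfolding I_def
      by (intro integral_nonneg integrable_continuous_interval continuous_intros) auto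
    have CI: "(real d + 1)\<^sup>2 * ((real d + 1)\<^sup>2 * (B * I)) \<le> C * I"
      using mult_right_mono[OF max.cobounded2[of "(real d + 1)\<^sup>2 * ((real d + 1)\<^sup>2 * B)" 1] I0]
      by (simp add: C_def mult.assoc)
    have coq: "(cmod (coeff q i))\<^sup>2 \<le> B * I" if "i \<le> d" for i
      unfolding I_def using co[OF that] .
    define u where "u = (x - a) / h"
    define v where "v = (y - a) / h"
    have uv: "u \<in> {0..1}" "v \<in> {0..1}" using x y h by (auto simp: u_def v_def)
    have xu: "x = a + h * u" and yv: "y = a + h * v" using h by (auto simp: u_def v_def)
    have "(cmod (poly q (of_real u)))\<^sup>2 \<le> (real d + 1)\<^sup>2 * (B * I)"
      unfolding qsum[symmetric]
    proof (rule cmod_sum_power2_le)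
      fix i assume "i \<le> d"
      have "(cmod (coeff q i * of_real u ^ i))\<^sup>2 = (cmod (coeff q i))\<^sup>2 * (\<bar>u\<bar> ^ i)\<^sup>2"
        by (simp add: norm_mult norm_power power_mult_distrib)
      also have "\<dots> \<le> (cmod (coeff q i))\<^sup>2 * 1"
        using uv by (intro mult_left_mono power_le_one) auto
      finally show "(cmod (coeff q i * of_real u ^ i))\<^sup>2 \<le> B * I" using coq[OF \<open>i \<le> d\<close>] by linarith
    qed
    also have "\<dots> \<le> (real d + 1)\<^sup>2 * ((real d + 1)\<^sup>2 * (B * I))"
    proof (intro mult_left_mono)
      show "B * I \<le> (real d + 1)\<^sup>2 * (B * I)"
        using mult_right_mono[of 1 "(real d + 1)\<^sup>2" "B * I"] B I0 by (simp add: one_le_power)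
    qed auto
    finally have 1: "(cmod (poly q (of_real u)))\<^sup>2 \<le> C * I" using CI by linarith
    have "poly q (of_real u) - poly q (of_real v) = (\<Sum>i\<le>d. coeff q i * (of_real u ^ i - of_real v ^ i))"
      by (simp add: qsum[symmetric] sum_subtractf[symmetric] algebra_simps)
    also have "(cmod \<dots>)\<^sup>2 \<le> (real d + 1)\<^sup>2 * ((u - v)\<^sup>2 * ((real d + 1)\<^sup>2 * (B * I)))"
    proof (rule cmod_sum_power2_le)
      fix i assume i: "i \<le> d"
      have "cmod (of_real u ^ i - of_real v ^ i) = \<bar>u ^ i - v ^ i\<bar>"
        by (simp flip: of_real_power of_real_diff)
      also have "\<dots> \<le> real i * \<bar>u - v\<bar>" using uv by (intro power_diff_le) auto
      also have "\<dots> \<le> (real d + 1) * \<bar>u - v\<bar>" using i by (intro mult_right_mono) auto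
      finally have "(cmod (of_real u ^ i - of_real v ^ i))\<^sup>2 \<le> ((real d + 1) * \<bar>u - v\<bar>)\<^sup>2"
        by (intro power_mono) auto
      then have "(cmod (coeff q i))\<^sup>2 * (cmod (of_real u ^ i - of_real v ^ i))\<^sup>2
          \<le> (B * I) * ((real d + 1) * \<bar>u - v\<bar>)\<^sup>2"
        using coq[OF i] B I0 by (intro mult_mono) auto
      then show "(cmod (coeff q i * (of_real u ^ i - of_real v ^ i)))\<^sup>2
          \<le> (u - v)\<^sup>2 * ((real d + 1)\<^sup>2 * (B * I))"
        by (simp add: norm_mult power_mult_distrib ac_simps)
    qed
    also have "\<dots> = (u - v)\<^sup>2 * ((real d + 1)\<^sup>2 * ((real d + 1)\<^sup>2 * (B * I)))" by (simp add: ac_simps)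
    also have "\<dots> \<le> (u - v)\<^sup>2 * (C * I)" using CI by (intro mult_left_mono) auto
    also have "(u - v)\<^sup>2 = (\<bar>x - y\<bar> / h)\<^sup>2"
      by (simp add: u_def v_def power_divide diff_divide_distrib[symmetric])
    finally show ?thesis using 1 by (simp add: IJ xu[symmetric] yv[symmetric] flip: pq)
  qed
  show thesis
    by (rule that[of C]) (use bounds in \<open>auto simp: C_def\<close>)
qed

section \<open>Translates of piecewise polynomials\<close>

lemma lborel_integral_Ico:
  fixes f :: "real \<Rightarrow> real"
  assumes f: "continuous_on {a..b} f"
  shows "integrable lborel (\<lambda>x. indicator {a..<b} x * f x)"
    and "(\<integral>x. indicator {a..<b} x * f x \<partial>lborel) = integral {a..b} f"
proof -
  have 1: "set_integrable lborel {a..b} f" by (rule borel_integrable_atLeastAtMost'[OF f])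
  then have 2: "set_integrable lborel {a..<b} f" by (rule set_integrable_subset) auto
  show "integrable lborel (\<lambda>x. indicator {a..<b} x * f x)"
    using 2 by (simp add: set_integrable_def)
  have "AE x in lborel. indicator {a..<b} x * f x = indicator {a..b} x * f x"
    using AE_lborel_singleton[of b] by eventually_elim (auto simp: indicator_def)
  then have "(\<integral>x. indicator {a..<b} x * f x \<partial>lborel) = (\<integral>x. indicator {a..b} x * f x \<partial>lborel)"
    using 1 2 by (intro integral_cong_AE) (auto simp: set_integrable_def)
  then show "(\<integral>x. indicator {a..<b} x * f x \<partial>lborel) = integral {a..b} f"
    using set_borel_integral_eq_integral(2)[OF 1] by (simp add: set_lebesgue_integral_def)
qed

text \<open>Half-open pieces make the summands disjointly supported. Outside the knots the function
  is zero, which makes translates meaningful on the whole line at the price of possible jumps at the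
  two outer knots.\<close>

definition piecewise_poly :: "nat \<Rightarrow> (nat \<Rightarrow> real) \<Rightarrow> (nat \<Rightarrow> complex poly) \<Rightarrow> real \<Rightarrow> complex" where
  "piecewise_poly k w p x = (\<Sum>j\<le>k. indicator {w j..<w (Suc j)} x * poly (p j) (of_real x))"

context
  fixes k :: nat and w :: "nat \<Rightarrow> real"
  assumes w: "\<And>j. j \<le> k \<Longrightarrow> w j < w (Suc j)"
begin

lemma knots_mono: "i \<le> j \<Longrightarrow> j \<le> Suc k \<Longrightarrow> w i \<le> w j"
proof (induction j)
  case (Suc j)
  then show ?case using w[of j] by (cases "i = Suc j") auto
qed simp

lemma knot_interval_unique:
  assumes "i \<le> k" "j \<le> k" "x \<in> {w i..<w (Suc i)}" "x \<in> {w j..<w (Suc j)}"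
  shows "i = j"
proof (rule ccontr)
  assume "i \<noteq> j"
  then consider "Suc i \<le> j" | "Suc j \<le> i" by linarith
  then show False
    using assms knots_mono[of "Suc i" j] knots_mono[of "Suc j" i] by cases auto
qed

lemma knot_interval_exists:
  assumes "x \<in> {w 0..<w (Suc n)}"
  shows "\<exists>j\<le>n. x \<in> {w j..<w (Suc j)}"
  using assms
proof (induction n)
  case (Suc n)
  show ?case
  proof (cases "x < w (Suc n)")
    case True
    then show ?thesis using Suc by (auto intro: le_SucI)
  next
    case False
    then show ?thesis using Suc.prems by (intro exI[of _ "Suc n"]) auto
  qed
qed auto

lemma sum_indicator_knots:
  assumes "j \<le> k" "x \<in> {w j..<w (Suc j)}"
  shows "(\<Sum>i\<le>k. indicator {w i..<w (Suc i)} x * f i) = (f j :: 'a :: real_normed_algebra_1)"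
proof -
  have "(\<Sum>i\<le>k. indicator {w i..<w (Suc i)} x * f i) = (\<Sum>i\<le>k. if i = j then f i else 0)"
  proof (intro sum.cong refl)
    fix i assume "i \<in> {..k}"
    then have "x \<notin> {w i..<w (Suc i)}" if "i \<noteq> j"
      using knot_interval_unique[OF _ assms(1) _ assms(2), of i] that by blast
    then show "indicator {w i..<w (Suc i)} x * f i = (if i = j then f i else 0)"
      using assms(2) by (cases "i = j") (simp_all only: indicator_simps, simp_all)
  qed
  then show ?thesis using assms(1) by (simp add: sum.delta)
qed

lemma piecewise_poly_eq:
  "j \<le> k \<Longrightarrow> x \<in> {w j..<w (Suc j)} \<Longrightarrow> piecewise_poly k w p x = poly (p j) (of_real x)"
  unfolding piecewise_poly_def by (rule sum_indicator_knots)

lemma piecewise_poly_outside: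
  "(\<And>j. j \<le> k \<Longrightarrow> x \<notin> {w j..<w (Suc j)}) \<Longrightarrow> piecewise_poly k w p x = 0"
  unfolding piecewise_poly_def by (intro sum.neutral) (auto simp: indicator_def)

lemma piecewise_poly_cmod2:
  "(cmod (piecewise_poly k w p x))\<^sup>2
    = (\<Sum>j\<le>k. indicator {w j..<w (Suc j)} x * (cmod (poly (p j) (of_real x)))\<^sup>2)"
proof (cases "\<exists>j\<le>k. x \<in> {w j..<w (Suc j)}")
  case True
  then obtain j where j: "j \<le> k" "x \<in> {w j..<w (Suc j)}" by blast
  show ?thesis by (simp only: piecewise_poly_eq[OF j] sum_indicator_knots[OF j])
next
  case False
  then have "piecewise_poly k w p x = 0" by (intro piecewise_poly_outside) auto
  moreover have "(\<Sum>j\<le>k. indicator {w j..<w (Suc j)} x * (cmod (poly (p j) (of_real x)))\<^sup>2) = 0"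
    using False by (intro sum.neutral) (auto simp: indicator_def)
  ultimately show ?thesis by simp
qed

lemma piecewise_poly_measurable [measurable]: "piecewise_poly k w p \<in> borel_measurable borel"
proof -
  have "(\<lambda>x. poly (p j) (complex_of_real x)) \<in> borel_measurable borel" for j
    by (intro borel_measurable_continuous_onI continuous_intros)
  then show ?thesis unfolding piecewise_poly_def [abs_def]
    by (intro borel_measurable_sum borel_measurable_times) auto
qed

lemma piecewise_poly_sq_integral:
  "integrable lborel (\<lambda>x. (cmod (piecewise_poly k w p x))\<^sup>2)"
  "(\<integral>x. (cmod (piecewise_poly k w p x))\<^sup>2 \<partial>lborel)
    = (\<Sum>j\<le>k. integral {w j..w (Suc j)} (\<lambda>x. (cmod (poly (p j) (of_real x)))\<^sup>2))"
proof -
  have *: "continuous_on S (\<lambda>x. (cmod (poly (p j) (of_real x)))\<^sup>2)" for S j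
    by (intro continuous_intros)
  show "integrable lborel (\<lambda>x. (cmod (piecewise_poly k w p x))\<^sup>2)"
    unfolding piecewise_poly_cmod2
    by (intro Bochner_Integration.integrable_sum lborel_integral_Ico *)
  show "(\<integral>x. (cmod (piecewise_poly k w p x))\<^sup>2 \<partial>lborel)
    = (\<Sum>j\<le>k. integral {w j..w (Suc j)} (\<lambda>x. (cmod (poly (p j) (of_real x)))\<^sup>2))"
    unfolding piecewise_poly_cmod2
    by (subst Bochner_Integration.integral_sum)
      (auto intro!: lborel_integral_Ico * sum.cong)
qed

text \<open>If \<open>x\<close> and \<open>x + t\<close> lie in the same knot interval, then smoothness of the
  polynomial gives the bound. Otherwise \<open>x\<close> is within distance \<open>t\<close> of the right end
  of its own interval and of the left end of that of \<open>x + t\<close>.\<close>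

lemma piecewise_poly_translation_pointwise:
  fixes m :: "nat \<Rightarrow> real"
  assumes t: "t \<ge> 0"
    and m: "\<And>j x. j \<le> k \<Longrightarrow> x \<in> {w j..<w (Suc j)} \<Longrightarrow> (cmod (poly (p j) (of_real x)))\<^sup>2 \<le> m j"
    and m': "\<And>j x y. j \<le> k \<Longrightarrow> x \<in> {w j..<w (Suc j)} \<Longrightarrow> y \<in> {w j..<w (Suc j)} \<Longrightarrow>
      (cmod (poly (p j) (of_real x) - poly (p j) (of_real y)))\<^sup>2
        \<le> (\<bar>x - y\<bar> / (w (Suc j) - w j))\<^sup>2 * m j"
  shows "(cmod (piecewise_poly k w p (x + t) - piecewise_poly k w p x))\<^sup>2 \<le>
     (\<Sum>j\<le>k. m j * (t / (w (Suc j) - w j) * indicator {w j..<w (Suc j)} x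
        + 2 * indicator {w (Suc j) - t..<w (Suc j)} x + 2 * indicator {w j - t..<w j} x))"
  (is "?L \<le> (\<Sum>j\<le>k. ?b j)")
proof -
  let ?F = "piecewise_poly k w p"
  have m0: "0 \<le> m j" if "j \<le> k" for j
    using m[OF that, of "w j"] w[OF that] order_trans[OF zero_le_power2] by fastforce
  have b0: "0 \<le> ?b j" if "j \<le> k" for j
    using m0[OF that] w[OF that] t by (intro mult_nonneg_nonneg add_nonneg_nonneg) auto
  show ?thesis
  proof (cases "\<exists>j\<le>k. x \<in> {w j..<w (Suc j)} \<and> x + t \<in> {w j..<w (Suc j)}")
    case True
    then obtain j where j: "j \<le> k" "x \<in> {w j..<w (Suc j)}" "x + t \<in> {w j..<w (Suc j)}" by blast
    define h where "h = w (Suc j) - w j"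
    have h: "h > 0" "t \<le> h" using j by (auto simp: h_def)
    have "?L \<le> (\<bar>(x + t) - x\<bar> / h)\<^sup>2 * m j"
      using m'[OF j(1,3,2)] by (simp only: piecewise_poly_eq[OF j(1,2)] piecewise_poly_eq[OF j(1,3)] h_def)
    also have "\<dots> = t / h * (t / h * m j)" using t by (simp add: power2_eq_square)
    \<comment> \<open>Both points lie in one interval of length \<open>h\<close>, so
      \<open>t / h\<close> is at most 1. The quadratic gain is given up for the linear rate that the
      jump terms have anyway.\<close>
    also have "\<dots> \<le> 1 * (t / h * m j)" using h t m0[OF j(1)] by (intro mult_right_mono) auto
    also have "\<dots> \<le> ?b j" using j m0[OF j(1)] t h
      by (auto simp: h_def[symmetric] algebra_simps intro!: add_nonneg_nonneg)
    also have "\<dots> \<le> (\<Sum>j\<le>k. ?b j)" by (rule member_le_sum) (use j b0 in auto)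
    finally show ?thesis .
  next
    case False
    have A: "2 * (cmod (?F x))\<^sup>2 \<le> (\<Sum>j\<le>k. m j * (2 * indicator {w (Suc j) - t..<w (Suc j)} x))"
    proof (cases "\<exists>j\<le>k. x \<in> {w j..<w (Suc j)}")
      case True
      then obtain j where j: "j \<le> k" "x \<in> {w j..<w (Suc j)}" by blast
      then have "x \<in> {w (Suc j) - t..<w (Suc j)}" using False t by fastforce
      then have "2 * (cmod (?F x))\<^sup>2 \<le> m j * (2 * indicator {w (Suc j) - t..<w (Suc j)} x)"
        using m[OF j] by (simp add: piecewise_poly_eq[OF j])
      also have "\<dots> \<le> (\<Sum>j\<le>k. m j * (2 * indicator {w (Suc j) - t..<w (Suc j)} x))"
        by (rule member_le_sum) (use j m0 in auto)
      finally show ?thesis .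
    next
      case False
      then have "?F x = 0" by (intro piecewise_poly_outside) auto
      then show ?thesis using m0 by (auto intro!: sum_nonneg)
    qed
    have B: "2 * (cmod (?F (x + t)))\<^sup>2 \<le> (\<Sum>j\<le>k. m j * (2 * indicator {w j - t..<w j} x))"
    proof (cases "\<exists>j\<le>k. x + t \<in> {w j..<w (Suc j)}")
      case True
      then obtain j where j: "j \<le> k" "x + t \<in> {w j..<w (Suc j)}" by blast
      then have "x \<in> {w j - t..<w j}" using False t by fastforce
      then have "2 * (cmod (?F (x + t)))\<^sup>2 \<le> m j * (2 * indicator {w j - t..<w j} x)"
        using m[OF j] by (simp add: piecewise_poly_eq[OF j] del: of_real_add)
      also have "\<dots> \<le> (\<Sum>j\<le>k. m j * (2 * indicator {w j - t..<w j} x))"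
        by (rule member_le_sum) (use j m0 in auto)
      finally show ?thesis .
    next
      case False
      then have "?F (x + t) = 0" by (intro piecewise_poly_outside) auto
      then show ?thesis using m0 by (auto intro!: sum_nonneg)
    qed
    have "?L \<le> 2 * (cmod (?F (x + t)))\<^sup>2 + 2 * (cmod (?F x))\<^sup>2" by (rule cmod_diff_power2_le)
    also have "\<dots> \<le> (\<Sum>j\<le>k. m j * (2 * indicator {w (Suc j) - t..<w (Suc j)} x + 2 * indicator {w j - t..<w j} x))"
      using A B by (simp add: distrib_left sum.distrib)
    also have "\<dots> \<le> (\<Sum>j\<le>k. ?b j)"
    proof (intro sum_mono mult_left_mono)
      fix j assume "j \<in> {..k}"
      then show "0 \<le> m j" using m0 by auto
      have "0 \<le> t / (w (Suc j) - w j) * indicator {w j..<w (Suc j)} x"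
        using t w[of j] \<open>j \<in> {..k}\<close> by auto
      then show "2 * indicator {w (Suc j) - t..<w (Suc j)} x + 2 * indicator {w j - t..<w j} x
        \<le> t / (w (Suc j) - w j) * indicator {w j..<w (Suc j)} x
        + 2 * indicator {w (Suc j) - t..<w (Suc j)} x + 2 * indicator {w j - t..<w j} x"
        by linarith
    qed
    finally show ?thesis .
  qed
qed

text \<open>Integrating the pointwise bound, the piece \<open>j\<close> contributes
  \<open>m j\<close> times t + 2t + 2t: the smooth part, its right end and its left end. This is the
  factor 5. The remaining \<open>1 / h j\<close> in \<open>m j\<close> is at most 1/\<eta>.\<close>

lemma piecewise_poly_translation_aux:
  assumes t: "t \<ge> 0" and \<eta>: "\<eta> > 0" "\<And>j. j \<le> k \<Longrightarrow> \<eta> \<le> w (Suc j) - w j"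
    and p: "\<And>j. j \<le> k \<Longrightarrow> degree (p j) \<le> d" and C: "C \<ge> 1"
    and C1: "\<And>p a h x. degree p \<le> d \<Longrightarrow> h > 0 \<Longrightarrow> x \<in> {a..a + h} \<Longrightarrow>
      (cmod (poly p (of_real x)))\<^sup>2 \<le> C / h * integral {a..a + h} (\<lambda>x. (cmod (poly p (of_real x)))\<^sup>2)"
    and C2: "\<And>p a h x y. degree p \<le> d \<Longrightarrow> h > 0 \<Longrightarrow> x \<in> {a..a + h} \<Longrightarrow> y \<in> {a..a + h} \<Longrightarrow>
      (cmod (poly p (of_real x) - poly p (of_real y)))\<^sup>2
        \<le> (\<bar>x - y\<bar> / h)\<^sup>2 * (C / h * integral {a..a + h} (\<lambda>x. (cmod (poly p (of_real x)))\<^sup>2))"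
  shows "(\<integral>x. (cmod (piecewise_poly k w p (x + t) - piecewise_poly k w p x))\<^sup>2 \<partial>lborel)
    \<le> 5 * C * t / \<eta> * (\<integral>x. (cmod (piecewise_poly k w p x))\<^sup>2 \<partial>lborel)"
proof -
  define I where "I j = integral {w j..w (Suc j)} (\<lambda>x. (cmod (poly (p j) (of_real x)))\<^sup>2)" for j
  define h where "h j = w (Suc j) - w j" for j
  define m where "m j = C / h j * I j" for j
  define b where "b j x = m j * (t / h j * indicator {w j..<w (Suc j)} x
        + 2 * indicator {w (Suc j) - t..<w (Suc j)} x + 2 * indicator {w j - t..<w j} x)" for j x
  have h: "h j > 0" "\<eta> \<le> h j" if "j \<le> k" for j using w[OF that] \<eta>(2)[OF that] by (auto simp: h_def)
  have I0: "0 \<le> I j" for j unfolding I_def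
    by (intro integral_nonneg integrable_continuous_interval continuous_intros) auto
  have m0: "0 \<le> m j" if "j \<le> k" for j using h[OF that] I0 C by (simp add: m_def)
  have pt: "(cmod (piecewise_poly k w p (x + t) - piecewise_poly k w p x))\<^sup>2 \<le> (\<Sum>j\<le>k. b j x)" for x
    unfolding b_def h_def
  proof (rule piecewise_poly_translation_pointwise[OF t])
    fix j x y assume j: "j \<le> k" and x: "x \<in> {w j..<w (Suc j)}"
    show "(cmod (poly (p j) (of_real x)))\<^sup>2 \<le> m j"
      using C1[OF p[OF j] h(1)[OF j], of x "w j"] x by (simp add: m_def I_def h_def)
    assume y: "y \<in> {w j..<w (Suc j)}"
    show "(cmod (poly (p j) (of_real x) - poly (p j) (of_real y)))\<^sup>2
        \<le> (\<bar>x - y\<bar> / (w (Suc j) - w j))\<^sup>2 * m j"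
      using C2[OF p[OF j] h(1)[OF j], of x "w j" y] x y by (simp add: m_def I_def h_def)
  qed
  have ind: "has_bochner_integral lborel (\<lambda>x. indicator {a..<a'} x :: real) (a' - a)"
    if "a \<le> a'" for a a' :: real
    using that by (simp add: has_bochner_integral_iff)
  have bint: "has_bochner_integral lborel (b j) (5 * t * m j)" if j: "j \<le> k" for j
  proof -
    have "has_bochner_integral lborel (b j) (m j * (t / h j * (w (Suc j) - w j)
        + 2 * (w (Suc j) - (w (Suc j) - t)) + 2 * (w j - (w j - t))))"
      unfolding b_def
      by (intro has_bochner_integral_mult_right has_bochner_integral_add ind) (use t w[OF j] in auto)
    moreover have "m j * (t / h j * (w (Suc j) - w j)
        + 2 * (w (Suc j) - (w (Suc j) - t)) + 2 * (w j - (w j - t))) = 5 * t * m j"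
      using h(1)[OF j] by (simp add: h_def field_simps)
    ultimately show ?thesis by (simp only:)
  qed
  have "(\<integral>x. (cmod (piecewise_poly k w p (x + t) - piecewise_poly k w p x))\<^sup>2 \<partial>lborel)
      \<le> (\<integral>x. (\<Sum>j\<le>k. b j x) \<partial>lborel)"
  proof (rule integral_mono'[OF _ pt])
    show "integrable lborel (\<lambda>x. \<Sum>j\<le>k. b j x)"
      using bint by (intro Bochner_Integration.integrable_sum) (auto simp: has_bochner_integral_iff)
    show "0 \<le> (\<Sum>j\<le>k. b j x)" for x by (rule order_trans[OF _ pt]) simp
  qed
  also have "\<dots> = (\<Sum>j\<le>k. 5 * t * m j)"
    using bint by (subst Bochner_Integration.integral_sum) (auto simp: has_bochner_integral_iff)
  also have "\<dots> \<le> (\<Sum>j\<le>k. 5 * C * t / \<eta> * I j)"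
  proof (rule sum_mono)
    fix j assume "j \<in> {..k}"
    then have j: "j \<le> k" by simp
    have "C / h j \<le> C / \<eta>" using h[OF j] \<eta> C by (intro divide_left_mono) auto
    then have "m j \<le> C / \<eta> * I j" unfolding m_def using I0 by (intro mult_right_mono)
    then have "5 * t * m j \<le> 5 * t * (C / \<eta> * I j)" using t by (intro mult_left_mono) auto
    then show "5 * t * m j \<le> 5 * C * t / \<eta> * I j" by (simp add: ac_simps)
  qed
  also have "\<dots> = 5 * C * t / \<eta> * (\<integral>x. (cmod (piecewise_poly k w p x))\<^sup>2 \<partial>lborel)"
    by (simp add: piecewise_poly_sq_integral(2) I_def sum_distrib_left)
  finally show ?thesis .
qed

end

text \<open>The constant is obtained before knots and polynomials are chosen, so it depends on
  \<open>d\<close> only; the final constant \<open>c\<close> inherits its uniformity from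
  this.\<close>

lemma piecewise_poly_translation:
  obtains C where "C \<ge> 1"
    "\<And>k w p \<eta> t. (\<And>j. j \<le> k \<Longrightarrow> w j < w (Suc j)) \<Longrightarrow> \<eta> > 0 \<Longrightarrow>
      (\<And>j. j \<le> k \<Longrightarrow> \<eta> \<le> w (Suc j) - w j) \<Longrightarrow> (\<And>j. j \<le> k \<Longrightarrow> degree (p j) \<le> d) \<Longrightarrow>
      (\<integral>x. (cmod (piecewise_poly k w p (x + t) - piecewise_poly k w p x))\<^sup>2 \<partial>lborel)
        \<le> 5 * C * \<bar>t\<bar> / \<eta> * (\<integral>x. (cmod (piecewise_poly k w p x))\<^sup>2 \<partial>lborel)"
proof (rule poly_pointwise_bounds[of d], goal_cases)
  case (1 C)
  note C = 1(2-)
  show thesis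
  proof (rule that[OF C(1)])
    fix k :: nat and w :: "nat \<Rightarrow> real" and p :: "nat \<Rightarrow> complex poly" and \<eta> t :: real
    assume a: "\<And>j. j \<le> k \<Longrightarrow> w j < w (Suc j)" "\<eta> > 0"
      "\<And>j. j \<le> k \<Longrightarrow> \<eta> \<le> w (Suc j) - w j" "\<And>j. j \<le> k \<Longrightarrow> degree (p j) \<le> d"
    let ?F = "piecewise_poly k w p"
    have aux: "(\<integral>x. (cmod (?F (x + t) - ?F x))\<^sup>2 \<partial>lborel) \<le> 5 * C * t / \<eta> * (\<integral>x. (cmod (?F x))\<^sup>2 \<partial>lborel)"
      if "t \<ge> 0" for t
      by (rule piecewise_poly_translation_aux[of k w t \<eta> p d C]) (fact a C that)+
    show "(\<integral>x. (cmod (?F (x + t) - ?F x))\<^sup>2 \<partial>lborel)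
        \<le> 5 * C * \<bar>t\<bar> / \<eta> * (\<integral>x. (cmod (?F x))\<^sup>2 \<partial>lborel)"
    proof (cases "t \<ge> 0")
      case True
      then show ?thesis using aux[of t] by simp
    next
      case False
      \<comment> \<open>Substituting x - t for x turns a shift to the left into a shift to the
        right.\<close>
      have "(\<integral>x. (cmod (?F (x + t) - ?F x))\<^sup>2 \<partial>lborel) = (\<integral>x. (cmod (?F (x + - t) - ?F x))\<^sup>2 \<partial>lborel)"
        by (subst lborel_integral_real_affine[of 1 _ "- t"]) (auto simp: norm_minus_commute add_ac)
      then show ?thesis using aux[of "- t"] False by simp
    qed
  qed
qed

section \<open>Fourier transforms of functions supported in the unit interval\<close>

text \<open>The Fourier transform with the interval \<open>(0,1)\<close> recentred at \<open>0\<close>. This changes only the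
  phase, but it halves the frequency content and hence the norm of the derivative.\<close>

definition centred_fourier :: "(real \<Rightarrow> complex) \<Rightarrow> real \<Rightarrow> complex" where
  "centred_fourier F \<omega> = (\<integral>x. F x * iexp (pi * \<omega> * (1 - 2 * x)) \<partial>lborel)"

definition sq_norm :: "(real \<Rightarrow> complex) \<Rightarrow> real" where
  "sq_norm F = (\<integral>x. (cmod (F x))\<^sup>2 \<partial>lborel)"

lemma borel_measurable_iexp [measurable (raw)]:
  "g \<in> borel_measurable M \<Longrightarrow> (\<lambda>x. iexp (g x)) \<in> borel_measurable M"
  by (rule measurable_compose[of g M borel iexp])
    (auto intro!: borel_measurable_continuous_onI continuous_intros)

lemma borel_measurable_cnj [measurable (raw)]:
  "g \<in> borel_measurable M \<Longrightarrow> (\<lambda>x. cnj (g x)) \<in> borel_measurable M"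
  by (rule measurable_compose[of g M borel cnj])
    (auto intro!: borel_measurable_continuous_onI continuous_intros)

text \<open>The integrable product f(x) g(y) dominates the integrand. Applied to the
  autocorrelation, the normal density and a complex exponential.\<close>

lemma Fubini_bounded_kernel:
  fixes f g :: "real \<Rightarrow> complex" and K :: "real \<Rightarrow> real \<Rightarrow> complex"
  assumes f: "integrable lborel f" and g: "integrable lborel g"
    and K [measurable]: "case_prod K \<in> borel_measurable (lborel \<Otimes>\<^sub>M lborel)"
    and K1: "\<And>x y. cmod (K x y) \<le> 1"
  shows "(\<integral>y. (\<integral>x. f x * g y * K x y \<partial>lborel) \<partial>lborel) = (\<integral>x. (\<integral>y. f x * g y * K x y \<partial>lborel) \<partial>lborel)"
proof (rule lborel_pair.Fubini_integral, rule Bochner_Integration.integrable_bound)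
  have [measurable]: "f \<in> borel_measurable borel" "g \<in> borel_measurable borel" using f g by auto
  show "integrable (lborel \<Otimes>\<^sub>M lborel) (\<lambda>(x, y). f x * g y)"
    using f g
    by (intro lborel_pair.Fubini_integrable) (auto simp: norm_mult)
  show "case_prod (\<lambda>x y. f x * g y * K x y) \<in> borel_measurable (lborel \<Otimes>\<^sub>M lborel)"
    using K by measurable
  show "AE z in lborel \<Otimes>\<^sub>M lborel. norm (case_prod (\<lambda>x y. f x * g y * K x y) z) \<le> norm (case z of (x, y) \<Rightarrow> f x * g y)"
    by (intro AE_I2) (auto simp: norm_mult K1 intro!: mult_left_le split: prod.split)
qed

text \<open>Borel representatives extended by zero, rather than classes on the open interval:
  translation, the product measure on \<open>lborel\<close> and the affine substitutions then apply
  directly.\<close>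

locale unit_L2 =
  fixes F :: "real \<Rightarrow> complex"
  assumes meas [measurable]: "F \<in> borel_measurable borel"
    and supp: "\<And>x. x \<notin> {0..1} \<Longrightarrow> F x = 0"
    and sq: "integrable lborel (\<lambda>x. (cmod (F x))\<^sup>2)"
begin

lemma integrable_F: "integrable lborel F"
proof (rule Bochner_Integration.integrable_bound)
  show "integrable lborel (\<lambda>x. (cmod (F x))\<^sup>2 + indicator {0..1} x)"
    using sq by (intro Bochner_Integration.integrable_add) auto
  have "cmod (F x) \<le> (cmod (F x))\<^sup>2 + indicator {0..1} x" for x
  proof (cases "x \<in> {0..1}")
    case True
    have "0 \<le> (cmod (F x) - 1)\<^sup>2 + (cmod (F x))\<^sup>2 + 1" by simp
    then show ?thesis using True by (simp add: power2_eq_square algebra_simps)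
  next
    case False
    then show ?thesis using supp[OF False] by simp
  qed
  then show "AE x in lborel. norm (F x) \<le> norm ((cmod (F x))\<^sup>2 + indicator {0..1} x)"
    by (intro AE_I2) (smt (verit) norm_ge_zero real_norm_def)
qed auto

lemma sq_norm_nonneg: "0 \<le> sq_norm F"
  by (simp add: sq_norm_def)

lemma integrable_mult_iexp: "integrable lborel (\<lambda>x. F x * iexp (g x))"
  if [measurable]: "g \<in> borel_measurable borel" for g
  by (rule Bochner_Integration.integrable_bound[OF integrable_F]) (auto simp: norm_mult)

text \<open>The multiplier is what differentiation in frequency brings down. Its modulus is at most
  \<open>pi\<close> on the unit interval because |1 - 2x| is at most 1 there; this is the \<pi> that
  cancels the one in Wirtinger's constant.\<close>

lemma cmod2_derivative_le: "(cmod (\<i> * of_real (pi * (1 - 2 * x)) * F x))\<^sup>2 \<le> pi\<^sup>2 * (cmod (F x))\<^sup>2"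
proof (cases "x \<in> {0..1}")
  case True
  then have "\<bar>1 - 2 * x\<bar> ^ 2 \<le> 1" by (intro power_le_one) auto
  then have "(pi * (1 - 2 * x))\<^sup>2 \<le> pi\<^sup>2" by (simp add: power_mult_distrib)
  moreover have "(cmod (\<i> * of_real c * F x))\<^sup>2 = c\<^sup>2 * (cmod (F x))\<^sup>2" for c
    by (simp add: norm_mult power_mult_distrib)
  ultimately show ?thesis by (simp only: mult_right_mono zero_le_power2)
qed (simp add: supp)

lemma unit_L2_derivative: "unit_L2 (\<lambda>x. \<i> * of_real (pi * (1 - 2 * x)) * F x)"
proof
  show "integrable lborel (\<lambda>x. (cmod (\<i> * of_real (pi * (1 - 2 * x)) * F x))\<^sup>2)"
  proof (rule Bochner_Integration.integrable_bound)
    show "integrable lborel (\<lambda>x. pi\<^sup>2 * (cmod (F x))\<^sup>2)" using sq by simp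
    show "AE x in lborel. norm ((cmod (\<i> * of_real (pi * (1 - 2 * x)) * F x))\<^sup>2) \<le> norm (pi\<^sup>2 * (cmod (F x))\<^sup>2)"
      using cmod2_derivative_le by (intro AE_I2) (simp only: real_norm_def abs_mult abs_power2)
  qed measurable
qed (use supp in auto)

lemma sq_norm_derivative: "sq_norm (\<lambda>x. \<i> * of_real (pi * (1 - 2 * x)) * F x) \<le> pi\<^sup>2 * sq_norm F"
proof -
  have "sq_norm (\<lambda>x. \<i> * of_real (pi * (1 - 2 * x)) * F x) \<le> (\<integral>x. pi\<^sup>2 * (cmod (F x))\<^sup>2 \<partial>lborel)"
    unfolding sq_norm_def
  proof (rule integral_mono')
    show "(cmod (\<i> * of_real (pi * (1 - 2 * x)) * F x))\<^sup>2 \<le> pi\<^sup>2 * (cmod (F x))\<^sup>2" for x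
      by (rule cmod2_derivative_le)
  qed (use sq in auto)
  then show ?thesis by (simp add: sq_norm_def)
qed

text \<open>The first-order Taylor remainder of the exponential is quadratic in \<open>h\<close>,
  uniformly over the support of \<open>F\<close>. After integration against the integrable
  \<open>F\<close> it is at most M h^2.\<close>

lemma centred_fourier_has_derivative:
  "(centred_fourier F has_vector_derivative
     centred_fourier (\<lambda>x. \<i> * of_real (pi * (1 - 2 * x)) * F x) \<omega>) (at \<omega>)"
proof -
  define G where "G = (\<lambda>x. \<i> * of_real (pi * (1 - 2 * x)) * F x)"
  interpret G: unit_L2 G unfolding G_def by (rule unit_L2_derivative)
  define M where "M = (\<integral>x. cmod (F x) * pi\<^sup>2 / 2 \<partial>lborel)"
  have bound: "cmod (centred_fourier F (\<omega> + h) - centred_fourier F \<omega> - h *\<^sub>R centred_fourier G \<omega>) \<le> M * h\<^sup>2" for h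
  proof -
    define e where "e = (\<lambda>\<omega> x. iexp (pi * \<omega> * (1 - 2 * x)))"
    have FT: "centred_fourier H \<omega> = (\<integral>x. H x * e \<omega> x \<partial>lborel)" for H \<omega>
      by (simp only: centred_fourier_def e_def)
    have i: "integrable lborel (\<lambda>x. F x * e \<omega> x)" "integrable lborel (\<lambda>x. G x * e \<omega> x)" for \<omega>
      unfolding e_def by (rule integrable_mult_iexp G.integrable_mult_iexp, measurable)+
    have i': "integrable lborel (\<lambda>x. complex_of_real h * (G x * e \<omega> x))"
      using i(2)[of \<omega>] by simp
    have "centred_fourier F (\<omega> + h) - centred_fourier F \<omega> - h *\<^sub>R centred_fourier G \<omega>
        = (\<integral>x. F x * e (\<omega> + h) x - F x * e \<omega> x - of_real h * (G x * e \<omega> x) \<partial>lborel)"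
      using i i' by (simp add: FT scaleR_conv_of_real)
    also have "cmod \<dots> \<le> (\<integral>x. cmod (F x) * pi\<^sup>2 / 2 * h\<^sup>2 \<partial>lborel)"
    proof (rule Bochner_Integration.integral_norm_bound[THEN order_trans], rule integral_mono)
      show "integrable lborel (\<lambda>x. cmod (F x * e (\<omega> + h) x - F x * e \<omega> x - of_real h * (G x * e \<omega> x)))"
        using i i' by (intro integrable_norm Bochner_Integration.integrable_diff)
      show "integrable lborel (\<lambda>x. cmod (F x) * pi\<^sup>2 / 2 * h\<^sup>2)" using integrable_F by simp
      fix x
      show "cmod (F x * e (\<omega> + h) x - F x * e \<omega> x - of_real h * (G x * e \<omega> x)) \<le> cmod (F x) * pi\<^sup>2 / 2 * h\<^sup>2"
      proof (cases "x \<in> {0..1}")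
        case True
        define y where "y = h * pi * (1 - 2 * x)"
        have "e (\<omega> + h) x = e \<omega> x * iexp y"
          by (simp add: e_def y_def exp_add[symmetric] algebra_simps)
        then have "F x * e (\<omega> + h) x - F x * e \<omega> x - of_real h * (G x * e \<omega> x)
            = F x * e \<omega> x * (iexp y - (\<Sum>k\<le>1. (\<i> * y) ^ k / fact k))"
          by (simp add: G_def y_def algebra_simps)
        also have "cmod \<dots> = cmod (F x) * cmod (iexp y - (\<Sum>k\<le>1. (\<i> * y) ^ k / fact k))"
          by (simp add: norm_mult e_def)
        also have "\<dots> \<le> cmod (F x) * (\<bar>y\<bar> ^ Suc 1 / fact (Suc 1))"
          by (intro mult_left_mono iexp_approx1) auto
        also have "\<dots> \<le> cmod (F x) * ((h * pi)\<^sup>2 * 1 / 2)"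
        proof (rule mult_left_mono)
          have "\<bar>1 - 2 * x\<bar> ^ 2 \<le> 1" using True by (intro power_le_one) auto
          then have "(h * pi)\<^sup>2 * (1 - 2 * x)\<^sup>2 \<le> (h * pi)\<^sup>2 * 1" by (intro mult_left_mono) auto
          then show "\<bar>y\<bar> ^ Suc 1 / fact (Suc 1) \<le> (h * pi)\<^sup>2 * 1 / 2"
            by (simp add: y_def power_mult_distrib flip: power2_eq_square)
        qed simp
        finally show ?thesis by (simp add: power_mult_distrib ac_simps)
      qed (simp add: supp G_def)
    qed
    also have "\<dots> = M * h\<^sup>2" by (simp add: M_def)
    finally show ?thesis .
  qed
  have "((\<lambda>h. cmod (centred_fourier F (\<omega> + h) - centred_fourier F \<omega> - h *\<^sub>R centred_fourier G \<omega>) / norm h) \<longlongrightarrow> 0) (at 0)"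
  proof (rule Lim_null_comparison)
    show "\<forall>\<^sub>F h in at 0. norm (cmod (centred_fourier F (\<omega> + h) - centred_fourier F \<omega> - h *\<^sub>R centred_fourier G \<omega>) / norm h)
        \<le> M * \<bar>h\<bar>"
    proof (intro always_eventually allI)
      fix h :: real
      show "norm (cmod (centred_fourier F (\<omega> + h) - centred_fourier F \<omega> - h *\<^sub>R centred_fourier G \<omega>) / norm h)
        \<le> M * \<bar>h\<bar>"
      proof (cases "h = 0")
        case False
        have "M * h\<^sup>2 = M * \<bar>h\<bar> * \<bar>h\<bar>" by (simp add: power2_eq_square)
        then show ?thesis using bound[of h] False by (simp only: real_norm_def abs_divide abs_norm_cancel abs_abs)
          (simp add: pos_divide_le_eq)
      qed simp
    qed
    show "((\<lambda>h. M * \<bar>h\<bar>) \<longlongrightarrow> 0) (at 0)" by (auto intro!: tendsto_eq_intros)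
  qed
  then show ?thesis
    unfolding has_vector_derivative_def has_derivative_at G_def[symmetric]
    by (auto intro: bounded_linear_scaleR_left)
qed

lemma continuous_centred_fourier: "continuous_on S (centred_fourier F)"
  using centred_fourier_has_derivative
  by (intro continuous_at_imp_continuous_on ballI has_vector_derivative_continuous)

lemma cmod_centred_fourier_le: "cmod (centred_fourier F \<omega>) \<le> (\<integral>x. cmod (F x) \<partial>lborel)"
  unfolding centred_fourier_def
  by (rule Bochner_Integration.integral_norm_bound[THEN order_trans]) (simp add: norm_mult)

section \<open>Autocorrelation and Gaussian averages of the squared transform\<close>

definition autocorr :: "real \<Rightarrow> complex" where
  "autocorr t = (\<integral>x. F x * cnj (F (x + t)) \<partial>lborel)"

lemma sq_shift: "integrable lborel (\<lambda>x. (cmod (F (x + t)))\<^sup>2)"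
  "(\<integral>x. (cmod (F (x + t)))\<^sup>2 \<partial>lborel) = sq_norm F"
proof -
  show "integrable lborel (\<lambda>x. (cmod (F (x + t)))\<^sup>2)"
    using lborel_integrable_real_affine[OF sq, of 1 t] by (simp add: add.commute)
  show "(\<integral>x. (cmod (F (x + t)))\<^sup>2 \<partial>lborel) = sq_norm F"
    unfolding sq_norm_def
    by (subst lborel_integral_real_affine[of 1 "\<lambda>x. (cmod (F x))\<^sup>2" t]) (auto simp: add.commute)
qed

lemma autocorr_integrable: "integrable lborel (\<lambda>x. F x * cnj (F (x + t)))"
proof (rule Bochner_Integration.integrable_bound)
  show "integrable lborel (\<lambda>x. (cmod (F x))\<^sup>2 + (cmod (F (x + t)))\<^sup>2)"
    using sq sq_shift by simp
  have "cmod (F x) * cmod (F (x + t)) \<le> (cmod (F x))\<^sup>2 + (cmod (F (x + t)))\<^sup>2" for x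
    using sum_squares_bound[of "cmod (F x)" "cmod (F (x + t))"]
      mult_nonneg_nonneg[OF norm_ge_zero norm_ge_zero, of "F x" "F (x + t)"] by linarith
  then show "AE x in lborel. norm (F x * cnj (F (x + t))) \<le> norm ((cmod (F x))\<^sup>2 + (cmod (F (x + t)))\<^sup>2)"
    by (auto simp: norm_mult)
qed measurable

text \<open>Polarization of F(x) and F(x + t), which have equal norms. It converts a translation
  estimate into a lower bound for the autocorrelation, and shows that its real part never exceeds
  the value at 0.\<close>

lemma Re_autocorr:
  "Re (autocorr t) = sq_norm F - (\<integral>x. (cmod (F (x + t) - F x))\<^sup>2 \<partial>lborel) / 2"
proof -
  have eq: "Re (a * cnj b) = ((cmod a)\<^sup>2 + (cmod b)\<^sup>2 - (cmod (b - a))\<^sup>2) / 2" for a b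
    unfolding cmod_power2 by (simp add: power2_eq_square algebra_simps)
  have d: "integrable lborel (\<lambda>x. (cmod (F (x + t) - F x))\<^sup>2)"
  proof (rule Bochner_Integration.integrable_bound)
    show "integrable lborel (\<lambda>x. 2 * (cmod (F (x + t)))\<^sup>2 + 2 * (cmod (F x))\<^sup>2)"
      using sq sq_shift by simp
    show "AE x in lborel. norm ((cmod (F (x + t) - F x))\<^sup>2) \<le> norm (2 * (cmod (F (x + t)))\<^sup>2 + 2 * (cmod (F x))\<^sup>2)"
      using cmod_diff_power2_le by auto
  qed measurable
  have "Re (autocorr t) = (\<integral>x. Re (F x * cnj (F (x + t))) \<partial>lborel)"
    unfolding autocorr_def by (rule integral_Re[OF autocorr_integrable, symmetric])
  also have "\<dots> = (\<integral>x. ((cmod (F x))\<^sup>2 + (cmod (F (x + t)))\<^sup>2 - (cmod (F (x + t) - F x))\<^sup>2) / 2 \<partial>lborel)"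
    by (simp only: eq)
  also have "\<dots> = (sq_norm F + sq_norm F - (\<integral>x. (cmod (F (x + t) - F x))\<^sup>2 \<partial>lborel)) / 2"
    using sq sq_shift d by (simp add: sq_norm_def)
  finally show ?thesis by simp
qed

lemma Re_autocorr_le: "Re (autocorr t) \<le> sq_norm F"
  by (simp add: Re_autocorr)

text \<open>Wiener-Khinchin: in the product of the transform with its conjugate the second variable
  is written as x + t, the phases combine to one depending on t alone, and Fubini integrates out
  x.\<close>

lemma cmod2_centred_fourier:
  "integrable lborel autocorr"
  "complex_of_real ((cmod (centred_fourier F \<omega>))\<^sup>2) = (\<integral>t. autocorr t * iexp (2 * pi * \<omega> * t) \<partial>lborel)"
proof -
  define e where "e = (\<lambda>x. iexp (pi * \<omega> * (1 - 2 * x)))"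
  have [measurable]: "e \<in> borel_measurable borel" unfolding e_def by measurable
  \<comment> \<open>The frequency is left free: \<open>K 0\<close> yields integrability of the
    autocorrelation, \<open>K \<omega>\<close> the identity.\<close>
  define K where "K \<theta> = (\<lambda>(x, t). F x * cnj (F (x + t)) * iexp (2 * pi * \<theta> * t))" for \<theta>
  have Fs: "integrable lborel (\<lambda>t. F (x + t))" for x
    using lborel_integrable_real_affine[OF integrable_F, of 1 x] by simp
  have int: "integrable (lborel \<Otimes>\<^sub>M lborel) (K \<theta>)" for \<theta>
  proof (rule lborel_pair.Fubini_integrable)
    show "K \<theta> \<in> borel_measurable (lborel \<Otimes>\<^sub>M lborel)" unfolding K_def by measurable
    have "(\<integral>y. cmod (F (x + y)) \<partial>lborel) = (\<integral>y. cmod (F y) \<partial>lborel)" for x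
      by (subst lborel_integral_real_affine[of 1 "\<lambda>x. cmod (F x)" x]) auto
    then have "(\<lambda>x. \<integral>y. norm (K \<theta> (x, y)) \<partial>lborel) = (\<lambda>x. cmod (F x) * (\<integral>y. cmod (F y) \<partial>lborel))"
      by (simp add: K_def norm_mult)
    then show "integrable lborel (\<lambda>x. \<integral>y. norm (K \<theta> (x, y)) \<partial>lborel)"
      using integrable_F by simp
    show "AE x in lborel. integrable lborel (\<lambda>y. K \<theta> (x, y))"
    proof (rule AE_I2)
      fix x
      show "integrable lborel (\<lambda>y. K \<theta> (x, y))"
      proof (rule Bochner_Integration.integrable_bound)
        show "integrable lborel (\<lambda>y. F x * F (x + y))" using Fs by simp
        show "(\<lambda>y. K \<theta> (x, y)) \<in> borel_measurable lborel" unfolding K_def prod.case by measurable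
      qed (simp add: K_def norm_mult)
    qed
  qed
  have "integrable lborel (\<lambda>t. \<integral>x. K 0 (x, t) \<partial>lborel)"
    using lborel_pair.integrable_snd[OF int[of 0, unfolded K_def]] by (simp add: K_def)
  then show "integrable lborel autocorr" by (simp add: K_def autocorr_def[abs_def])
  have "complex_of_real ((cmod (centred_fourier F \<omega>))\<^sup>2) = centred_fourier F \<omega> * cnj (centred_fourier F \<omega>)"
    by (rule complex_norm_square)
  also have "\<dots> = (\<integral>x. F x * e x * cnj (centred_fourier F \<omega>) \<partial>lborel)"
    by (simp add: centred_fourier_def e_def)
  also have "\<dots> = (\<integral>x. (\<integral>t. K \<omega> (x, t) \<partial>lborel) \<partial>lborel)"
  proof (rule Bochner_Integration.integral_cong[OF refl])
    fix x
    have "cnj (centred_fourier F \<omega>) = (\<integral>y. cnj (F y * e y) \<partial>lborel)"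
      unfolding centred_fourier_def e_def by (rule Bochner_Integration.integral_cnj[symmetric])
    also have "\<dots> = (\<integral>t. cnj (F (x + t) * e (x + t)) \<partial>lborel)"
      by (subst lborel_integral_real_affine[of 1 "\<lambda>y. cnj (F y * e y)" x]) auto
    finally have "F x * e x * cnj (centred_fourier F \<omega>) = (\<integral>t. F x * e x * cnj (F (x + t) * e (x + t)) \<partial>lborel)"
      by simp
    also have "\<dots> = (\<integral>t. K \<omega> (x, t) \<partial>lborel)"
    proof (rule Bochner_Integration.integral_cong[OF refl])
      fix t
      have "e x * cnj (e (x + t)) = iexp (2 * pi * \<omega> * t)"
        by (simp add: e_def exp_cnj exp_add[symmetric] algebra_simps)
      then show "F x * e x * cnj (F (x + t) * e (x + t)) = K \<omega> (x, t)"
        by (simp add: K_def)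
    qed
    finally show "F x * e x * cnj (centred_fourier F \<omega>) = (\<integral>t. K \<omega> (x, t) \<partial>lborel)" .
  qed
  also have "\<dots> = (\<integral>t. (\<integral>x. K \<omega> (x, t) \<partial>lborel) \<partial>lborel)"
    using lborel_pair.Fubini_integral[of "\<lambda>x t. K \<omega> (x, t)"] int[of \<omega>] by simp
  also have "\<dots> = (\<integral>t. autocorr t * iexp (2 * pi * \<omega> * t) \<partial>lborel)"
    by (simp add: K_def autocorr_def)
  finally show "complex_of_real ((cmod (centred_fourier F \<omega>))\<^sup>2) = (\<integral>t. autocorr t * iexp (2 * pi * \<omega> * t) \<partial>lborel)" .
qed

text \<open>Parseval's identity for the pair (squared transform, autocorrelation) tested on a
  Gaussian, whose transform is again Gaussian. A weight of width 1/\<sigma> in frequency becomes an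
  average of the autocorrelation over shifts of size \<sigma>/(2\<pi>).\<close>

lemma gaussian_integral_centred_fourier:
  assumes \<sigma>: "\<sigma> > 0"
  shows "integrable lborel (\<lambda>\<omega>. exp (- (\<sigma> * \<omega>)\<^sup>2 / 2) * (cmod (centred_fourier F \<omega>))\<^sup>2)"
    and "integrable lborel (\<lambda>z. std_normal_density z * Re (autocorr (\<sigma> * z / (2 * pi))))"
    and "(\<integral>\<omega>. exp (- (\<sigma> * \<omega>)\<^sup>2 / 2) * (cmod (centred_fourier F \<omega>))\<^sup>2 \<partial>lborel)
      = (\<integral>z. std_normal_density z * Re (autocorr (\<sigma> * z / (2 * pi))) \<partial>lborel)"
proof -
  let ?\<Phi> = "centred_fourier F"
  let ?\<phi> = "std_normal_density"
  have [measurable]: "?\<Phi> \<in> borel_measurable borel"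
    by (intro borel_measurable_continuous_onI continuous_centred_fourier)
  have [measurable]: "autocorr \<in> borel_measurable borel"
    using cmod2_centred_fourier(1) by auto
  have phi: "?\<phi> (\<sigma> * \<omega>) = exp (- (\<sigma> * \<omega>)\<^sup>2 / 2) / sqrt (2 * pi)" for \<omega>
    by (simp add: std_normal_density_def)
  have int: "integrable lborel (\<lambda>\<omega>. ?\<phi> (\<sigma> * \<omega>) * (cmod (?\<Phi> \<omega>))\<^sup>2)"
  proof (rule Bochner_Integration.integrable_bound)
    show "integrable lborel (\<lambda>\<omega>. ?\<phi> (\<sigma> * \<omega>) * (\<integral>x. cmod (F x) \<partial>lborel)\<^sup>2)"
      using lborel_integrable_real_affine[OF integrable_normal_density[of 1 0], of \<sigma> 0] \<sigma> by simp
    show "AE \<omega> in lborel. norm (?\<phi> (\<sigma> * \<omega>) * (cmod (?\<Phi> \<omega>))\<^sup>2) \<le> norm (?\<phi> (\<sigma> * \<omega>) * (\<integral>x. cmod (F x) \<partial>lborel)\<^sup>2)"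
      by (auto simp: abs_mult intro!: mult_left_mono power_mono cmod_centred_fourier_le)
  qed measurable
  show 1: "integrable lborel (\<lambda>\<omega>. exp (- (\<sigma> * \<omega>)\<^sup>2 / 2) * (cmod (?\<Phi> \<omega>))\<^sup>2)"
    using integrable_mult_left[OF int, of "sqrt (2 * pi)"] by (simp add: phi)
  \<comment> \<open>The characteristic function of the standard normal distribution.\<close>
  have gauss: "(\<integral>u. complex_of_real (?\<phi> u) * iexp (s * u) \<partial>lborel) = exp (- s\<^sup>2 / 2)" for s
  proof -
    have "char std_normal_distribution s = (\<integral>u. ?\<phi> u *\<^sub>R iexp (s * u) \<partial>lborel)"
      unfolding char_def by (rule integral_density) auto
    then show ?thesis by (simp add: char_std_normal_distribution scaleR_conv_of_real)
  qed
  have "complex_of_real (\<integral>u. ?\<phi> u * (cmod (?\<Phi> (u / \<sigma>)))\<^sup>2 \<partial>lborel)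
      = (\<integral>u. complex_of_real (?\<phi> u) * complex_of_real ((cmod (?\<Phi> (u / \<sigma>)))\<^sup>2) \<partial>lborel)"
    by (subst integral_complex_of_real[symmetric]) simp
  also have "\<dots> = (\<integral>u. (\<integral>t. autocorr t * complex_of_real (?\<phi> u) * iexp (2 * pi * (u / \<sigma>) * t) \<partial>lborel) \<partial>lborel)"
  proof (rule Bochner_Integration.integral_cong[OF refl])
    fix u
    have "complex_of_real (?\<phi> u) * complex_of_real ((cmod (?\<Phi> (u / \<sigma>)))\<^sup>2)
        = (\<integral>t. complex_of_real (?\<phi> u) * (autocorr t * iexp (2 * pi * (u / \<sigma>) * t)) \<partial>lborel)"
      unfolding cmod2_centred_fourier(2) by simp
    then show "complex_of_real (?\<phi> u) * complex_of_real ((cmod (?\<Phi> (u / \<sigma>)))\<^sup>2)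
        = (\<integral>t. autocorr t * complex_of_real (?\<phi> u) * iexp (2 * pi * (u / \<sigma>) * t) \<partial>lborel)"
      by (simp only: ac_simps)
  qed
  also have "\<dots> = (\<integral>t. (\<integral>u. autocorr t * complex_of_real (?\<phi> u) * iexp (2 * pi * (u / \<sigma>) * t) \<partial>lborel) \<partial>lborel)"
    by (rule Fubini_bounded_kernel) (use cmod2_centred_fourier(1) in auto)
  also have "\<dots> = (\<integral>t. autocorr t * exp (- (2 * pi * t / \<sigma>)\<^sup>2 / 2) \<partial>lborel)"
  proof (rule Bochner_Integration.integral_cong[OF refl])
    fix t
    have "(\<integral>u. autocorr t * complex_of_real (?\<phi> u) * iexp (2 * pi * (u / \<sigma>) * t) \<partial>lborel)
        = (\<integral>u. autocorr t * (complex_of_real (?\<phi> u) * iexp (2 * pi * t / \<sigma> * u)) \<partial>lborel)"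
      by (simp add: ac_simps)
    also have "\<dots> = autocorr t * exp (- (2 * pi * t / \<sigma>)\<^sup>2 / 2)"
      unfolding gauss[symmetric] by simp
    finally show "(\<integral>u. autocorr t * complex_of_real (?\<phi> u) * iexp (2 * pi * (u / \<sigma>) * t) \<partial>lborel)
        = autocorr t * exp (- (2 * pi * t / \<sigma>)\<^sup>2 / 2)" .
  qed
  finally have E: "complex_of_real (\<integral>u. ?\<phi> u * (cmod (?\<Phi> (u / \<sigma>)))\<^sup>2 \<partial>lborel)
      = (\<integral>t. autocorr t * exp (- (2 * pi * t / \<sigma>)\<^sup>2 / 2) \<partial>lborel)" .
  define g where "g = (\<lambda>t. autocorr t * exp (- (2 * pi * t / \<sigma>)\<^sup>2 / 2))"
  have gi: "integrable lborel g"
    unfolding g_def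
    by (rule Bochner_Integration.integrable_bound[OF cmod2_centred_fourier(1)])
      (auto simp: norm_mult intro!: mult_left_le)
  \<comment> \<open>The substitution t = \<sigma>z/(2\<pi>) reduces the Gaussian factor to
    exp(-z^2/2), which is sqrt(2\<pi>) times the normal density.\<close>
  have gz: "g (0 + \<sigma> / (2 * pi) * z) = complex_of_real (sqrt (2 * pi)) * (complex_of_real (?\<phi> z) * autocorr (\<sigma> * z / (2 * pi)))" for z
    using \<sigma> by (simp add: g_def std_normal_density_def power_divide power_mult_distrib)
  have \<sigma>': "\<sigma> / (2 * pi) \<noteq> 0" using \<sigma> by simp
  have "integrable lborel (\<lambda>z. g (0 + \<sigma> / (2 * pi) * z))"
    by (rule lborel_integrable_real_affine[OF gi \<sigma>'])
  then have zi: "integrable lborel (\<lambda>z. complex_of_real (?\<phi> z) * autocorr (\<sigma> * z / (2 * pi)))"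
    using integrable_mult_right[of "1 / complex_of_real (sqrt (2 * pi))" lborel "\<lambda>z. g (0 + \<sigma> / (2 * pi) * z)"]
    unfolding gz by simp
  show "integrable lborel (\<lambda>z. ?\<phi> z * Re (autocorr (\<sigma> * z / (2 * pi))))"
    using integrable_Re[OF zi] by simp
  have "(\<integral>t. g t \<partial>lborel) = (\<sigma> / (2 * pi)) *\<^sub>R (\<integral>z. g (0 + \<sigma> / (2 * pi) * z) \<partial>lborel)"
    using \<sigma> by (subst lborel_integral_real_affine[OF \<sigma>', of g 0]) simp
  also have "\<dots> = (\<sigma> / (2 * pi) * sqrt (2 * pi)) *\<^sub>R (\<integral>z. complex_of_real (?\<phi> z) * autocorr (\<sigma> * z / (2 * pi)) \<partial>lborel)"
    unfolding gz integral_mult_right_zero by (simp only: scaleR_conv_of_real of_real_mult mult.assoc)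
  finally have G: "(\<integral>t. g t \<partial>lborel) = \<dots>" .
  have "(\<integral>u. ?\<phi> u * (cmod (?\<Phi> (u / \<sigma>)))\<^sup>2 \<partial>lborel) = Re (\<integral>t. g t \<partial>lborel)"
    unfolding g_def E[symmetric] by (simp only: Re_complex_of_real)
  also have "\<dots> = \<sigma> / (2 * pi) * sqrt (2 * pi) * (\<integral>z. ?\<phi> z * Re (autocorr (\<sigma> * z / (2 * pi))) \<partial>lborel)"
    unfolding G using integral_Re[OF zi] by simp
  finally have L: "(\<integral>u. ?\<phi> u * (cmod (?\<Phi> (u / \<sigma>)))\<^sup>2 \<partial>lborel)
     = \<sigma> / (2 * pi) * sqrt (2 * pi) * (\<integral>z. ?\<phi> z * Re (autocorr (\<sigma> * z / (2 * pi))) \<partial>lborel)" .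
  have "(\<integral>u. ?\<phi> u * (cmod (?\<Phi> (u / \<sigma>)))\<^sup>2 \<partial>lborel)
      = \<sigma> * (\<integral>\<omega>. ?\<phi> (\<sigma> * \<omega>) * (cmod (?\<Phi> \<omega>))\<^sup>2 \<partial>lborel)"
    using \<sigma> by (subst lborel_integral_real_affine[of \<sigma> _ 0]) auto
  also have "\<dots> = \<sigma> / sqrt (2 * pi) * (\<integral>\<omega>. exp (- (\<sigma> * \<omega>)\<^sup>2 / 2) * (cmod (?\<Phi> \<omega>))\<^sup>2 \<partial>lborel)"
    by (simp add: phi)
  finally have "\<sigma> / sqrt (2 * pi) * (\<integral>\<omega>. exp (- (\<sigma> * \<omega>)\<^sup>2 / 2) * (cmod (?\<Phi> \<omega>))\<^sup>2 \<partial>lborel)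
     = \<sigma> / (2 * pi) * sqrt (2 * pi) * (\<integral>z. ?\<phi> z * Re (autocorr (\<sigma> * z / (2 * pi))) \<partial>lborel)"
    using L by simp
  also have "\<sigma> / (2 * pi) * sqrt (2 * pi) = \<sigma> / sqrt (2 * pi)"
    using real_sqrt_mult_self[of "2 * pi"] by (simp add: field_simps del: real_sqrt_mult_self)
  finally show "(\<integral>\<omega>. exp (- (\<sigma> * \<omega>)\<^sup>2 / 2) * (cmod (?\<Phi> \<omega>))\<^sup>2 \<partial>lborel)
      = (\<integral>z. ?\<phi> z * Re (autocorr (\<sigma> * z / (2 * pi))) \<partial>lborel)"
    using \<sigma> by simp
qed

text \<open>The normal density has total mass 1 and the real part of the autocorrelation is at most
  the squared norm. The bound is uniform in \<sigma>.\<close>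

lemma gaussian_integral_le:
  assumes "\<sigma> > 0"
  shows "(\<integral>\<omega>. exp (- (\<sigma> * \<omega>)\<^sup>2 / 2) * (cmod (centred_fourier F \<omega>))\<^sup>2 \<partial>lborel) \<le> sq_norm F"
proof -
  have "(\<integral>z. std_normal_density z * Re (autocorr (\<sigma> * z / (2 * pi))) \<partial>lborel)
      \<le> (\<integral>z. std_normal_density z * sq_norm F \<partial>lborel)"
    using gaussian_integral_centred_fourier(2)[OF assms]
    by (intro integral_mono mult_left_mono Re_autocorr_le) auto
  then show ?thesis using gaussian_integral_centred_fourier(3)[OF assms] by simp
qed

lemma lborel_integral_Icc_fourier:
  "integrable lborel (\<lambda>\<omega>. indicator {a..b} \<omega> * (cmod (centred_fourier F \<omega>))\<^sup>2)"
  "(\<integral>\<omega>. indicator {a..b} \<omega> * (cmod (centred_fourier F \<omega>))\<^sup>2 \<partial>lborel)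
     = integral {a..b} (\<lambda>\<omega>. (cmod (centred_fourier F \<omega>))\<^sup>2)"
proof -
  have 1: "set_integrable lborel {a..b} (\<lambda>\<omega>. (cmod (centred_fourier F \<omega>))\<^sup>2)"
    by (intro borel_integrable_atLeastAtMost' continuous_intros continuous_centred_fourier)
  show "integrable lborel (\<lambda>\<omega>. indicator {a..b} \<omega> * (cmod (centred_fourier F \<omega>))\<^sup>2)"
    using 1 by (simp add: set_integrable_def)
  show "(\<integral>\<omega>. indicator {a..b} \<omega> * (cmod (centred_fourier F \<omega>))\<^sup>2 \<partial>lborel)
     = integral {a..b} (\<lambda>\<omega>. (cmod (centred_fourier F \<omega>))\<^sup>2)"
    using set_borel_integral_eq_integral(2)[OF 1] by (simp add: set_lebesgue_integral_def)
qed

text \<open>As \<sigma> tends to 0 the Gaussian weight tends to 1 on any bounded interval, while its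
  total integral stays below the squared norm. This is the upper half of Plancherel's
  theorem.\<close>

lemma bessel: "integral {a..b} (\<lambda>\<omega>. (cmod (centred_fourier F \<omega>))\<^sup>2) \<le> sq_norm F"
proof -
  define R where "R = \<bar>a\<bar> + \<bar>b\<bar>"
  define J where "J = integral {a..b} (\<lambda>\<omega>. (cmod (centred_fourier F \<omega>))\<^sup>2)"
  have *: "exp (- (\<sigma> * R)\<^sup>2 / 2) * J \<le> sq_norm F" if \<sigma>: "\<sigma> > 0" for \<sigma>
  proof -
    have "exp (- (\<sigma> * R)\<^sup>2 / 2) * J
        = (\<integral>\<omega>. exp (- (\<sigma> * R)\<^sup>2 / 2) * (indicator {a..b} \<omega> * (cmod (centred_fourier F \<omega>))\<^sup>2) \<partial>lborel)"
      unfolding J_def lborel_integral_Icc_fourier(2)[symmetric] by simp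
    also have "\<dots> \<le> (\<integral>\<omega>. exp (- (\<sigma> * \<omega>)\<^sup>2 / 2) * (cmod (centred_fourier F \<omega>))\<^sup>2 \<partial>lborel)"
    proof (rule integral_mono')
      show "integrable lborel (\<lambda>\<omega>. exp (- (\<sigma> * \<omega>)\<^sup>2 / 2) * (cmod (centred_fourier F \<omega>))\<^sup>2)"
        by (rule gaussian_integral_centred_fourier(1)[OF \<sigma>])
      fix \<omega> :: real
      show "exp (- (\<sigma> * R)\<^sup>2 / 2) * (indicator {a..b} \<omega> * (cmod (centred_fourier F \<omega>))\<^sup>2)
          \<le> exp (- (\<sigma> * \<omega>)\<^sup>2 / 2) * (cmod (centred_fourier F \<omega>))\<^sup>2"
      proof (cases "\<omega> \<in> {a..b}")
        case True
        then have "\<bar>\<omega>\<bar> \<le> \<bar>R\<bar>" by (auto simp: R_def)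
        then have "\<bar>\<sigma> * \<omega>\<bar> \<le> \<bar>\<sigma> * R\<bar>" using \<sigma> by (simp add: abs_mult)
        then have "(\<sigma> * \<omega>)\<^sup>2 \<le> (\<sigma> * R)\<^sup>2" by (simp only: abs_le_square_iff)
        then show ?thesis using True by (auto intro!: mult_right_mono)
      qed simp
    qed auto
    also have "\<dots> \<le> sq_norm F" by (rule gaussian_integral_le[OF \<sigma>])
    finally show ?thesis .
  qed
  have ev: "\<forall>\<^sub>F \<sigma> in at_right 0. exp (- (\<sigma> * R)\<^sup>2 / 2) * J \<le> sq_norm F"
    using eventually_at_right_less[of "0::real"] by eventually_elim (rule *)
  have "((\<lambda>\<sigma>. exp (- (\<sigma> * R)\<^sup>2 / 2) * J) \<longlongrightarrow> exp (- (0 * R)\<^sup>2 / 2) * J) (at_right 0)"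
    by (intro tendsto_intros) auto
  then have "exp (- (0 * R)\<^sup>2 / 2) * J \<le> sq_norm F"
    by (rule tendsto_upperbound[OF _ ev]) simp
  then show ?thesis by (simp add: J_def)
qed

text \<open>A Gaussian weight of width \<open>1/\<sigma>\<close> loses little mass by the translation estimate, and
  outside \<open>[-R,R]\<close> it is dominated by a wider Gaussian times a small constant.\<close>

lemma fourier_concentration:
  assumes C: "C \<ge> 0" "\<eta> > 0"
    and tr: "\<And>t. (\<integral>x. (cmod (F (x + t) - F x))\<^sup>2 \<partial>lborel) \<le> 5 * C * \<bar>t\<bar> / \<eta> * sq_norm F"
    and \<sigma>: "\<sigma> > 0" and R: "R \<ge> 0"
  shows "(1 - C * \<sigma> / (2 * \<eta>) - exp (- (\<sigma> * R)\<^sup>2 / 4)) * sq_norm F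
    \<le> integral {-R..R} (\<lambda>\<omega>. (cmod (centred_fourier F \<omega>))\<^sup>2)"
proof -
  let ?\<phi> = "std_normal_density"
  define Q where "Q \<sigma> = (\<integral>\<omega>. exp (- (\<sigma> * \<omega>)\<^sup>2 / 2) * (cmod (centred_fourier F \<omega>))\<^sup>2 \<partial>lborel)" for \<sigma>
  define N where "N = sq_norm F"
  have N: "N \<ge> 0" using sq_norm_nonneg by (simp add: N_def)
  \<comment> \<open>Half of the translation bound at t = \<sigma>z/(2\<pi>), divided by |z| and the
    squared norm; the half is the one in \<open>Re_autocorr\<close>.\<close>
  define B where "B = 5 * C * \<sigma> / (4 * pi * \<eta>)"
  have B: "B \<ge> 0" using C \<sigma> by (simp add: B_def)
  have mom: "has_bochner_integral lborel (\<lambda>z. ?\<phi> z * \<bar>z\<bar>) (sqrt (2 / pi))"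
    using std_normal_moment_abs_odd[of 0] by simp
  have ReA: "N - B * \<bar>z\<bar> * N \<le> Re (autocorr (\<sigma> * z / (2 * pi)))" for z
  proof -
    have "5 * C * \<bar>\<sigma> * z / (2 * pi)\<bar> / \<eta> * N = 2 * (B * \<bar>z\<bar> * N)"
      using \<sigma> C by (simp add: B_def abs_mult field_simps)
    then show ?thesis using tr[of "\<sigma> * z / (2 * pi)"] by (simp add: Re_autocorr N_def)
  qed
  have "has_bochner_integral lborel (\<lambda>z. ?\<phi> z * N - (?\<phi> z * \<bar>z\<bar>) * (B * N)) (1 * N - sqrt (2 / pi) * (B * N))"
    by (intro has_bochner_integral_diff has_bochner_integral_mult_left mom)
      (simp add: has_bochner_integral_iff)
  then have hb: "has_bochner_integral lborel (\<lambda>z. ?\<phi> z * (N - B * \<bar>z\<bar> * N)) (1 * N - sqrt (2 / pi) * (B * N))"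
    by (simp add: algebra_simps)
  have "1 * N - sqrt (2 / pi) * (B * N) = (\<integral>z. ?\<phi> z * (N - B * \<bar>z\<bar> * N) \<partial>lborel)"
    using hb by (simp add: has_bochner_integral_iff)
  also have "\<dots> \<le> (\<integral>z. ?\<phi> z * Re (autocorr (\<sigma> * z / (2 * pi))) \<partial>lborel)"
    using hb gaussian_integral_centred_fourier(2)[OF \<sigma>]
    by (intro integral_mono mult_left_mono ReA) (auto simp: has_bochner_integral_iff)
  also have "\<dots> = Q \<sigma>" unfolding Q_def by (rule gaussian_integral_centred_fourier(3)[OF \<sigma>, symmetric])
  finally have Q1: "N - sqrt (2 / pi) * (B * N) \<le> Q \<sigma>" by simp
  \<comment> \<open>Two roundings give the constant of the statement: the absolute moment
    sqrt(2/\<pi>) is replaced by 1, and 5/(4\<pi>) in \<open>B\<close> by 1/2.\<close>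
  have "sqrt (2 / pi) \<le> 1" using pi_gt3 by simp
  then have "sqrt (2 / pi) * (B * N) \<le> 1 * (B * N)" using B N by (intro mult_right_mono) auto
  moreover have "B \<le> C * \<sigma> / (2 * \<eta>)"
  proof -
    have "C * \<sigma> * 5 \<le> C * \<sigma> * (2 * pi)" using C \<sigma> pi_gt3 by (intro mult_left_mono) auto
    then have "C * \<sigma> * 5 / (4 * pi * \<eta>) \<le> C * \<sigma> * (2 * pi) / (4 * pi * \<eta>)"
      using C by (intro divide_right_mono) auto
    then show ?thesis by (simp add: B_def ac_simps)
  qed
  then have "B * N \<le> C * \<sigma> / (2 * \<eta>) * N" using N by (rule mult_right_mono)
  ultimately have Q2: "(1 - C * \<sigma> / (2 * \<eta>)) * N \<le> Q \<sigma>" using Q1 by (simp add: algebra_simps)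
  \<comment> \<open>With this \<tau> the Gaussian splits into exp(-(\<sigma>\<omega>)^2/4) times the
    Gaussian of parameter \<tau>. Outside [-R, R] the first factor is at most \<open>E\<close>, and
    the second integrates to at most the squared norm.\<close>
  define \<tau> where "\<tau> = \<sigma> / sqrt 2"
  have \<tau>: "\<tau> > 0" using \<sigma> by (simp add: \<tau>_def)
  have \<tau>2: "(\<tau> * \<omega>)\<^sup>2 / 2 = (\<sigma> * \<omega>)\<^sup>2 / 4" for \<omega>
    by (simp add: \<tau>_def power_mult_distrib power_divide)
  define E where "E = exp (- (\<sigma> * R)\<^sup>2 / 4)"
  define J where "J = integral {-R..R} (\<lambda>\<omega>. (cmod (centred_fourier F \<omega>))\<^sup>2)"
  have "Q \<sigma> \<le> (\<integral>\<omega>. indicator {-R..R} \<omega> * (cmod (centred_fourier F \<omega>))\<^sup>2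
      + E * (exp (- (\<tau> * \<omega>)\<^sup>2 / 2) * (cmod (centred_fourier F \<omega>))\<^sup>2) \<partial>lborel)"
    unfolding Q_def
  proof (rule integral_mono)
    show "integrable lborel (\<lambda>\<omega>. exp (- (\<sigma> * \<omega>)\<^sup>2 / 2) * (cmod (centred_fourier F \<omega>))\<^sup>2)"
      by (rule gaussian_integral_centred_fourier(1)[OF \<sigma>])
    show "integrable lborel (\<lambda>\<omega>. indicator {-R..R} \<omega> * (cmod (centred_fourier F \<omega>))\<^sup>2
      + E * (exp (- (\<tau> * \<omega>)\<^sup>2 / 2) * (cmod (centred_fourier F \<omega>))\<^sup>2))"
      by (intro Bochner_Integration.integrable_add integrable_mult_right
          gaussian_integral_centred_fourier(1) lborel_integral_Icc_fourier \<tau>)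
    fix \<omega> :: real
    have "exp (- (\<sigma> * \<omega>)\<^sup>2 / 2) \<le> indicator {-R..R} \<omega> + E * exp (- (\<tau> * \<omega>)\<^sup>2 / 2)"
    proof (cases "\<omega> \<in> {-R..R}")
      case True
      have "exp (- (\<sigma> * \<omega>)\<^sup>2 / 2) \<le> 1" by simp
      moreover have "0 \<le> E * exp (- (\<tau> * \<omega>)\<^sup>2 / 2)" by (simp add: E_def)
      moreover have "indicator {-R..R} \<omega> = (1::real)" using True by simp
      ultimately show ?thesis by linarith
    next
      case False
      then have "\<bar>\<sigma> * R\<bar> \<le> \<bar>\<sigma> * \<omega>\<bar>" using \<sigma> R by (auto simp: abs_mult)
      then have "(\<sigma> * R)\<^sup>2 \<le> (\<sigma> * \<omega>)\<^sup>2" by (simp add: abs_le_square_iff)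
      then have "- (\<sigma> * \<omega>)\<^sup>2 / 2 \<le> - (\<sigma> * R)\<^sup>2 / 4 + - (\<tau> * \<omega>)\<^sup>2 / 2" using \<tau>2[of \<omega>] by linarith
      then have "exp (- (\<sigma> * \<omega>)\<^sup>2 / 2) \<le> E * exp (- (\<tau> * \<omega>)\<^sup>2 / 2)"
        by (simp only: E_def exp_add[symmetric] exp_le_cancel_iff)
      then show ?thesis using False by simp
    qed
    then have "exp (- (\<sigma> * \<omega>)\<^sup>2 / 2) * (cmod (centred_fourier F \<omega>))\<^sup>2
        \<le> (indicator {-R..R} \<omega> + E * exp (- (\<tau> * \<omega>)\<^sup>2 / 2)) * (cmod (centred_fourier F \<omega>))\<^sup>2"
      by (rule mult_right_mono) simp
    then show "exp (- (\<sigma> * \<omega>)\<^sup>2 / 2) * (cmod (centred_fourier F \<omega>))\<^sup>2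
        \<le> indicator {-R..R} \<omega> * (cmod (centred_fourier F \<omega>))\<^sup>2
      + E * (exp (- (\<tau> * \<omega>)\<^sup>2 / 2) * (cmod (centred_fourier F \<omega>))\<^sup>2)"
      by (simp add: algebra_simps)
  qed
  also have "\<dots> = J + E * Q \<tau>"
    using gaussian_integral_centred_fourier(1)[OF \<tau>] lborel_integral_Icc_fourier
    by (subst Bochner_Integration.integral_add) (auto simp: J_def Q_def)
  also have "\<dots> \<le> J + E * N"
    using gaussian_integral_le[OF \<tau>] by (auto simp: Q_def N_def E_def)
  finally show ?thesis using Q2 by (simp add: N_def E_def J_def algebra_simps)
qed

end

section \<open>Nonuniform sampling\<close>

text \<open>Young's inequality with a free weight. Summed over cells with the weight chosen as a
  ratio of norm bounds, it gives the constants of Minkowski's inequality without treating the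
  sampled step function as an element of a Hilbert space.\<close>

lemma cmod_power2_le_weighted:
  assumes "\<theta> > 0"
  shows "(cmod a)\<^sup>2 \<le> (1 + \<theta>) * (cmod b)\<^sup>2 + (1 + 1 / \<theta>) * (cmod (a - b))\<^sup>2"
proof -
  define x y where "x = cmod b" and "y = cmod (a - b)"
  have "cmod a \<le> x + y" unfolding x_def y_def using norm_triangle_ineq[of b "a - b"] by simp
  then have "(cmod a)\<^sup>2 \<le> (x + y)\<^sup>2" by (intro power_mono) auto
  also have "(x + y)\<^sup>2 \<le> (1 + \<theta>) * x\<^sup>2 + (1 + 1 / \<theta>) * y\<^sup>2"
  proof -
    have "0 \<le> (\<theta> * x - y)\<^sup>2 / \<theta>" using assms by simp
    also have "\<dots> = (1 + \<theta>) * x\<^sup>2 + (1 + 1 / \<theta>) * y\<^sup>2 - (x + y)\<^sup>2"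
      using assms by (simp add: field_simps power2_eq_square)
    finally show ?thesis by simp
  qed
  finally show ?thesis by (simp add: x_def y_def)
qed

lemma sum_integral_telescope:
  fixes f :: "real \<Rightarrow> real" and z :: "nat \<Rightarrow> real"
  assumes f: "continuous_on UNIV f" and z: "\<And>n. n < N \<Longrightarrow> z n \<le> z (Suc n)"
  shows "z 0 \<le> z N \<and> (\<Sum>n<N. integral {z n..z (Suc n)} f) = integral {z 0..z N} f"
  using z
proof (induction N)
  case (Suc N)
  then have IH: "z 0 \<le> z N" "(\<Sum>n<N. integral {z n..z (Suc n)} f) = integral {z 0..z N} f" by auto
  have "f integrable_on {z 0..z (Suc N)}"
    by (rule integrable_continuous_interval, rule continuous_on_subset[OF f]) simp
  then show ?case
    using IH Suc.prems[of N] Henstock_Kurzweil_Integration.integral_combine[of "z 0" "z N" "z (Suc N)" f] by auto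
qed simp

context unit_L2
begin

lemma continuous_centred_fourier_derivative:
  "continuous_on S (centred_fourier (\<lambda>x. \<i> * of_real (pi * (1 - 2 * x)) * F x))"
  by (rule unit_L2.continuous_centred_fourier[OF unit_L2_derivative])

text \<open>The node \<open>c\<close> splits the cell into two halves, and the difference to the
  value at \<open>c\<close> vanishes at one end of each. The half length \<delta>/2 turns 2L/\<pi>
  into \<delta>/\<pi>.\<close>

lemma wirtinger_centred_fourier:
  assumes "a \<le> c" "c \<le> b" "c - a \<le> \<delta> / 2" "b - c \<le> \<delta> / 2" "\<delta> > 0"
  shows "integral {a..b} (\<lambda>\<omega>. (cmod (centred_fourier F \<omega> - centred_fourier F c))\<^sup>2)
    \<le> (\<delta> / pi)\<^sup>2 * integral {a..b} (\<lambda>\<omega>. (cmod (centred_fourier (\<lambda>x. \<i> * of_real (pi * (1 - 2 * x)) * F x) \<omega>))\<^sup>2)"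
proof -
  define g where "g = (\<lambda>\<omega>. centred_fourier F \<omega> - centred_fourier F c)"
  define g' where "g' = centred_fourier (\<lambda>x. \<i> * of_real (pi * (1 - 2 * x)) * F x)"
  have g: "(g has_vector_derivative g' x) (at x within S)" for x S
  proof -
    have "(g has_vector_derivative g' x - 0) (at x)"
      unfolding g_def g'_def
      by (rule has_vector_derivative_diff centred_fourier_has_derivative has_vector_derivative_const)+
    then show ?thesis by (simp only: diff_zero has_vector_derivative_at_within)
  qed
  have g': "continuous_on S g'" for S unfolding g'_def by (rule continuous_centred_fourier_derivative)
  have cg: "continuous_on S g" for S unfolding g_def by (intro continuous_intros continuous_centred_fourier)
  have comb: "integral {a..b} (\<lambda>\<omega>. (cmod (h \<omega>))\<^sup>2)
      = integral {a..c} (\<lambda>\<omega>. (cmod (h \<omega>))\<^sup>2) + integral {c..b} (\<lambda>\<omega>. (cmod (h \<omega>))\<^sup>2)"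
    if "\<And>S. continuous_on S h" for h :: "real \<Rightarrow> complex"
  proof -
    have "(\<lambda>\<omega>. (cmod (h \<omega>))\<^sup>2) integrable_on {a..b}"
      by (intro integrable_continuous_interval continuous_intros that)
    then show ?thesis by (rule Henstock_Kurzweil_Integration.integral_combine[OF assms(1,2), symmetric])
  qed
  have "integral {a..c} (\<lambda>\<omega>. (cmod (g \<omega>))\<^sup>2) \<le> (2 * (\<delta> / 2) / pi)\<^sup>2 * integral {a..c} (\<lambda>\<omega>. (cmod (g' \<omega>))\<^sup>2)"
    by (rule wirtinger_half_interval) (use assms g g' in \<open>auto simp: g_def\<close>)
  moreover have "integral {c..b} (\<lambda>\<omega>. (cmod (g \<omega>))\<^sup>2) \<le> (2 * (\<delta> / 2) / pi)\<^sup>2 * integral {c..b} (\<lambda>\<omega>. (cmod (g' \<omega>))\<^sup>2)"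
    by (rule wirtinger_half_interval) (use assms g g' in \<open>auto simp: g_def\<close>)
  ultimately have "integral {a..b} (\<lambda>\<omega>. (cmod (g \<omega>))\<^sup>2) \<le> (\<delta> / pi)\<^sup>2 * integral {a..b} (\<lambda>\<omega>. (cmod (g' \<omega>))\<^sup>2)"
    unfolding comb[OF cg] comb[OF g'] by (simp add: distrib_left)
  then show ?thesis by (simp add: g_def g'_def)
qed

context
  fixes \<delta> :: real and N :: nat and z \<omega> :: "nat \<Rightarrow> real"
  assumes \<delta>: "\<delta> > 0"
    and z: "\<And>n. n < N \<Longrightarrow> z n \<le> \<omega> (Suc n)" "\<And>n. n < N \<Longrightarrow> \<omega> (Suc n) \<le> z (Suc n)"
    and gap: "\<And>n. n < N \<Longrightarrow> \<omega> (Suc n) - z n \<le> \<delta> / 2" "\<And>n. n < N \<Longrightarrow> z (Suc n) - \<omega> (Suc n) \<le> \<delta> / 2"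
begin

lemma cells: "n < N \<Longrightarrow> z n \<le> z (Suc n)"
  using z by (meson order_trans)

text \<open>Wirtinger's inequality on each cell, after which the integrals of the derivative
  telescope to one interval. The derivative is again the transform of a function on the unit
  interval, so \<open>bessel\<close> applies to it, and the two factors \<pi> cancel. Nodes are
  numbered from 1 and cells from 0: the node in the cell from \<open>z n\<close> to
  \<open>z (Suc n)\<close> is \<open>\<omega> (Suc n)\<close>.\<close>

lemma sampling_defect:
  "(\<Sum>n<N. integral {z n..z (Suc n)} (\<lambda>x. (cmod (centred_fourier F x - centred_fourier F (\<omega> (Suc n))))\<^sup>2))
    \<le> \<delta>\<^sup>2 * sq_norm F"
proof -
  define F' where "F' = (\<lambda>x. \<i> * of_real (pi * (1 - 2 * x)) * F x)"
  define g' where "g' = centred_fourier F'"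
  have g': "continuous_on S g'" for S
    unfolding g'_def F'_def by (rule continuous_centred_fourier_derivative)
  have "(\<Sum>n<N. integral {z n..z (Suc n)} (\<lambda>x. (cmod (centred_fourier F x - centred_fourier F (\<omega> (Suc n))))\<^sup>2))
      \<le> (\<Sum>n<N. (\<delta> / pi)\<^sup>2 * integral {z n..z (Suc n)} (\<lambda>x. (cmod (g' x))\<^sup>2))"
    unfolding g'_def F'_def
    by (intro sum_mono wirtinger_centred_fourier) (use z gap \<delta> in auto)
  also have "\<dots> = (\<delta> / pi)\<^sup>2 * integral {z 0..z N} (\<lambda>x. (cmod (g' x))\<^sup>2)"
    using sum_integral_telescope[of "\<lambda>x. (cmod (g' x))\<^sup>2" N z] cells
    by (simp add: sum_distrib_left[symmetric] g' continuous_intros)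
  also have "\<dots> \<le> (\<delta> / pi)\<^sup>2 * (pi\<^sup>2 * sq_norm F)"
    unfolding g'_def F'_def
    using unit_L2.bessel[OF unit_L2_derivative] sq_norm_derivative
    by (intro mult_left_mono) (auto intro: order_trans)
  also have "\<dots> = \<delta>\<^sup>2 * sq_norm F" by (simp add: power_divide)
  finally show ?thesis .
qed

lemma sampling_upper:
  "(\<Sum>n<N. (z (Suc n) - z n) * (cmod (centred_fourier F (\<omega> (Suc n))))\<^sup>2) \<le> (1 + \<delta>)\<^sup>2 * sq_norm F"
proof -
  let ?\<Phi> = "centred_fourier F"
  have c: "continuous_on S ?\<Phi>" for S by (rule continuous_centred_fourier)
  \<comment> \<open>The weight is \<delta>, the bound on the defect relative to the norm: (1 +
    \<delta>) + (1 + 1/\<delta>) \<delta>^2 = (1 + \<delta>)^2.\<close>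
  have "(\<Sum>n<N. (z (Suc n) - z n) * (cmod (?\<Phi> (\<omega> (Suc n))))\<^sup>2)
      \<le> (\<Sum>n<N. (1 + \<delta>) * integral {z n..z (Suc n)} (\<lambda>x. (cmod (?\<Phi> x))\<^sup>2)
        + (1 + 1 / \<delta>) * integral {z n..z (Suc n)} (\<lambda>x. (cmod (?\<Phi> x - ?\<Phi> (\<omega> (Suc n))))\<^sup>2))"
  proof (rule sum_mono)
    fix n assume "n \<in> {..<N}"
    have "(z (Suc n) - z n) * (cmod (?\<Phi> (\<omega> (Suc n))))\<^sup>2
        = integral {z n..z (Suc n)} (\<lambda>x. (cmod (?\<Phi> (\<omega> (Suc n))))\<^sup>2)"
      using cells \<open>n \<in> {..<N}\<close> by simp
    also have "\<dots> \<le> integral {z n..z (Suc n)} (\<lambda>x. (1 + \<delta>) * (cmod (?\<Phi> x))\<^sup>2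
        + (1 + 1 / \<delta>) * (cmod (?\<Phi> x - ?\<Phi> (\<omega> (Suc n))))\<^sup>2)"
    proof (intro integral_le integrable_continuous_interval continuous_intros c)
      fix x
      show "(cmod (?\<Phi> (\<omega> (Suc n))))\<^sup>2 \<le> (1 + \<delta>) * (cmod (?\<Phi> x))\<^sup>2
        + (1 + 1 / \<delta>) * (cmod (?\<Phi> x - ?\<Phi> (\<omega> (Suc n))))\<^sup>2"
        using cmod_power2_le_weighted[OF \<delta>, of "?\<Phi> (\<omega> (Suc n))" "?\<Phi> x"] by (simp add: norm_minus_commute)
    qed
    also have "\<dots> = (1 + \<delta>) * integral {z n..z (Suc n)} (\<lambda>x. (cmod (?\<Phi> x))\<^sup>2)
        + (1 + 1 / \<delta>) * integral {z n..z (Suc n)} (\<lambda>x. (cmod (?\<Phi> x - ?\<Phi> (\<omega> (Suc n))))\<^sup>2)"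
      by (subst Henstock_Kurzweil_Integration.integral_add)
        (auto intro!: integrable_continuous_interval continuous_intros c)
    finally show "(z (Suc n) - z n) * (cmod (?\<Phi> (\<omega> (Suc n))))\<^sup>2 \<le> \<dots>" .
  qed
  also have "\<dots> = (1 + \<delta>) * integral {z 0..z N} (\<lambda>x. (cmod (?\<Phi> x))\<^sup>2)
     + (1 + 1 / \<delta>) * (\<Sum>n<N. integral {z n..z (Suc n)} (\<lambda>x. (cmod (?\<Phi> x - ?\<Phi> (\<omega> (Suc n))))\<^sup>2))"
    using sum_integral_telescope[of "\<lambda>x. (cmod (?\<Phi> x))\<^sup>2" N z] cells
    by (simp add: sum.distrib sum_distrib_left[symmetric] c continuous_intros)
  also have "\<dots> \<le> (1 + \<delta>) * sq_norm F + (1 + 1 / \<delta>) * (\<delta>\<^sup>2 * sq_norm F)"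
    using \<delta> by (intro add_mono mult_left_mono bessel sampling_defect) auto
  also have "\<dots> = (1 + \<delta>)\<^sup>2 * sq_norm F" using \<delta> by (simp add: field_simps power2_eq_square)
  finally show ?thesis .
qed

lemma sampling_lower:
  assumes \<beta>: "\<beta> > \<delta>" "\<beta>\<^sup>2 * sq_norm F \<le> integral {z 0..z N} (\<lambda>x. (cmod (centred_fourier F x))\<^sup>2)"
  shows "(\<beta> - \<delta>)\<^sup>2 * sq_norm F \<le> (\<Sum>n<N. (z (Suc n) - z n) * (cmod (centred_fourier F (\<omega> (Suc n))))\<^sup>2)"
    (is "_ \<le> ?S")
proof -
  let ?\<Phi> = "centred_fourier F"
  \<comment> \<open>Ratio of the defect bound \<delta> to the expected sampled norm \<beta> -
    \<delta>. With it the estimate, divided by \<beta>, becomes exactly the square of \<beta> -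
    \<delta>.\<close>
  define \<theta> where "\<theta> = \<delta> / (\<beta> - \<delta>)"
  have \<theta>: "\<theta> > 0" using \<beta> \<delta> by (simp add: \<theta>_def)
  have \<theta>1: "1 + \<theta> = \<beta> / (\<beta> - \<delta>)" and \<theta>2: "1 + 1 / \<theta> = \<beta> / \<delta>"
    using \<beta> \<delta> by (auto simp: \<theta>_def field_simps)
  have c: "continuous_on S ?\<Phi>" for S by (rule continuous_centred_fourier)
  have "integral {z 0..z N} (\<lambda>x. (cmod (?\<Phi> x))\<^sup>2) = (\<Sum>n<N. integral {z n..z (Suc n)} (\<lambda>x. (cmod (?\<Phi> x))\<^sup>2))"
    using sum_integral_telescope[of "\<lambda>x. (cmod (?\<Phi> x))\<^sup>2" N z] cells
    by (simp add: c continuous_intros)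
  also have "\<dots> \<le> (\<Sum>n<N. (1 + \<theta>) * ((z (Suc n) - z n) * (cmod (?\<Phi> (\<omega> (Suc n))))\<^sup>2)
        + (1 + 1 / \<theta>) * integral {z n..z (Suc n)} (\<lambda>x. (cmod (?\<Phi> x - ?\<Phi> (\<omega> (Suc n))))\<^sup>2))"
  proof (rule sum_mono)
    fix n assume n: "n \<in> {..<N}"
    have "integral {z n..z (Suc n)} (\<lambda>x. (cmod (?\<Phi> x))\<^sup>2)
      \<le> integral {z n..z (Suc n)} (\<lambda>x. (1 + \<theta>) * (cmod (?\<Phi> (\<omega> (Suc n))))\<^sup>2
        + (1 + 1 / \<theta>) * (cmod (?\<Phi> x - ?\<Phi> (\<omega> (Suc n))))\<^sup>2)"
      by (intro integral_le integrable_continuous_interval continuous_intros c cmod_power2_le_weighted \<theta>)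
    also have "\<dots> = integral {z n..z (Suc n)} (\<lambda>x. (1 + \<theta>) * (cmod (?\<Phi> (\<omega> (Suc n))))\<^sup>2)
        + (1 + 1 / \<theta>) * integral {z n..z (Suc n)} (\<lambda>x. (cmod (?\<Phi> x - ?\<Phi> (\<omega> (Suc n))))\<^sup>2)"
      by (subst Henstock_Kurzweil_Integration.integral_add)
        (auto intro!: integrable_continuous_interval continuous_intros c)
    also have "integral {z n..z (Suc n)} (\<lambda>x. (1 + \<theta>) * (cmod (?\<Phi> (\<omega> (Suc n))))\<^sup>2)
        = (1 + \<theta>) * ((z (Suc n) - z n) * (cmod (?\<Phi> (\<omega> (Suc n))))\<^sup>2)"
      using cells n by simp
    finally show "integral {z n..z (Suc n)} (\<lambda>x. (cmod (?\<Phi> x))\<^sup>2)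
      \<le> (1 + \<theta>) * ((z (Suc n) - z n) * (cmod (?\<Phi> (\<omega> (Suc n))))\<^sup>2)
        + (1 + 1 / \<theta>) * integral {z n..z (Suc n)} (\<lambda>x. (cmod (?\<Phi> x - ?\<Phi> (\<omega> (Suc n))))\<^sup>2)" .
  qed
  also have "\<dots> = (1 + \<theta>) * ?S
     + (1 + 1 / \<theta>) * (\<Sum>n<N. integral {z n..z (Suc n)} (\<lambda>x. (cmod (?\<Phi> x - ?\<Phi> (\<omega> (Suc n))))\<^sup>2))"
    by (simp add: sum.distrib sum_distrib_left[symmetric])
  also have "\<dots> \<le> (1 + \<theta>) * ?S + (1 + 1 / \<theta>) * (\<delta>\<^sup>2 * sq_norm F)"
    using \<theta> by (intro add_mono mult_left_mono sampling_defect) auto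
  finally have "\<beta>\<^sup>2 * sq_norm F \<le> (1 + \<theta>) * ?S + (1 + 1 / \<theta>) * (\<delta>\<^sup>2 * sq_norm F)"
    using \<beta>(2) by linarith
  then have "\<beta> * (\<beta> * sq_norm F - \<delta> * sq_norm F) \<le> \<beta> * (?S / (\<beta> - \<delta>))"
    unfolding \<theta>1 \<theta>2 using \<delta> by (simp add: algebra_simps power2_eq_square)
  then have "\<beta> * sq_norm F - \<delta> * sq_norm F \<le> ?S / (\<beta> - \<delta>)"
    using \<beta>(1) \<delta> by (simp only: mult_le_cancel_left_pos)
  then have "(\<beta> * sq_norm F - \<delta> * sq_norm F) * (\<beta> - \<delta>) \<le> ?S"
    using \<beta>(1) by (simp add: pos_le_divide_eq)
  then show ?thesis by (simp add: power2_eq_square algebra_simps)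
qed

end

end

section \<open>Borel representatives of elements of L^2(0,1)\<close>

text \<open>Integrals over (0,1) for the completed measure equal Borel integrals over the line,
  since the representative vanishes off [0,1] and the end points are null. Recentring multiplies the
  transform by the unimodular factor exp(i\<pi>\<omega>), so only the modulus is preserved.\<close>

lemma unit_L2_representative:
  assumes F: "unit_L2 F" and f: "f \<in> borel_measurable unit_leb"
    and ae: "AE x in unit_leb. f x = F x"
  shows "f \<in> L2_unit" and "(L2_norm_unit f)\<^sup>2 = sq_norm F"
    and "cmod (fourier_unit f \<omega>) = cmod (centred_fourier F \<omega>)"
proof -
  interpret unit_L2 F by fact
  have Fm: "F \<in> borel_measurable unit_leb"
    by (rule measurable_restrict_space1) (use meas in \<open>simp add: measurable_completion\<close>)
  \<comment> \<open>Stated for values in a Banach space because it is used both for the real squared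
    norm and for the complex Fourier integral.\<close>
  have transfer: "integral\<^sup>L unit_leb g = integral\<^sup>L lborel h"
    if gh: "AE x in unit_leb. g x = h x" and g: "g \<in> borel_measurable unit_leb"
      and [measurable]: "h \<in> borel_measurable borel" and h0: "\<And>x. x \<notin> {0..1} \<Longrightarrow> h x = 0"
    for g h :: "real \<Rightarrow> 'a :: {banach, second_countable_topology}"
  proof -
    have hm: "h \<in> borel_measurable unit_leb"
      by (rule measurable_restrict_space1) (simp add: measurable_completion)
    have "integral\<^sup>L unit_leb g = integral\<^sup>L unit_leb h"
      by (rule integral_cong_AE[OF g hm gh])
    also have "\<dots> = integral\<^sup>L lebesgue (\<lambda>x. indicator {0<..<1} x *\<^sub>R h x)"
      by (rule integral_restrict_space) auto
    also have "\<dots> = integral\<^sup>L lborel (\<lambda>x. indicator {0<..<1} x *\<^sub>R h x)"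
      by (rule integral_completion) measurable
    also have "\<dots> = integral\<^sup>L lborel h"
    proof (rule integral_cong_AE)
      show "AE x in lborel. indicator {0<..<1} x *\<^sub>R h x = h x"
        using AE_lborel_singleton[of 0] AE_lborel_singleton[of 1]
      proof eventually_elim
        case (elim x)
        then show ?case using h0[of x] by (cases "x \<in> {0..1}") (auto simp: indicator_def)
      qed
    qed measurable
    finally show ?thesis .
  qed
  have "integrable unit_leb (\<lambda>x. (cmod (F x))\<^sup>2)"
  proof -
    have "integrable lebesgue (\<lambda>x. (cmod (F x))\<^sup>2)" using sq by (subst integrable_completion) auto
    then have "integrable lebesgue (\<lambda>x. indicator {0<..<1} x *\<^sub>R (cmod (F x))\<^sup>2)"
      by (intro integrable_mult_indicator) auto
    then show ?thesis by (subst integrable_restrict_space) auto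
  qed
  then have "integrable unit_leb (\<lambda>x. (cmod (f x))\<^sup>2)"
    by (rule integrable_cong_AE_imp) (use f ae in auto)
  then show "f \<in> L2_unit" using f by (simp add: L2_unit_def)
  have "(\<integral>x. (cmod (f x))\<^sup>2 \<partial>unit_leb) = (\<integral>x. (cmod (F x))\<^sup>2 \<partial>lborel)"
    by (rule transfer) (use f ae supp in auto)
  then show "(L2_norm_unit f)\<^sup>2 = sq_norm F"
    by (simp add: L2_norm_unit_def sq_norm_def)
  define e where "e = (\<lambda>x. exp (- (2 * complex_of_real pi * \<i> * complex_of_real \<omega> * complex_of_real x)))"
  have e [measurable]: "e \<in> borel_measurable borel"
    unfolding e_def by (intro borel_measurable_continuous_onI continuous_intros)
  have em: "e \<in> borel_measurable unit_leb"
    by (rule measurable_restrict_space1) (use e in \<open>simp add: measurable_completion\<close>)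
  have "fourier_unit f \<omega> = integral\<^sup>L unit_leb (\<lambda>x. f x * e x)"
    by (simp only: fourier_unit_def e_def)
  also have "\<dots> = (\<integral>x. F x * e x \<partial>lborel)"
  proof (rule transfer)
    show "AE x in unit_leb. f x * e x = F x * e x" using ae by eventually_elim simp
    show "(\<lambda>x. f x * e x) \<in> borel_measurable unit_leb" using f em by (rule borel_measurable_times)
  qed (use supp in auto)
  finally have "fourier_unit f \<omega> = (\<integral>x. F x * e x \<partial>lborel)" .
  moreover have "centred_fourier F \<omega> = iexp (pi * \<omega>) * (\<integral>x. F x * e x \<partial>lborel)"
  proof -
    have "iexp (pi * \<omega> * (1 - 2 * x)) = iexp (pi * \<omega>) * e x" for x
      by (simp add: e_def exp_add[symmetric] algebra_simps)
    then have "centred_fourier F \<omega> = (\<integral>x. iexp (pi * \<omega>) * (F x * e x) \<partial>lborel)"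
      unfolding centred_fourier_def by (simp only: mult.left_commute)
    then show ?thesis by simp
  qed
  ultimately show "cmod (fourier_unit f \<omega>) = cmod (centred_fourier F \<omega>)"
    by (simp add: norm_mult)
qed

text \<open>Real and imaginary parts of the cut-off function are Lebesgue measurable, so each agrees
  almost everywhere with a Borel function; the cut-off is applied once more to restore the
  support.\<close>

lemma L2_unit_representative_exists:
  assumes "f \<in> L2_unit"
  obtains F where "unit_L2 F" "AE x in unit_leb. f x = F x"
proof -
  have f: "f \<in> borel_measurable unit_leb" "integrable unit_leb (\<lambda>x. (cmod (f x))\<^sup>2)"
    using assms by (auto simp: L2_unit_def)
  define g where "g = (\<lambda>x. indicator {0<..<1} x *\<^sub>R f x)"
  have g: "g \<in> borel_measurable lebesgue"
    using f(1) unfolding g_def by (subst (asm) borel_measurable_restrict_space_iff) auto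
  have "(\<lambda>x. Re (g x)) \<in> borel_measurable lebesgue" "(\<lambda>x. Im (g x)) \<in> borel_measurable lebesgue"
    using g by auto
  then obtain u v where u [measurable]: "u \<in> borel_measurable lborel" and uae: "AE x in lborel. Re (g x) = u x"
    and v [measurable]: "v \<in> borel_measurable lborel" and vae: "AE x in lborel. Im (g x) = v x"
    using completion_ex_borel_measurable_real[of "\<lambda>x. Re (g x)" lborel]
      completion_ex_borel_measurable_real[of "\<lambda>x. Im (g x)" lborel] by blast
  define F where "F = (\<lambda>x. indicator {0<..<1} x *\<^sub>R (complex_of_real (u x) + \<i> * complex_of_real (v x)))"
  have Fm [measurable]: "F \<in> borel_measurable borel" using u v unfolding F_def by measurable
  have "AE x in lborel. g x = F x"
    using uae vae
  proof eventually_elim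
    case (elim x)
    then have "g x = complex_of_real (u x) + \<i> * complex_of_real (v x)" by (simp add: complex_eq_iff)
    then show ?case unfolding F_def g_def by (auto simp: indicator_def split: if_splits)
  qed
  then have ae: "AE x in lebesgue. g x = F x" by (rule AE_completion)
  have "integrable lebesgue (\<lambda>x. indicator {0<..<1} x *\<^sub>R (cmod (f x))\<^sup>2)"
    using f(2) by (subst (asm) integrable_restrict_space) auto
  then have "integrable lebesgue (\<lambda>x. (cmod (F x))\<^sup>2)"
  proof (rule integrable_cong_AE_imp)
    show "(\<lambda>x. (cmod (F x))\<^sup>2) \<in> borel_measurable lebesgue"
      by (rule measurable_completion) measurable
    show "AE x in lebesgue. indicator {0<..<1} x *\<^sub>R (cmod (f x))\<^sup>2 = (cmod (F x))\<^sup>2"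
      using ae
    proof eventually_elim
      case (elim x)
      have "indicator {0<..<1} x *\<^sub>R (cmod (f x))\<^sup>2 = (cmod (g x))\<^sup>2"
        by (simp add: g_def indicator_def)
      then show ?case using elim by simp
    qed
  qed
  then have "integrable lborel (\<lambda>x. (cmod (F x))\<^sup>2)" by (subst (asm) integrable_completion) auto
  then have "unit_L2 F" by unfold_locales (auto simp: F_def indicator_def)
  moreover have "AE x in unit_leb. f x = F x"
    using ae by (subst AE_restrict_space_iff) (auto simp: g_def indicator_def elim: eventually_mono)
  ultimately show thesis by (rule that)
qed

section \<open>From frame bounds to quasi-optimality\<close>

lemma L2_unit_integrable:
  assumes "f \<in> L2_unit"
  shows "integrable unit_leb f"
proof (rule Bochner_Integration.integrable_bound)
  have f: "f \<in> borel_measurable unit_leb" "integrable unit_leb (\<lambda>x. (cmod (f x))\<^sup>2)"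
    using assms by (auto simp: L2_unit_def)
  interpret finite_measure unit_leb by (rule finite_measure_lebesgue_on) simp
  show "integrable unit_leb (\<lambda>x. (cmod (f x))\<^sup>2 + 1)" using f(2) by simp
  have "cmod (f x) \<le> (cmod (f x))\<^sup>2 + 1" for x
  proof -
    have "0 \<le> (cmod (f x) - 1)\<^sup>2 + (cmod (f x))\<^sup>2 + 1" by simp
    then show ?thesis by (simp add: power2_eq_square algebra_simps)
  qed
  then show "AE x in unit_leb. norm (f x) \<le> norm ((cmod (f x))\<^sup>2 + 1)"
    by (intro AE_I2) (simp only: real_norm_def, smt (verit))
  show "f \<in> borel_measurable unit_leb" by (rule f)
qed

lemma L2_unit_add_scale:
  assumes f: "f \<in> L2_unit" and g: "g \<in> L2_unit"
  shows "(\<lambda>x. f x + a * g x) \<in> L2_unit"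
proof -
  have fm: "f \<in> borel_measurable unit_leb" "g \<in> borel_measurable unit_leb" and
    i: "integrable unit_leb (\<lambda>x. (cmod (f x))\<^sup>2)" "integrable unit_leb (\<lambda>x. (cmod (g x))\<^sup>2)"
    using f g by (auto simp: L2_unit_def)
  have m: "(\<lambda>x. f x + a * g x) \<in> borel_measurable unit_leb"
    using fm by (intro borel_measurable_add borel_measurable_times) auto
  have "integrable unit_leb (\<lambda>x. (cmod (f x + a * g x))\<^sup>2)"
  proof (rule Bochner_Integration.integrable_bound)
    show "integrable unit_leb (\<lambda>x. 2 * (cmod (f x))\<^sup>2 + 2 * (cmod a)\<^sup>2 * (cmod (g x))\<^sup>2)" using i by simp
    show "AE x in unit_leb. norm ((cmod (f x + a * g x))\<^sup>2)
        \<le> norm (2 * (cmod (f x))\<^sup>2 + 2 * (cmod a)\<^sup>2 * (cmod (g x))\<^sup>2)"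
      using cmod_add_power2_le[of "f _" "a * g _"] by (auto simp: norm_mult power_mult_distrib mult.assoc)
  qed (use m in auto)
  then show ?thesis using m by (simp add: L2_unit_def)
qed

lemma fourier_unit_add_scale:
  assumes f: "f \<in> L2_unit" and g: "g \<in> L2_unit"
  shows "fourier_unit (\<lambda>x. f x + a * g x) \<omega> = fourier_unit f \<omega> + a * fourier_unit g \<omega>"
proof -
  define e where "e = (\<lambda>x. exp (- (2 * complex_of_real pi * \<i> * complex_of_real \<omega> * complex_of_real x)))"
  have e: "e \<in> borel_measurable borel"
    unfolding e_def by (intro borel_measurable_continuous_onI continuous_intros)
  have em: "e \<in> borel_measurable unit_leb"
    by (rule measurable_restrict_space1) (use e in \<open>simp add: measurable_completion\<close>)
  have i: "integrable unit_leb (\<lambda>x. h x * e x)" if "h \<in> L2_unit" for h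
  proof (rule Bochner_Integration.integrable_bound[OF L2_unit_integrable[OF that]])
    show "(\<lambda>x. h x * e x) \<in> borel_measurable unit_leb"
      using that em by (intro borel_measurable_times) (auto simp: L2_unit_def)
  qed (simp add: norm_mult e_def)
  have FT: "fourier_unit h \<omega> = (\<integral>x. h x * e x \<partial>unit_leb)" for h
    by (simp only: fourier_unit_def e_def)
  have "(\<integral>x. (f x + a * g x) * e x \<partial>unit_leb) = (\<integral>x. f x * e x + a * (g x * e x) \<partial>unit_leb)"
    by (simp add: algebra_simps)
  also have "\<dots> = (\<integral>x. f x * e x \<partial>unit_leb) + a * (\<integral>x. g x * e x \<partial>unit_leb)"
    using i[OF f] i[OF g] by simp
  finally show ?thesis unfolding FT .
qed

lemma L2_norm_unit_nonneg: "0 \<le> L2_norm_unit f"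
  by (simp add: L2_norm_unit_def)

text \<open>\<open>B\<close> is the integral of the pointwise real inner product. Only the shape of
  the quadratic form on the real span of \<open>f\<close> and \<open>g\<close> matters later, so
  \<open>B\<close> is left unnamed.\<close>

lemma L2_norm_unit_combination:
  assumes f: "f \<in> L2_unit" and g: "g \<in> L2_unit"
  shows "\<exists>B. \<forall>a b :: real. (L2_norm_unit (\<lambda>x. of_real a * f x + of_real b * g x))\<^sup>2
    = a\<^sup>2 * (L2_norm_unit f)\<^sup>2 + 2 * a * b * B + b\<^sup>2 * (L2_norm_unit g)\<^sup>2"
proof -
  have sq: "(L2_norm_unit h)\<^sup>2 = (\<integral>x. (cmod (h x))\<^sup>2 \<partial>unit_leb)" for h
    by (simp add: L2_norm_unit_def)
  have fm: "f \<in> borel_measurable unit_leb" "g \<in> borel_measurable unit_leb" and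
    i: "integrable unit_leb (\<lambda>x. (cmod (f x))\<^sup>2)" "integrable unit_leb (\<lambda>x. (cmod (g x))\<^sup>2)"
    using f g by (auto simp: L2_unit_def)
  have ib: "integrable unit_leb (\<lambda>x. f x \<bullet> g x)"
  proof (rule Bochner_Integration.integrable_bound)
    show "integrable unit_leb (\<lambda>x. (cmod (f x))\<^sup>2 + (cmod (g x))\<^sup>2)" using i by simp
    show "(\<lambda>x. f x \<bullet> g x) \<in> borel_measurable unit_leb" using fm by (rule borel_measurable_inner)
    have "\<bar>f x \<bullet> g x\<bar> \<le> (cmod (f x))\<^sup>2 + (cmod (g x))\<^sup>2" for x
      using Cauchy_Schwarz_ineq2[of "f x" "g x"] sum_squares_bound[of "cmod (f x)" "cmod (g x)"]
        mult_nonneg_nonneg[OF norm_ge_zero norm_ge_zero, of "f x" "g x"] by linarith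
    then show "AE x in unit_leb. norm (f x \<bullet> g x) \<le> norm ((cmod (f x))\<^sup>2 + (cmod (g x))\<^sup>2)" by auto
  qed
  have "(cmod (of_real a * f x + of_real b * g x))\<^sup>2
      = a\<^sup>2 * (cmod (f x))\<^sup>2 + 2 * a * b * (f x \<bullet> g x) + b\<^sup>2 * (cmod (g x))\<^sup>2" for a b x
    unfolding scaleR_conv_of_real[symmetric] power2_norm_eq_inner
    by (simp add: inner_add_left inner_add_right inner_commute algebra_simps power2_eq_square)
  then have "\<forall>a b :: real. (L2_norm_unit (\<lambda>x. of_real a * f x + of_real b * g x))\<^sup>2
    = a\<^sup>2 * (L2_norm_unit f)\<^sup>2 + 2 * a * b * (\<integral>x. f x \<bullet> g x \<partial>unit_leb) + b\<^sup>2 * (L2_norm_unit g)\<^sup>2"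
    unfolding sq using i ib by simp
  then show ?thesis by blast
qed

text \<open>Two-dimensional form of the identity \<open>\<parallel>P\<parallel> = \<parallel>I - P\<parallel>\<close> for an oblique projection \<open>P\<close>:
  rescaling \<open>u\<close> and \<open>v\<close> so that they exchange their norms does not change the norm of \<open>u + v\<close>.\<close>

lemma projection_complement_bound:
  fixes A B D c :: real
  assumes A: "A \<ge> 0" and D: "D \<ge> 0" and c: "c \<ge> 1"
    and pos: "\<And>a b. 0 \<le> a\<^sup>2 * A + 2 * a * b * B + b\<^sup>2 * D"
    and proj: "\<And>a b. a\<^sup>2 * A \<le> c * (a\<^sup>2 * A + 2 * a * b * B + b\<^sup>2 * D)"
  shows "D \<le> c * (A + 2 * B + D)"
proof (cases "A = 0 \<or> D = 0")
  case True
  show ?thesis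
  proof (cases "D = 0")
    case True
    then show ?thesis using pos[of 1 1] c by simp
  next
    case False
    then have A0: "A = 0" using True by simp
    have "B = 0"
    proof (rule ccontr)
      assume "B \<noteq> 0"
      \<comment> \<open>With \<open>A = 0\<close> and \<open>b = 1\<close> the form is affine in
        \<open>a\<close>; this choice gives it the value -1.\<close>
      then show False using pos[of "- (D + 1) / (2 * B)" 1] A0 by (simp add: field_simps)
    qed
    then show ?thesis using A0 D c mult_right_mono[of 1 c D] by simp
  qed
next
  case False
  then have AD: "A > 0" "D > 0" using A D by auto
  define a where "a = sqrt (D / A)"
  have a: "a > 0" "a\<^sup>2 = D / A" using AD by (auto simp: a_def)
  then have "(1 / a)\<^sup>2 = A / D" by (simp add: power_divide)
  then show ?thesis using proj[of a "1 / a"] a AD by (simp add: algebra_simps)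
qed

text \<open>The residual of a minimizer is orthogonal to \<open>T\<close> for the sampled semi-inner
  product. For u in \<open>T\<close> and v orthogonal in this sense, the frame bounds and Pythagoras
  give a |u| \<le> S(u)^(1/2) \<le> S(u + v)^(1/2) \<le> b |u + v|, with norms in L^2. Hence the
  projection has norm at most b/a, and so has its complement.\<close>

lemma stable_quasi_optimalI:
  assumes T: "T \<subseteq> L2_unit" "(\<lambda>_. 0) \<in> T"
    and Tlin: "\<And>u v a. u \<in> T \<Longrightarrow> v \<in> T \<Longrightarrow> (\<lambda>x. u x + a * v x) \<in> T"
    and \<mu>: "\<And>n. n \<in> {1..N} \<Longrightarrow> sample_weight \<Omega> K N n > 0"
    and ab: "0 < a" "a \<le> b"
    and upper: "\<And>f. f \<in> L2_unit \<Longrightarrow>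
      (\<Sum>n=1..N. sample_weight \<Omega> K N n * (cmod (fourier_unit f (\<Omega> N n)))\<^sup>2) \<le> b\<^sup>2 * (L2_norm_unit f)\<^sup>2"
    and lower: "\<And>f. f \<in> T \<Longrightarrow>
      a\<^sup>2 * (L2_norm_unit f)\<^sup>2 \<le> (\<Sum>n=1..N. sample_weight \<Omega> K N n * (cmod (fourier_unit f (\<Omega> N n)))\<^sup>2)"
  shows "stable_quasi_optimal \<Omega> K N T (b / a)"
proof -
  define \<mu> where "\<mu> = (\<lambda>i. sample_weight \<Omega> K N (Suc i))"
  define s where "s = (\<lambda>f i. fourier_unit f (\<Omega> N (Suc i)))"
  define S where "S = (\<lambda>f. \<Sum>i<N. \<mu> i * (cmod (s f i))\<^sup>2)"
  \<comment> \<open>Orthogonality of weighted sample vectors, not of functions in L^2.\<close>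
  define orth where "orth = (\<lambda>v. \<forall>t\<in>T. (\<Sum>i<N. \<mu> i * (s v i * cnj (s t i))) = 0)"
  have \<mu>0: "\<mu> i > 0" if "i < N" for i using \<mu> that by (simp add: \<mu>_def)
  have shift: "(\<Sum>n=1..N. g n) = (\<Sum>i<N. g (Suc i))" for g :: "nat \<Rightarrow> real"
    by (simp add: sum.atLeast1_atMost_eq lessThan_atLeast0)
  have s_lin: "s (\<lambda>x. f x + c * g x) i = s f i + c * s g i" if "f \<in> L2_unit" "g \<in> L2_unit" for f g c i
    unfolding s_def by (rule fourier_unit_add_scale[OF that])
  have L2_diff: "(\<lambda>x. f x - g x) \<in> L2_unit" if "f \<in> L2_unit" "g \<in> L2_unit" for f g
    using L2_unit_add_scale[OF that, of "-1"] by simp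
  have s_diff: "s (\<lambda>x. f x - g x) i = s f i - s g i" if "f \<in> L2_unit" "g \<in> L2_unit" for f g i
    using s_lin[OF that, of "-1"] by simp
  have Tdiff: "(\<lambda>x. u x - v x) \<in> T" if "u \<in> T" "v \<in> T" for u v
    using Tlin[OF that, of "-1"] by simp
  have Tscale: "(\<lambda>x. c * u x) \<in> T" if "u \<in> T" for u c
    using Tlin[OF T(2) that, of c] by simp
  have err: "wls_error \<Omega> K N f g = S (\<lambda>x. f x - g x)" if "f \<in> L2_unit" "g \<in> L2_unit" for f g
    unfolding wls_error_def shift S_def using s_diff[OF that] by (simp add: s_def \<mu>_def)
  have S0: "S f \<ge> 0" for f unfolding S_def by (intro sum_nonneg) (auto simp: \<mu>0 less_imp_le)
  have Sup: "S f \<le> b\<^sup>2 * (L2_norm_unit f)\<^sup>2" if "f \<in> L2_unit" for f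
    using upper[OF that] unfolding shift S_def s_def \<mu>_def .
  have Slow: "a\<^sup>2 * (L2_norm_unit f)\<^sup>2 \<le> S f" if "f \<in> T" for f
    using lower[OF that] unfolding shift S_def s_def \<mu>_def .
  have pyth: "S (\<lambda>x. u x + v x) = S u + S v" if u: "u \<in> T" and v: "v \<in> L2_unit" "orth v" for u v
  proof -
    have uL: "u \<in> L2_unit" using u T by auto
    have "(cmod (x + y))\<^sup>2 = (cmod x)\<^sup>2 + (cmod y)\<^sup>2 + 2 * Re (y * cnj x)" for x y
      unfolding cmod_power2 by (simp add: power2_eq_square algebra_simps)
    then have "S (\<lambda>x. u x + v x) = S u + S v + 2 * (\<Sum>i<N. \<mu> i * Re (s v i * cnj (s u i)))"
      using s_lin[OF uL v(1), of 1]
      by (simp add: S_def algebra_simps sum.distrib sum_distrib_left)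
    also have "(\<Sum>i<N. \<mu> i * Re (s v i * cnj (s u i))) = Re (\<Sum>i<N. \<mu> i * (s v i * cnj (s u i)))"
      by simp
    also have "\<dots> = 0" using v(2) u by (simp only: orth_def) simp
    finally show ?thesis by simp
  qed
  have proj1: "(L2_norm_unit u)\<^sup>2 \<le> (b / a)\<^sup>2 * (L2_norm_unit (\<lambda>x. u x + v x))\<^sup>2"
    if u: "u \<in> T" and v: "v \<in> L2_unit" "orth v" for u v
  proof -
    have uL: "u \<in> L2_unit" using u T by auto
    have "a\<^sup>2 * (L2_norm_unit u)\<^sup>2 \<le> S u" by (rule Slow[OF u])
    also have "\<dots> \<le> S (\<lambda>x. u x + v x)" using pyth[OF u v] S0[of v] by simp
    also have "\<dots> \<le> b\<^sup>2 * (L2_norm_unit (\<lambda>x. u x + v x))\<^sup>2"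
      using L2_unit_add_scale[OF uL v(1), of 1] by (intro Sup) simp
    finally show ?thesis using ab by (simp add: power_divide field_simps)
  qed
  have ba: "b / a \<ge> 1" using ab by simp
  have proj2: "(L2_norm_unit v)\<^sup>2 \<le> (b / a)\<^sup>2 * (L2_norm_unit (\<lambda>x. u x + v x))\<^sup>2"
    if u: "u \<in> T" and v: "v \<in> L2_unit" "orth v" for u v
  proof -
    have uL: "u \<in> L2_unit" using u T by auto
    obtain B where B: "\<And>\<alpha> \<beta> :: real. (L2_norm_unit (\<lambda>x. of_real \<alpha> * u x + of_real \<beta> * v x))\<^sup>2
      = \<alpha>\<^sup>2 * (L2_norm_unit u)\<^sup>2 + 2 * \<alpha> * \<beta> * B + \<beta>\<^sup>2 * (L2_norm_unit v)\<^sup>2"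
      using L2_norm_unit_combination[OF uL v(1)] by blast
    have Lscale: "(\<lambda>x. c * v x) \<in> L2_unit" for c
      using L2_unit_add_scale[of "\<lambda>_. 0" v c] v(1) T by auto
    have oscale: "orth (\<lambda>x. c * v x)" for c
    proof -
      have "s (\<lambda>x. c * v x) i = c * s v i" for i
        using s_lin[of "\<lambda>_. 0" v c i] v(1) T by (auto simp: s_def fourier_unit_def)
      then have "(\<Sum>i<N. \<mu> i * (s (\<lambda>x. c * v x) i * cnj (s t i)))
          = c * (\<Sum>i<N. \<mu> i * (s v i * cnj (s t i)))" for t
        by (simp add: sum_distrib_left ac_simps)
      then show ?thesis using v(2) by (simp add: orth_def)
    qed
    \<comment> \<open>\<open>proj1\<close> holds for every pair of scaled vectors, because
      \<open>T\<close> and \<open>orth\<close> are closed under scaling; this supplies the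
      hypothesis for all coefficients.\<close>
    have "(L2_norm_unit v)\<^sup>2 \<le> (b / a)\<^sup>2 * ((L2_norm_unit u)\<^sup>2 + 2 * B + (L2_norm_unit v)\<^sup>2)"
    proof (rule projection_complement_bound)
      show "1 \<le> (b / a)\<^sup>2" using ba by (rule one_le_power)
      fix \<alpha> \<beta> :: real
      show "0 \<le> \<alpha>\<^sup>2 * (L2_norm_unit u)\<^sup>2 + 2 * \<alpha> * \<beta> * B + \<beta>\<^sup>2 * (L2_norm_unit v)\<^sup>2"
        unfolding B[symmetric] by simp
      have "(L2_norm_unit (\<lambda>x. of_real \<alpha> * u x))\<^sup>2 = \<alpha>\<^sup>2 * (L2_norm_unit u)\<^sup>2"
        using B[of \<alpha> 0] by simp
      then show "\<alpha>\<^sup>2 * (L2_norm_unit u)\<^sup>2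
        \<le> (b / a)\<^sup>2 * (\<alpha>\<^sup>2 * (L2_norm_unit u)\<^sup>2 + 2 * \<alpha> * \<beta> * B + \<beta>\<^sup>2 * (L2_norm_unit v)\<^sup>2)"
        unfolding B[symmetric]
        using proj1[OF Tscale[OF u, of "of_real \<alpha>"] Lscale[of "of_real \<beta>"] oscale] by simp
    qed auto
    then show ?thesis using B[of 1 1] by simp
  qed
  have le: "x \<le> b / a * y" if "x\<^sup>2 \<le> (b / a)\<^sup>2 * y\<^sup>2" "0 \<le> y" for x y :: real
  proof (rule power2_le_imp_le)
    show "x\<^sup>2 \<le> (b / a * y)\<^sup>2" using that(1) by (simp only: power_mult_distrib)
    show "0 \<le> b / a * y" using ba that(2) by (intro mult_nonneg_nonneg) linarith+
  qed
  show ?thesis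
    unfolding stable_quasi_optimal_def
  proof (intro ballI)
    fix f assume f: "f \<in> L2_unit"
    \<comment> \<open>The projection is made among sample vectors, which have \<open>N\<close>
      coordinates whatever \<open>T\<close> is, and is then pulled back to some \<open>g0\<close> in
      \<open>T\<close>.\<close>
    have "\<exists>p\<in>s ` T. \<forall>t\<in>s ` T. (\<Sum>i<N. \<mu> i * ((s f i - p i) * cnj (t i))) = 0"
    proof (rule weighted_projection_exists)
      show "(\<lambda>_. 0) \<in> s ` T" using T(2) by (rule rev_image_eqI) (simp add: s_def fourier_unit_def)
      fix p q c assume "p \<in> s ` T" "q \<in> s ` T"
      then obtain u v where "u \<in> T" "v \<in> T" "p = s u" "q = s v" by auto
      moreover from this have "(\<lambda>i. p i + c * q i) = s (\<lambda>x. u x + c * v x)"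
        using T(1) s_lin[of u v c] by (simp add: fun_eq_iff subset_iff)
      ultimately show "(\<lambda>i. p i + c * q i) \<in> s ` T" using Tlin[of u v c] by simp
    qed (rule \<mu>0)
    then obtain g0 where g0: "g0 \<in> T"
      and o0: "\<And>t. t \<in> T \<Longrightarrow> (\<Sum>i<N. \<mu> i * ((s f i - s g0 i) * cnj (s t i))) = 0" by auto
    have g0L: "g0 \<in> L2_unit" using g0 T by auto
    have orth0: "orth (\<lambda>x. f x - g0 x)" using o0 by (simp add: orth_def s_diff[OF f g0L])
    \<comment> \<open>f - h = (g0 - h) + (f - g0) with orthogonal parts. The excess over the minimum
      is the sampled norm of g0 - h, which yields both minimality of \<open>g0\<close> and the
      samples of every other minimizer.\<close>
    have split: "wls_error \<Omega> K N f h = S (\<lambda>x. g0 x - h x) + wls_error \<Omega> K N f g0" if h: "h \<in> T" for h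
    proof -
      have hL: "h \<in> L2_unit" using h T by auto
      have "(\<lambda>x. (g0 x - h x) + (f x - g0 x)) = (\<lambda>x. f x - h x)" by (simp add: fun_eq_iff)
      then show ?thesis
        using pyth[OF Tdiff[OF g0 h] L2_diff[OF f g0L] orth0] by (simp add: err f hL g0L)
    qed
    have min0: "wls_reconstruction \<Omega> K N T f g0"
    proof -
      have "wls_error \<Omega> K N f g0 \<le> wls_error \<Omega> K N f h" if "h \<in> T" for h
        using split[OF that] S0[of "\<lambda>x. g0 x - h x"] by linarith
      then show ?thesis using g0 by (simp add: wls_reconstruction_def is_arg_min_linorder)
    qed
    have min: "g \<in> T" "\<And>i. i < N \<Longrightarrow> s g i = s g0 i" if g: "wls_reconstruction \<Omega> K N T f g" for g
    proof -
      show gT: "g \<in> T" using g by (simp add: wls_reconstruction_def is_arg_min_def)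
      have gL: "g \<in> L2_unit" using gT T by auto
      have "wls_error \<Omega> K N f g \<le> wls_error \<Omega> K N f g0"
        using g g0 by (simp add: wls_reconstruction_def is_arg_min_linorder)
      then have "S (\<lambda>x. g0 x - g x) = 0" using split[OF gT] S0[of "\<lambda>x. g0 x - g x"] by linarith
      then have all: "\<forall>i\<in>{..<N}. \<mu> i * (cmod (s (\<lambda>x. g0 x - g x) i))\<^sup>2 = 0"
        unfolding S_def by (subst (asm) sum_nonneg_eq_0_iff) (auto simp: \<mu>0 less_imp_le)
      show "s g i = s g0 i" if "i < N" for i
        using bspec[OF all, of i] that \<mu>0[OF that] by (simp add: s_diff[OF g0L gL])
    qed
    have uniq: "AE x in unit_leb. g x = g' x"
      if g: "wls_reconstruction \<Omega> K N T f g" "wls_reconstruction \<Omega> K N T f g'" for g g'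
    proof -
      have gT: "g \<in> T" "g' \<in> T" using min(1) g by auto
      then have gL: "g \<in> L2_unit" "g' \<in> L2_unit" using T by auto
      \<comment> \<open>Two minimizers have the same samples, and the lower frame bound makes an
        element of \<open>T\<close> with zero samples vanish almost everywhere.\<close>
      have "S (\<lambda>x. g x - g' x) = 0" unfolding S_def
        by (intro sum.neutral) (auto simp: s_diff[OF gL] min(2)[OF g(1)] min(2)[OF g(2)])
      then have "a\<^sup>2 * (L2_norm_unit (\<lambda>x. g x - g' x))\<^sup>2 \<le> 0" using Slow[OF Tdiff[OF gT]] by simp
      then have "L2_norm_unit (\<lambda>x. g x - g' x) = 0" using ab by (simp add: mult_le_0_iff)
      then have 0: "(\<integral>x. (cmod (g x - g' x))\<^sup>2 \<partial>unit_leb) = 0" by (simp add: L2_norm_unit_def)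
      have "integrable unit_leb (\<lambda>x. (cmod (g x - g' x))\<^sup>2)" using L2_diff[OF gL] by (simp add: L2_unit_def)
      then have "AE x in unit_leb. (cmod (g x - g' x))\<^sup>2 = 0"
        using 0 by (subst (asm) integral_nonneg_eq_0_iff_AE) auto
      then show ?thesis by eventually_elim simp
    qed
    have bound: "L2_norm_unit (\<lambda>x. f x - g x) \<le> b / a * (INF h\<in>T. L2_norm_unit (\<lambda>x. f x - h x)) \<and>
           L2_norm_unit g \<le> b / a * L2_norm_unit f" if g: "wls_reconstruction \<Omega> K N T f g" for g
    proof -
      have gT: "g \<in> T" using min(1) g by auto
      then have gL: "g \<in> L2_unit" using T by auto
      have "(\<Sum>i<N. \<mu> i * ((s f i - s g i) * cnj (s t i))) = 0" if "t \<in> T" for t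
      proof -
        have "(\<Sum>i<N. \<mu> i * ((s f i - s g i) * cnj (s t i))) = (\<Sum>i<N. \<mu> i * ((s f i - s g0 i) * cnj (s t i)))"
          by (intro sum.cong refl) (simp add: min(2)[OF g])
        then show ?thesis using o0[OF that] by simp
      qed
      then have o: "orth (\<lambda>x. f x - g x)" by (simp add: orth_def s_diff[OF f gL])
      have vL: "(\<lambda>x. f x - g x) \<in> L2_unit" by (rule L2_diff[OF f gL])
      have "L2_norm_unit (\<lambda>x. f x - g x) \<le> b / a * L2_norm_unit (\<lambda>x. f x - h x)" if h: "h \<in> T" for h
        \<comment> \<open>The decomposition is f - h = (g - h) + (f - g) with g - h in
          \<open>T\<close>. Since the error f - g is the same for all h, the infimum may be taken
          afterwards.\<close>
        using proj2[OF Tdiff[OF gT h] vL o] by (intro le L2_norm_unit_nonneg) (simp add: fun_eq_iff)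
      then have "L2_norm_unit (\<lambda>x. f x - g x) / (b / a) \<le> (INF h\<in>T. L2_norm_unit (\<lambda>x. f x - h x))"
        using T(2) ab by (intro cINF_greatest) (auto simp: field_simps)
      then have "L2_norm_unit (\<lambda>x. f x - g x) \<le> b / a * (INF h\<in>T. L2_norm_unit (\<lambda>x. f x - h x))"
        using ab by (simp add: field_simps)
      moreover have "L2_norm_unit g \<le> b / a * L2_norm_unit f"
        using proj1[OF gT vL o] by (intro le L2_norm_unit_nonneg) simp
      ultimately show ?thesis ..
    qed
    show "(\<exists>g. wls_reconstruction \<Omega> K N T f g) \<and>
        (\<forall>g g'. wls_reconstruction \<Omega> K N T f g \<longrightarrow> wls_reconstruction \<Omega> K N T f g' \<longrightarrow>
           (AE x in unit_leb. g x = g' x)) \<and>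
        (\<forall>g. wls_reconstruction \<Omega> K N T f g \<longrightarrow>
           L2_norm_unit (\<lambda>x. f x - g x) \<le> b / a * (INF h\<in>T. L2_norm_unit (\<lambda>x. f x - h x)) \<and>
           L2_norm_unit g \<le> b / a * L2_norm_unit f)"
      using min0 uniq bound by blast
  qed
qed

section \<open>Splines and the main theorem\<close>

lemma Ck_on_add_scale:
  assumes "Ck_on m S f" "Ck_on m S g"
  shows "Ck_on m S (\<lambda>x. f x + a * g x)"
proof -
  obtain D E where D: "\<forall>x\<in>S. D 0 x = f x"
      "\<forall>i<m. \<forall>x\<in>S. (D i has_vector_derivative D (Suc i) x) (at x within S)" "continuous_on S (D m)"
    and E: "\<forall>x\<in>S. E 0 x = g x"
      "\<forall>i<m. \<forall>x\<in>S. (E i has_vector_derivative E (Suc i) x) (at x within S)" "continuous_on S (E m)"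
    using assms unfolding Ck_on_def by blast
  show ?thesis unfolding Ck_on_def
  proof (intro exI[of _ "\<lambda>i x. D i x + a * E i x"] conjI allI impI ballI)
    show "continuous_on S (\<lambda>x. D m x + a * E m x)" using D(3) E(3) by (intro continuous_intros)
    fix i x assume "i < m" "x \<in> S"
    then show "((\<lambda>x. D i x + a * E i x) has_vector_derivative D (Suc i) x + a * E (Suc i) x) (at x within S)"
      using D(2) E(2) by (intro has_vector_derivative_add has_vector_derivative_mult_right) auto
  qed (use D(1) E(1) in auto)
qed

lemma spline_space_add_scale:
  assumes u: "u \<in> spline_space d k w" and v: "v \<in> spline_space d k w"
  shows "(\<lambda>x. u x + a * v x) \<in> spline_space d k w"
  unfolding spline_space_def
proof (intro CollectI conjI allI impI)
  show "Ck_on (d - 1) {0..1} (\<lambda>x. u x + a * v x)"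
    using u v by (intro Ck_on_add_scale) (auto simp: spline_space_def)
  fix j assume "j \<le> k"
  then obtain p q where p: "degree p \<le> d" "\<forall>x\<in>{w j..<w (j + 1)}. u x = poly p (of_real x)"
    and q: "degree q \<le> d" "\<forall>x\<in>{w j..<w (j + 1)}. v x = poly q (of_real x)"
    using u v unfolding spline_space_def by blast
  show "\<exists>p. degree p \<le> d \<and> (\<forall>x\<in>{w j..<w (j + 1)}. u x + a * v x = poly p (of_real x))"
    using p q degree_smult_le[of a q]
    by (intro exI[of _ "p + smult a q"]) (auto intro!: degree_add_le order_trans[OF degree_smult_le])
qed

lemma zero_in_spline_space: "(\<lambda>_. 0) \<in> spline_space d k w"
  unfolding spline_space_def Ck_on_def
  by (auto intro!: exI[of _ "\<lambda>_ _. 0"] exI[of _ "0 :: complex poly"])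

text \<open>The pieces are glued and extended by zero; the result is Borel and agrees with the
  spline at every point of (0,1), which also makes the spline measurable.\<close>

lemma spline_representative:
  assumes w: "w 0 = 0" "w (Suc k) = 1" "\<And>j. j \<le> k \<Longrightarrow> w j < w (Suc j)"
    and u: "u \<in> spline_space d k w"
  obtains p where "\<And>j. j \<le> k \<Longrightarrow> degree (p j) \<le> d" "unit_L2 (piecewise_poly k w p)"
    "u \<in> borel_measurable unit_leb" "AE x in unit_leb. u x = piecewise_poly k w p x"
proof -
  have "\<forall>j. \<exists>p. j \<le> k \<longrightarrow> degree p \<le> d \<and> (\<forall>x\<in>{w j..<w (Suc j)}. u x = poly p (of_real x))"
    using u unfolding spline_space_def by auto
  from choice[OF this] obtain p where p: "\<And>j. j \<le> k \<Longrightarrow> degree (p j) \<le> d"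
    "\<And>j x. j \<le> k \<Longrightarrow> x \<in> {w j..<w (Suc j)} \<Longrightarrow> u x = poly (p j) (of_real x)" by blast
  define F where "F = piecewise_poly k w p"
  have Fm [measurable]: "F \<in> borel_measurable borel"
    unfolding F_def by (rule piecewise_poly_measurable[of k w, OF w(3)])
  have F: "unit_L2 F"
  proof
    fix x :: real assume x: "x \<notin> {0..1}"
    have out: "x \<notin> {w j..<w (Suc j)}" if "j \<le> k" for j
      using x knots_mono[of k w 0 j, OF w(3)] knots_mono[of k w "Suc j" "Suc k", OF w(3)] that w(1,2) by auto
    show "F x = 0" unfolding F_def by (rule piecewise_poly_outside) (fact w(3) out)+
  qed (use Fm piecewise_poly_sq_integral(1)[of k w, OF w(3)] in \<open>auto simp: F_def\<close>)
  have uF: "u x = F x" if x: "x \<in> {0<..<1}" for x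
  proof -
    have "x \<in> {w 0..<w (Suc k)}" using x w(1,2) by auto
    then obtain j where j: "j \<le> k" "x \<in> {w j..<w (Suc j)}"
      using knot_interval_exists[of k w x k, OF w(3)] by blast
    then show ?thesis using p(2)[OF j] piecewise_poly_eq[of k w, OF w(3) j] by (simp add: F_def)
  qed
  have "F \<in> borel_measurable unit_leb"
    by (rule measurable_restrict_space1) (simp add: measurable_completion)
  then have "u \<in> borel_measurable unit_leb"
    by (rule measurable_cong[THEN iffD1, rotated]) (use uF in auto)
  moreover have "AE x in unit_leb. u x = F x"
    using uF by (intro AE_I2) auto
  ultimately show thesis using that[OF p(1)] F by (simp add: F_def)
qed

lemma sample_ext_properties:
  assumes dense: "uniformly_dense \<delta> \<Omega> K" and N: "N \<ge> 1" and K: "K N > 0"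
  defines "x \<equiv> sample_ext \<Omega> K N"
  shows "\<And>n. n \<le> N \<Longrightarrow> x n \<le> x (Suc n)" "\<And>n. n \<le> N \<Longrightarrow> x (Suc n) - x n \<le> \<delta>"
    "\<And>n. n \<in> {1..N} \<Longrightarrow> sample_weight \<Omega> K N n > 0"
    "\<And>n. n \<in> {1..N} \<Longrightarrow> x n = \<Omega> N n"
    "- K N \<le> \<Omega> N 1" "\<Omega> N N \<le> K N" "\<Omega> N 1 - \<Omega> N N + 2 * K N \<le> \<delta>"
proof -
  have sm: "strict_mono_on {1..N} (\<Omega> N)" and sub: "\<Omega> N ` {1..N} \<subseteq> {- K N..K N}"
    and mx: "(MAX n\<in>{0..N}. sample_ext \<Omega> K N (n + 1) - sample_ext \<Omega> K N n) \<le> \<delta>"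
    using dense N unfolding uniformly_dense_def by auto
  show xO: "\<And>n. n \<in> {1..N} \<Longrightarrow> x n = \<Omega> N n" by (auto simp: x_def sample_ext_def)
  have x0: "x 0 = \<Omega> N N - 2 * K N" and xN: "x (Suc N) = \<Omega> N 1 + 2 * K N"
    by (auto simp: x_def sample_ext_def)
  show b1: "- K N \<le> \<Omega> N 1" and bN: "\<Omega> N N \<le> K N" using sub N by force+
  have lt: "x n < x (Suc n)" if "1 \<le> n" "n < N" for n
    using strict_mono_onD[OF sm, of n "Suc n"] that by (simp add: xO)
  show le: "x n \<le> x (Suc n)" if n: "n \<le> N" for n
  proof -
    consider "n = 0" | "n = N" "n > 0" | "1 \<le> n" "n < N" using n by linarith
    then show ?thesis
    proof cases
      case 1
      then show ?thesis using b1 bN N by (simp add: x0 xO)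
    next
      case 2
      then show ?thesis using b1 bN N by (simp add: xN xO)
    qed (use lt in \<open>auto intro: less_imp_le\<close>)
  qed
  show gap: "x (Suc n) - x n \<le> \<delta>" if n: "n \<le> N" for n
  proof -
    have "sample_ext \<Omega> K N (n + 1) - sample_ext \<Omega> K N n
        \<le> (MAX n\<in>{0..N}. sample_ext \<Omega> K N (n + 1) - sample_ext \<Omega> K N n)"
      using n by (intro Max_ge) auto
    then show ?thesis using mx unfolding x_def Suc_eq_plus1 by linarith
  qed
  \<comment> \<open>The wrap-around gap: it forces the outermost nodes to lie close to the ends of
    the band.\<close>
  show "\<Omega> N 1 - \<Omega> N N + 2 * K N \<le> \<delta>" using gap[of 0] N by (simp add: x0 xO)
  show "sample_weight \<Omega> K N n > 0" if n: "n \<in> {1..N}" for n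
  proof -
    obtain m where m: "n = Suc m" "m < N" using n by (cases n) auto
    have "x m < x (Suc (Suc m))"
    \<comment> \<open>A single node has its own two periodic copies as neighbours, at total distance
      4 K_N; here positivity of the bandwidth is what counts. With more nodes, one of the two
      adjacent gaps is interior and hence strictly positive.\<close>
    proof (cases "N = 1")
      case True
      then show ?thesis using m K xN x0 by simp
    next
      case False
      then consider "Suc m < N" | "1 \<le> m" using m N by linarith
      then show ?thesis
        using lt[of "Suc m"] lt[of m] le[of m] le[of "Suc m"] m by cases auto
    qed
    then show ?thesis by (simp add: sample_weight_def x_def m)
  qed
qed

theorem mainTheorem5:
  fixes d :: nat and \<delta> \<epsilon> :: real
  assumes "d \<ge> 1" and "0 < \<delta>" and "\<delta> < 1" and "0 < \<epsilon>" and "\<epsilon> < 1 - \<delta>"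
  shows "\<exists>c>0. \<forall>(\<Omega> :: nat \<Rightarrow> nat \<Rightarrow> real) (K :: nat \<Rightarrow> real) (k :: nat) (w :: nat \<Rightarrow> real) (N :: nat).
           uniformly_dense \<delta> \<Omega> K \<longrightarrow>
           w 0 = 0 \<longrightarrow> w (k + 1) = 1 \<longrightarrow> (\<forall>j\<le>k. w j < w (j + 1)) \<longrightarrow>
           N \<ge> 1 \<longrightarrow>
           1 / (MIN j\<in>{0..k}. w (j + 1) - w j) \<le> c * K N \<longrightarrow>
           stable_quasi_optimal \<Omega> K N (spline_space d k w) ((1 + \<delta>) / (1 - \<epsilon> - \<delta>))"
proof (rule piecewise_poly_translation[of d], goal_cases)
  case (1 C)
  note C = 1(1) and trans = 1(2)
  \<comment> \<open>Chosen so that 1/\<eta> \<le> c K_N means \<sigma> K_N / 2 \<ge> 3/\<epsilon>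
    for \<sigma> = \<epsilon>\<eta>/C.\<close>
  define c where "c = \<epsilon>\<^sup>2 / (6 * C)"
  have c: "c > 0" using C assms by (simp add: c_def)
  \<comment> \<open>Together with \<eta> \<le> 1 this keeps K_N at least 1, so that K_N - 1/2 is
    still at least K_N / 2.\<close>
  have c1: "c \<le> 1 / 6"
  proof -
    have "\<epsilon>\<^sup>2 \<le> 1" using assms by (intro power_le_one) auto
    then show ?thesis using C by (simp add: c_def field_simps)
  qed
  have main: "stable_quasi_optimal \<Omega> K N (spline_space d k w) ((1 + \<delta>) / (1 - \<epsilon> - \<delta>))"
    if dense: "uniformly_dense \<delta> \<Omega> K" and w0: "w 0 = 0" and w1: "w (k + 1) = 1"
      and wm: "\<forall>j\<le>k. w j < w (j + 1)" and N: "N \<ge> 1"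
      and bound: "1 / (MIN j\<in>{0..k}. w (j + 1) - w j) \<le> c * K N"
    for \<Omega> :: "nat \<Rightarrow> nat \<Rightarrow> real" and K :: "nat \<Rightarrow> real" and k :: nat and w :: "nat \<Rightarrow> real" and N :: nat
  proof -
    have w: "w 0 = 0" "w (Suc k) = 1" "\<And>j. j \<le> k \<Longrightarrow> w j < w (Suc j)" using w0 w1 wm by auto
    define \<eta> where "\<eta> = (MIN j\<in>{0..k}. w (j + 1) - w j)"
    have \<eta>0: "\<eta> > 0" unfolding \<eta>_def using w by (subst Min_gr_iff) auto
    have \<eta>le: "\<eta> \<le> w (Suc j) - w j" if "j \<le> k" for j
      unfolding \<eta>_def using that by (intro Min_le) (auto intro!: image_eqI[of _ _ j])
    have "w (Suc 0) \<le> w (Suc k)" by (rule knots_mono[of k w, OF w(3)]) auto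
    then have \<eta>1: "\<eta> \<le> 1" using \<eta>le[of 0] w(1,2) by simp
    have cK: "1 / \<eta> \<le> c * K N" using bound by (simp add: \<eta>_def)
    have "1 \<le> 1 / \<eta>" using \<eta>0 \<eta>1 by simp
    then have "1 \<le> c * K N" using cK by linarith
    then have K0: "K N > 0" using c by (smt (verit) mult_nonneg_nonpos)
    have "c * K N \<le> 1 / 6 * K N" using c1 K0 by (intro mult_right_mono) auto
    then have K1: "K N \<ge> 1" using \<open>1 \<le> c * K N\<close> by linarith
    define x where "x = sample_ext \<Omega> K N"
    note xs = sample_ext_properties[OF dense N K0, folded x_def]
    \<comment> \<open>Midpoints of neighbouring nodes of the periodic continuation; the weight of a
      node is the length of its cell.\<close>
    define z where "z = (\<lambda>n. (x n + x (Suc n)) / 2)"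
    have zx: "z n \<le> \<Omega> N (Suc n)" "\<Omega> N (Suc n) \<le> z (Suc n)"
      "\<Omega> N (Suc n) - z n \<le> \<delta> / 2" "z (Suc n) - \<Omega> N (Suc n) \<le> \<delta> / 2" if "n < N" for n
      using xs(1)[of n] xs(1)[of "Suc n"] xs(2)[of n] xs(2)[of "Suc n"] xs(4)[of "Suc n"] that
      by (auto simp: z_def field_simps)
    have weight: "sample_weight \<Omega> K N (Suc n) = z (Suc n) - z n" for n
      by (simp add: sample_weight_def z_def x_def field_simps)
    have shift: "(\<Sum>n=1..N. g n) = (\<Sum>i<N. g (Suc i))" for g :: "nat \<Rightarrow> real"
      by (simp add: sum.atLeast1_atMost_eq lessThan_atLeast0)
    \<comment> \<open>The cells fill the interval of radius K_N around the mean of the first and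
      last node. By the wrap-around gap and the bounds on the nodes, this mean has modulus at most
      \<delta>/2, which is below 1/2.\<close>
    define R where "R = K N - 1 / 2"
    have "z 0 = (\<Omega> N N + \<Omega> N 1) / 2 - K N" "z N = (\<Omega> N N + \<Omega> N 1) / 2 + K N"
      using xs(4)[of 1] xs(4)[of N] N by (auto simp: z_def) (auto simp: x_def sample_ext_def field_simps)
    then have zR: "z 0 \<le> - R" "R \<le> z N"
      using xs(5,6,7) assms(3) by (auto simp: R_def field_simps)
    have R: "R \<ge> K N / 2" using K1 by (simp add: R_def)
    show ?thesis
    proof (rule stable_quasi_optimalI)
      show "spline_space d k w \<subseteq> L2_unit"
      proof
        fix u assume "u \<in> spline_space d k w"
        from spline_representative[OF w this] obtain p where
          "unit_L2 (piecewise_poly k w p)" "u \<in> borel_measurable unit_leb"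
          "AE x in unit_leb. u x = piecewise_poly k w p x" by blast
        then show "u \<in> L2_unit" by (rule unit_L2_representative(1))
      qed
      show "0 < 1 - \<epsilon> - \<delta>" "1 - \<epsilon> - \<delta> \<le> 1 + \<delta>" using assms by auto
      show "sample_weight \<Omega> K N n > 0" if "n \<in> {1..N}" for n using xs(3)[OF that] .
    next
      fix f assume f: "f \<in> L2_unit"
      then obtain F where F: "unit_L2 F" "AE x in unit_leb. f x = F x"
        by (rule L2_unit_representative_exists)
      have fm: "f \<in> borel_measurable unit_leb" using f by (simp add: L2_unit_def)
      note rep = unit_L2_representative[OF F(1) fm F(2)]
      show "(\<Sum>n=1..N. sample_weight \<Omega> K N n * (cmod (fourier_unit f (\<Omega> N n)))\<^sup>2)
          \<le> (1 + \<delta>)\<^sup>2 * (L2_norm_unit f)\<^sup>2"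
        unfolding shift rep(2,3) weight
        by (rule unit_L2.sampling_upper[OF F(1) assms(2)]) (use zx in auto)
    next
      fix u assume u: "u \<in> spline_space d k w"
      obtain p where p: "\<And>j. j \<le> k \<Longrightarrow> degree (p j) \<le> d" "unit_L2 (piecewise_poly k w p)"
        "u \<in> borel_measurable unit_leb" "AE x in unit_leb. u x = piecewise_poly k w p x"
        using spline_representative[OF w u] by blast
      define F where "F = piecewise_poly k w p"
      interpret F: unit_L2 F using p(2) by (simp add: F_def)
      note rep = unit_L2_representative[OF p(2-4), folded F_def]
      \<comment> \<open>Makes the translation loss \<open>C * \<sigma> / (2 * \<eta>)\<close> equal
        to \<epsilon>/2.\<close>
      define \<sigma> where "\<sigma> = \<epsilon> * \<eta> / C"
      have \<sigma>: "\<sigma> > 0" using assms \<eta>0 C by (simp add: \<sigma>_def)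
      have "3 / \<epsilon> \<le> \<sigma> * R"
      proof -
        have "6 * C / (\<epsilon>\<^sup>2 * \<eta>) = 1 / \<eta> / c" using assms C by (simp add: c_def)
        also have "\<dots> \<le> K N" using divide_right_mono[OF cK, of c] c by simp
        finally have KN: "6 * C / (\<epsilon>\<^sup>2 * \<eta>) \<le> K N" .
        have "3 / \<epsilon> = \<sigma> * ((6 * C / (\<epsilon>\<^sup>2 * \<eta>)) / 2)"
          using assms \<eta>0 C by (simp add: \<sigma>_def field_simps power2_eq_square)
        also have "\<dots> \<le> \<sigma> * R"
          using order_trans[OF divide_right_mono[OF KN, of 2] R] \<sigma>
          by (simp only: mult_left_mono less_imp_le zero_le_numeral)
        finally show ?thesis .
      qed
      then have "(3 / \<epsilon>)\<^sup>2 \<le> (\<sigma> * R)\<^sup>2" using assms by (intro power_mono) auto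
      then have y: "9 / (4 * \<epsilon>\<^sup>2) \<le> (\<sigma> * R)\<^sup>2 / 4" by (simp add: power_divide)
      \<comment> \<open>The tail gets the other half of \<epsilon>: since exp(y) exceeds y, the
        bound \<sigma>R \<ge> 3/\<epsilon> gives at most 4\<epsilon>^2/9, and \<epsilon> <
        1.\<close>
      have "exp (- (\<sigma> * R)\<^sup>2 / 4) \<le> \<epsilon> / 2"
      proof -
        have "9 / (4 * \<epsilon>\<^sup>2) \<le> exp ((\<sigma> * R)\<^sup>2 / 4)"
          using y exp_ge_add_one_self[of "(\<sigma> * R)\<^sup>2 / 4"] by linarith
        then have "inverse (exp ((\<sigma> * R)\<^sup>2 / 4)) \<le> inverse (9 / (4 * \<epsilon>\<^sup>2))"
          using assms by (intro le_imp_inverse_le) auto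
        also have "\<dots> = \<epsilon> * (4 * \<epsilon> / 9)" by (simp add: power2_eq_square)
        also have "\<dots> \<le> \<epsilon> * (1 / 2)" using assms by (intro mult_left_mono) auto
        finally show ?thesis by (simp add: exp_minus)
      qed
      moreover have "C * \<sigma> / (2 * \<eta>) = \<epsilon> / 2" using \<eta>0 C by (simp add: \<sigma>_def)
      ultimately have "1 - \<epsilon> \<le> 1 - C * \<sigma> / (2 * \<eta>) - exp (- (\<sigma> * R)\<^sup>2 / 4)" by linarith
      \<comment> \<open>The retained mass fraction 1 - \<epsilon> is weakened to a square so that
        \<beta> = 1 - \<epsilon> can be used in \<open>sampling_lower\<close>; it exceeds \<delta>
        because \<epsilon> < 1 - \<delta>.\<close>
      moreover have "(1 - \<epsilon>)\<^sup>2 \<le> 1 - \<epsilon>"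
        using assms by (simp add: power2_eq_square mult_left_le)
      ultimately have "(1 - \<epsilon>)\<^sup>2 * sq_norm F \<le> (1 - C * \<sigma> / (2 * \<eta>) - exp (- (\<sigma> * R)\<^sup>2 / 4)) * sq_norm F"
        by (intro mult_right_mono F.sq_norm_nonneg) linarith
      also have "\<dots> \<le> integral {-R..R} (\<lambda>\<omega>. (cmod (centred_fourier F \<omega>))\<^sup>2)"
      proof (rule F.fourier_concentration[OF _ \<eta>0 _ \<sigma>])
        show "(\<integral>x. (cmod (F (x + t) - F x))\<^sup>2 \<partial>lborel) \<le> 5 * C * \<bar>t\<bar> / \<eta> * sq_norm F" for t
          unfolding F_def sq_norm_def by (rule trans) (use w \<eta>0 \<eta>le p(1) in auto)
      qed (use C R K0 in auto)
      also have "\<dots> \<le> integral {z 0..z N} (\<lambda>\<omega>. (cmod (centred_fourier F \<omega>))\<^sup>2)"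
        using zR by (intro integral_subset_le integrable_continuous_interval continuous_intros
            F.continuous_centred_fourier) auto
      finally have low: "(1 - \<epsilon>)\<^sup>2 * sq_norm F \<le> \<dots>" .
      have "(1 - \<epsilon> - \<delta>)\<^sup>2 * sq_norm F
          \<le> (\<Sum>n<N. (z (Suc n) - z n) * (cmod (centred_fourier F (\<Omega> N (Suc n))))\<^sup>2)"
        by (rule F.sampling_lower[OF assms(2)]) (use zx assms low in auto)
      then show "(1 - \<epsilon> - \<delta>)\<^sup>2 * (L2_norm_unit u)\<^sup>2
          \<le> (\<Sum>n=1..N. sample_weight \<Omega> K N n * (cmod (fourier_unit u (\<Omega> N n)))\<^sup>2)"
        unfolding shift rep(2,3) weight .
    qed (use zero_in_spline_space spline_space_add_scale in auto)
  qed
  show ?case using c main by blast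
qed

end
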